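(* Let $\Gamma=(m_{i,j})_{n\times n}$ be a Coxeter matrix of finite type (i.e. the Coxeter group $W_\Gamma$ is finite), and let $(\Pi,\kappa)$ be parameters for which the BMW type algebra $B_\Gamma(\Pi,\kappa)$ is defined. Then $B_\Gamma(\Pi,\kappa)$ is a finite dimensional algebra over $\mathbb{C}$.
   Context: **Words.** $[xy\cdots]_r$ is the word of length $r$ in which $x,y$ alternate, beginning with $x$. **Dihedral setting.** For an integer $m\ge 2$ let $D_m$ be the dihedral group of order $2m$ acting on $\mathbb{R}^2$ and on its complexification $\mathbb{C}^2$. For $0\le i\le m-1$ let $H_i$ be the line through $0$ making angle $i\pi/m$ (anticlockwise) with the $x$-axis (and also its complexification), $s_i$ the reflection in $H_i$, $f_i$ a linear form on $\mathbb{C}^2$ with kernel $H_i$, $\omega_i=df_i/f_i$, and $M_m=\mathbb{C}^2\setminus\bigcup_i H_i$. Write $w(H_i)=H_{w(i)}$ for $w\in D_m$. The Artin group is $A_{D_m}=\pi_1(M_m/D_m)=\langle \sigma_0,\sigma_1\mid[\sigma_0\sigma_1\cdots]_m=[\sigma_1\sigma_0\cdots]_m\rangle$; the base point is the image of a point $p$ in the open real sector between $H_0$ and $H_1$, and $\sigma_i$ ($i=0,1$) is the class of the image of the path which follows the segment from $p$ to $s_i(p)$ except that near $H_i$ it follows the small half circle $t\mapsto p_i'-(1-e^{\pi\sqrt{-1}t})\frac{\langle p_i',a_i\rangle}{\langle a_i,a_i\rangle}a_i$, $t\in[0,1]$, where $a_i=s_i(p)-p$ and $p_i'$ is the point of the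 segment slightly before it meets $H_i$. Let $V$ be the complex vector space with basis $v_0,\dots,v_{m-1}$ and $\iota(w)v_i=v_{w(i)}$ the permutation representation of $D_m$. **Lawrence-Krammer representation $T_{LK}$.** If $m$ is odd, take $k\in\mathbb{C}^\times,\alpha\in\mathbb{C}$, $\Pi=(k,\alpha)$, and put $k_i=k,\alpha_i=\alpha$ for all $0\le i\le m-1$. If $m$ is even, take $k_0,k_1\in\mathbb{C}^\times$, $\alpha_0,\alpha_1\in\mathbb{C}$, $\Pi=(k_0,k_1,\alpha_0,\alpha_1)$, and for $0\le i\le m-1$ put $k_i=k_0,\alpha_i=\alpha_0$ for $i$ even and $k_i=k_1,\alpha_i=\alpha_1$ for $i$ odd. Define $p_i\in\mathrm{End}(V)$ by $p_i(v_i)=\alpha_iv_i$ and $p_i(v_j)=\big(\sum_{t:\,s_t(H_j)=H_i}k_t\big)v_i$ for $j\ne i$. The connection $\Omega_m=\kappa\sum_{i=0}^{m-1}(k_i\iota(s_i)-p_i)\omega_i$ on $M_m\times V$ is flat and $D_m$-invariant, so it induces a flat connection on the quotient bundle $(M_m\times V)/D_m$ over $M_m/D_m$; $T_{LK}:A_{D_m}\to GL(V)$ is its monodromy representation (flat sections satisfy $dF=\Omega_m F$, so that for generic $\kappa$, $T_{LK}(\sigma_i)$ is conjugate to $\iota(s_i)\exp(\pi\sqrt{-1}\,\kappa(k_i\iota(s_i)-p_i))$). **The functions $\Phi$.** For $i=0,1$ put $q_i=\exp(\kappa k_i\pi\sqrt{-1})$, $l_i=\exp(\kappa\alpha_i\pi\sqrt{-1})/q_i$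 and $e_i=\frac{l_i}{q_i^{-1}-q_i}(T_{LK}(\sigma_i)-q_i)(T_{LK}(\sigma_i)+q_i^{-1})$; for generic parameters $e_i$ has rank one. Let $\Lambda$ be the free monoid on $X_0,X_1,E_0,E_1$ and $f:\Lambda\to\mathrm{End}(V)$ the monoid morphism with $f(X_i)=T_{LK}(\sigma_i)$, $f(E_i)=e_i$. For generic $(\Pi,\kappa)$, $\Phi^i_{m,\Pi,\kappa}:\Lambda\to\mathbb{C}$ is defined by $e_if(X)e_i=\Phi^i_{m,\Pi,\kappa}(X)e_i$. **The algebra $B_\Gamma(\Pi,\kappa)$.** Let $W_\Gamma$ be the Coxeter group with Coxeter matrix $\Gamma=(m_{i,j})_{n\times n}$ and Coxeter generators $s_1,\dots,s_n$. Choose $(k_i,\alpha_i)\in\mathbb{C}^\times\times\mathbb{C}$, $1\le i\le n$, with $(k_i,\alpha_i)=(k_j,\alpha_j)$ whenever $s_i,s_j$ are conjugate; $\Pi=\{(k_i,\alpha_i)\}$, $\kappa\in\mathbb{C}$, $q_i=\exp(\kappa\sqrt{-1}\pi k_i)$, $l_i=\exp(\kappa\alpha_i\pi\sqrt{-1})/q_i$. For $i<j$ let $\Pi_{i,j}=\{(k_i,\alpha_i),(k_j,\alpha_j)\}$, let $\Lambda_{i,j}$ be the free monoid on $X_i,E_i,X_j,E_j$, and let $\Phi^i_{m_{i,j},\Pi_{i,j},\kappa},\Phi^j_{m_{i,j},\Pi_{i,j},\kappa}:\Lambda_{i,j}\to\mathbb{C}$ be the functions $\Phi^0,\Phi^1$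 of the dihedral group $D_{m_{i,j}}$ with $X_0,E_0,X_1,E_1$ renamed $X_i,E_i,X_j,E_j$ and parameters $(k_0,\alpha_0)=(k_i,\alpha_i)$, $(k_1,\alpha_1)=(k_j,\alpha_j)$ (these coincide if $m_{i,j}$ is odd). $B_\Gamma(\Pi,\kappa)$ is the $\mathbb{C}$-algebra generated by $X_i^{\pm},E_i$ ($1\le i\le n$), where $X_i=X_i^{+}$, with relations: (1) $X_iX_i^-=X_i^-X_i=1$ for any $i$; (2) $[X_iX_j\cdots]_{m_{i,j}}=[X_jX_i\cdots]_{m_{i,j}}$ for any $i\ne j$; (3) $(q_i^{-1}-q_i)E_i=l_i(X_i-q_i)(X_i+q_i^{-1})$ for any $i$; (4) $X_iE_i=E_iX_i=l_i^{-1}E_i$ for any $i$; (5) $E_iXE_i=\Phi^i_{m_{i,j},\Pi_{i,j},\kappa}(X)E_i$ and $E_jXE_j=\Phi^j_{m_{i,j},\Pi_{i,j},\kappa}(X)E_j$ for any $i<j$ (including pairs with $m_{i,j}=2$) and any $X\in\Lambda_{i,j}$; (6) $E_iXE_j=0=E_jXE_i$ for any $X\in\Lambda_{i,j}$ if $m_{i,j}$ is an even number greater than $2$. The algebra is defined for generic parameters, namely such that all $q_i^2\neq1$ and all the operators $e_i$ used above have rank one. *)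

theory Defs
  imports
    "HOL-Analysis.Derivative"
    "HOL-Analysis.Path_Connected"
    "HOL-Algebra.QuotRing"
    "HOL-Library.Poly_Mapping"
    "Jordan_Normal_Form.DL_Rank"
begin

section \<open>Coxeter groups\<close>

text \<open>Generators are indexed by \<open>0, \<dots>, n - 1\<close>.  The entry \<open>0\<close> encodes \<open>\<infinity>\<close>.\<close>

definition coxeter_matrix :: "nat \<Rightarrow> (nat \<Rightarrow> nat \<Rightarrow> nat) \<Rightarrow> bool" where
  "coxeter_matrix n M \<longleftrightarrow>
     (\<forall>i<n. M i i = 1) \<and>
     (\<forall>i<n. \<forall>j<n. M i j = M j i) \<and>
     (\<forall>i<n. \<forall>j<n. i \<noteq> j \<longrightarrow> M i j \<noteq> 1)"

text \<open>The relator \<open>(s\<^sub>i s\<^sub>j)^(M i j)\<close>; it is \<open>s\<^sub>i\<^sup>2\<close> for \<open>i = j\<close> and empty for \<open>M i j = \<infinity>\<close>.\<close>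

inductive cox_step :: "nat \<Rightarrow> (nat \<Rightarrow> nat \<Rightarrow> nat) \<Rightarrow> nat list \<Rightarrow> nat list \<Rightarrow> bool" for n M where
  "i < n \<Longrightarrow> j < n \<Longrightarrow> cox_step n M (u @ concat (replicate (M i j) [i, j]) @ v) (u @ v)"

definition cox_rel :: "nat \<Rightarrow> (nat \<Rightarrow> nat \<Rightarrow> nat) \<Rightarrow> (nat list \<times> nat list) set" where
  "cox_rel n M = {(u, v). u \<in> lists {..<n} \<and> v \<in> lists {..<n} \<and> equivclp (cox_step n M) u v}"

text \<open>As the generators are involutions, the presentation by words in the generators
  (without formal inverses) gives the group.\<close>

definition coxeter_group :: "nat \<Rightarrow> (nat \<Rightarrow> nat \<Rightarrow> nat) \<Rightarrow> nat list set monoid" where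
  "coxeter_group n M =
     \<lparr>carrier = lists {..<n} // cox_rel n M,
      mult = (\<lambda>A B. \<Union>a\<in>A. \<Union>b\<in>B. cox_rel n M `` {a @ b}),
      one = cox_rel n M `` {[]}\<rparr>"

definition cox_gen :: "nat \<Rightarrow> (nat \<Rightarrow> nat \<Rightarrow> nat) \<Rightarrow> nat \<Rightarrow> nat list set" where
  "cox_gen n M i = cox_rel n M `` {[i]}"

definition cox_conjugate :: "nat \<Rightarrow> (nat \<Rightarrow> nat \<Rightarrow> nat) \<Rightarrow> nat \<Rightarrow> nat \<Rightarrow> bool" where
  "cox_conjugate n M i j \<longleftrightarrow>
     (\<exists>g \<in> carrier (coxeter_group n M).
        g \<otimes>\<^bsub>coxeter_group n M\<^esub> cox_gen n M i \<otimes>\<^bsub>coxeter_group n M\<^esub> inv\<^bsub>coxeter_group n M\<^esub> g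
          = cox_gen n M j)"

fun alt :: "'a \<Rightarrow> 'a \<Rightarrow> nat \<Rightarrow> 'a list" where
  "alt x y 0 = []"
| "alt x y (Suc r) = x # alt y x r"


section \<open>The dihedral arrangement and the Lawrence--Krammer connection\<close>

text \<open>\<open>\<complex>\<^sup>2\<close> is \<^typ>\<open>complex \<times> complex\<close>, and \<open>\<real>\<^sup>2\<close> sits inside as the pairs with real coordinates.\<close>

definition cscale :: "complex \<Rightarrow> complex \<times> complex \<Rightarrow> complex \<times> complex" where
  "cscale c z = (c * fst z, c * snd z)"

definition line_form :: "nat \<Rightarrow> nat \<Rightarrow> complex \<times> complex \<Rightarrow> complex" where
  "line_form m i z =
     of_real (cos (real i * pi / real m)) * snd z - of_real (sin (real i * pi / real m)) * fst z"

definition hline :: "nat \<Rightarrow> nat \<Rightarrow> (complex \<times> complex) set" where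
  "hline m i = {z. line_form m i z = 0}"

definition reflection :: "nat \<Rightarrow> nat \<Rightarrow> complex \<times> complex \<Rightarrow> complex \<times> complex" where
  "reflection m i z =
     (of_real (cos (2 * real i * pi / real m)) * fst z + of_real (sin (2 * real i * pi / real m)) * snd z,
      of_real (sin (2 * real i * pi / real m)) * fst z - of_real (cos (2 * real i * pi / real m)) * snd z)"

definition open_sector :: "nat \<Rightarrow> (complex \<times> complex) set" where
  "open_sector m =
     {(of_real (r * cos t), of_real (r * sin t)) | r t. 0 < r \<and> 0 < t \<and> t < pi / real m}"

text \<open>The matrix of \<open>\<iota>(s\<^sub>i)\<close> in the basis \<open>v\<^sub>0, \<dots>, v\<^sub>m\<^sub>-\<^sub>1\<close>; columns are images of basis vectors.\<close>

definition perm_mat :: "nat \<Rightarrow> nat \<Rightarrow> complex mat" where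
  "perm_mat m i = mat m m (\<lambda>(a, b). if reflection m i ` hline m b = hline m a then 1 else 0)"

text \<open>The dihedral parameters are given by \<open>k 0, k 1, \<alpha> 0, \<alpha> 1\<close>, with \<open>k\<^sub>t = k (t mod 2)\<close> and
  \<open>\<alpha>\<^sub>t = \<alpha> (t mod 2)\<close>.  For odd \<open>m\<close> they are used only with \<open>k 0 = k 1\<close> and \<open>\<alpha> 0 = \<alpha> 1\<close>.\<close>

definition proj_mat :: "nat \<Rightarrow> (nat \<Rightarrow> complex) \<Rightarrow> (nat \<Rightarrow> complex) \<Rightarrow> nat \<Rightarrow> complex mat" where
  "proj_mat m k \<alpha> i = mat m m (\<lambda>(a, b).
     if a \<noteq> i then 0
     else if b = i then \<alpha> (i mod 2)
     else (\<Sum>t \<in> {t. t < m \<and> reflection m t ` hline m b = hline m i}. k (t mod 2)))"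

text \<open>The value of the matrix-valued 1-form \<open>\<Omega>\<^sub>m\<close> at the point \<open>z\<close> on the tangent vector \<open>u\<close>.\<close>

definition Omega ::
  "nat \<Rightarrow> (nat \<Rightarrow> complex) \<Rightarrow> (nat \<Rightarrow> complex) \<Rightarrow> complex \<Rightarrow>
   complex \<times> complex \<Rightarrow> complex \<times> complex \<Rightarrow> complex mat" where
  "Omega m k \<alpha> \<kappa> z u = mat m m (\<lambda>ab.
     \<kappa> * (\<Sum>i<m. (k (i mod 2) * (perm_mat m i $$ ab) - proj_mat m k \<alpha> i $$ ab)
                   * (line_form m i u / line_form m i z)))"

text \<open>\<open>F\<close> is a flat section (\<open>dF = \<Omega> F\<close>) along the piecewise differentiable path \<open>\<gamma>\<close>.\<close>

definition flat_along ::
  "nat \<Rightarrow> (nat \<Rightarrow> complex) \<Rightarrow> (nat \<Rightarrow> complex) \<Rightarrow> complex \<Rightarrow>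
   (real \<Rightarrow> complex \<times> complex) \<Rightarrow> (real \<Rightarrow> complex vec) \<Rightarrow> bool" where
  "flat_along m k \<alpha> \<kappa> \<gamma> F \<longleftrightarrow>
     (\<forall>t\<in>{0..1}. F t \<in> carrier_vec m) \<and>
     (\<forall>a<m. continuous_on {0..1} (\<lambda>t. vec_index (F t) a)) \<and>
     (\<exists>S. finite S \<and> (\<forall>t\<in>{0<..<1} - S.
        \<gamma> differentiable (at t) \<and>
        (\<forall>a<m. ((\<lambda>t. vec_index (F t) a) has_vector_derivative
                 vec_index (Omega m k \<alpha> \<kappa> (\<gamma> t) (vector_derivative \<gamma> (at t)) *\<^sub>v F t) a) (at t))))"

definition parallel_transport ::
  "nat \<Rightarrow> (nat \<Rightarrow> complex) \<Rightarrow> (nat \<Rightarrow> complex) \<Rightarrow> complex \<Rightarrow>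
   (real \<Rightarrow> complex \<times> complex) \<Rightarrow> complex mat" where
  "parallel_transport m k \<alpha> \<kappa> \<gamma> =
     (THE P. P \<in> carrier_mat m m \<and> (\<forall>F. flat_along m k \<alpha> \<kappa> \<gamma> F \<longrightarrow> F 1 = P *\<^sub>v F 0))"

text \<open>The path from \<open>p\<close> to \<open>s\<^sub>i(p)\<close> lifting \<open>\<sigma>\<^sub>i\<close>.  The segment meets \<open>H\<^sub>i\<close> at its midpoint, and
  the point \<open>p\<^sub>i'\<close> before it is \<open>p + (1 - \<epsilon>)/2 (s\<^sub>i(p) - p)\<close>, where \<open>0 < \<epsilon> < 1\<close>.\<close>

definition before_pt :: "nat \<Rightarrow> complex \<times> complex \<Rightarrow> real \<Rightarrow> nat \<Rightarrow> complex \<times> complex" where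
  "before_pt m p \<epsilon> i = p + ((1 - \<epsilon>) / 2) *\<^sub>R (reflection m i p - p)"

definition half_circle ::
  "complex \<times> complex \<Rightarrow> complex \<times> complex \<Rightarrow> real \<Rightarrow> complex \<times> complex" where
  "half_circle a p' t =
     p' - cscale ((1 - exp (of_real (pi * t) * \<i>)) * of_real (inner p' a / inner a a)) a"

definition sigma_path ::
  "nat \<Rightarrow> complex \<times> complex \<Rightarrow> real \<Rightarrow> nat \<Rightarrow> real \<Rightarrow> complex \<times> complex" where
  "sigma_path m p \<epsilon> i =
     linepath p (before_pt m p \<epsilon> i) +++
     (half_circle (reflection m i p - p) (before_pt m p \<epsilon> i) +++
      linepath (reflection m i (before_pt m p \<epsilon> i)) (reflection m i p))"

text \<open>The image of \<open>\<sigma>\<^sub>i\<close> (\<open>i = 0, 1\<close>) under \<open>T\<^sub>L\<^sub>K\<close>.  In the quotient bundle \<open>(x, v)\<close> is identified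
  with \<open>(w x, \<iota>(w) v)\<close>, so the transported vector \<open>v\<close> over \<open>s\<^sub>i(p)\<close> becomes \<open>\<iota>(s\<^sub>i) v\<close> over \<open>p\<close>.\<close>

definition T_LK ::
  "nat \<Rightarrow> complex \<times> complex \<Rightarrow> real \<Rightarrow> (nat \<Rightarrow> complex) \<Rightarrow> (nat \<Rightarrow> complex) \<Rightarrow> complex \<Rightarrow>
   nat \<Rightarrow> complex mat" where
  "T_LK m p \<epsilon> k \<alpha> \<kappa> i = perm_mat m i * parallel_transport m k \<alpha> \<kappa> (sigma_path m p \<epsilon> i)"

definition q_par :: "(nat \<Rightarrow> complex) \<Rightarrow> complex \<Rightarrow> nat \<Rightarrow> complex" where
  "q_par k \<kappa> i = exp (\<kappa> * k i * of_real pi * \<i>)"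

definition l_par :: "(nat \<Rightarrow> complex) \<Rightarrow> (nat \<Rightarrow> complex) \<Rightarrow> complex \<Rightarrow> nat \<Rightarrow> complex" where
  "l_par k \<alpha> \<kappa> i = exp (\<kappa> * \<alpha> i * of_real pi * \<i>) / q_par k \<kappa> i"

definition e_LK ::
  "nat \<Rightarrow> complex \<times> complex \<Rightarrow> real \<Rightarrow> (nat \<Rightarrow> complex) \<Rightarrow> (nat \<Rightarrow> complex) \<Rightarrow> complex \<Rightarrow>
   nat \<Rightarrow> complex mat" where
  "e_LK m p \<epsilon> k \<alpha> \<kappa> i =
     (l_par k \<alpha> \<kappa> i / (inverse (q_par k \<kappa> i) - q_par k \<kappa> i)) \<cdot>\<^sub>m
       ((T_LK m p \<epsilon> k \<alpha> \<kappa> i - q_par k \<kappa> i \<cdot>\<^sub>m 1\<^sub>m m) *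
        (T_LK m p \<epsilon> k \<alpha> \<kappa> i + inverse (q_par k \<kappa> i) \<cdot>\<^sub>m 1\<^sub>m m))"


section \<open>The functions Phi\<close>

text \<open>\<open>Xm i\<close> is the letter \<open>X\<^sub>i\<^sup>-\<close>.  The free monoid \<open>\<Lambda>\<close> does not involve it.\<close>

datatype 'a gen = X 'a | Xm 'a | E 'a

definition Lambda :: "nat gen list set" where
  "Lambda = lists {X 0, X 1, E 0, E 1}"

fun letter_val ::
  "nat \<Rightarrow> complex \<times> complex \<Rightarrow> real \<Rightarrow> (nat \<Rightarrow> complex) \<Rightarrow> (nat \<Rightarrow> complex) \<Rightarrow> complex \<Rightarrow>
   nat gen \<Rightarrow> complex mat" where
  "letter_val m p \<epsilon> k \<alpha> \<kappa> (X i) = T_LK m p \<epsilon> k \<alpha> \<kappa> i"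
| "letter_val m p \<epsilon> k \<alpha> \<kappa> (E i) = e_LK m p \<epsilon> k \<alpha> \<kappa> i"
| "letter_val m p \<epsilon> k \<alpha> \<kappa> (Xm i) = undefined"

definition word_val ::
  "nat \<Rightarrow> complex \<times> complex \<Rightarrow> real \<Rightarrow> (nat \<Rightarrow> complex) \<Rightarrow> (nat \<Rightarrow> complex) \<Rightarrow> complex \<Rightarrow>
   nat gen list \<Rightarrow> complex mat" where
  "word_val m p \<epsilon> k \<alpha> \<kappa> w = foldr (\<lambda>g A. letter_val m p \<epsilon> k \<alpha> \<kappa> g * A) w (1\<^sub>m m)"

definition Phi ::
  "nat \<Rightarrow> complex \<times> complex \<Rightarrow> real \<Rightarrow> (nat \<Rightarrow> complex) \<Rightarrow> (nat \<Rightarrow> complex) \<Rightarrow> complex \<Rightarrow>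
   nat \<Rightarrow> nat gen list \<Rightarrow> complex" where
  "Phi m p \<epsilon> k \<alpha> \<kappa> i w =
     (THE c. e_LK m p \<epsilon> k \<alpha> \<kappa> i * word_val m p \<epsilon> k \<alpha> \<kappa> w * e_LK m p \<epsilon> k \<alpha> \<kappa> i
             = c \<cdot>\<^sub>m e_LK m p \<epsilon> k \<alpha> \<kappa> i)"


section \<open>The BMW type algebra\<close>

text \<open>Words form a monoid under concatenation; with this instance, \<^typ>\<open>'a list \<Rightarrow>\<^sub>0 complex\<close> is
  the free associative algebra on \<^typ>\<open>'a\<close>.\<close>

instantiation list :: (type) monoid_add
begin
definition zero_list :: "'a list" where "zero_list = []"
definition plus_list :: "'a list \<Rightarrow> 'a list \<Rightarrow> 'a list" where "plus_list = (@)"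
instance by standard (simp_all add: zero_list_def plus_list_def)
end

type_synonym falg = "nat gen list \<Rightarrow>\<^sub>0 complex"

abbreviation mon :: "nat gen list \<Rightarrow> falg" where
  "mon w \<equiv> Poly_Mapping.single w 1"

abbreviation cst :: "complex \<Rightarrow> falg" where
  "cst c \<equiv> Poly_Mapping.single [] c"

definition free_algebra :: "nat \<Rightarrow> falg ring" where
  "free_algebra n =
     \<lparr>carrier = {f. Poly_Mapping.keys f \<subseteq> lists (X ` {..<n} \<union> Xm ` {..<n} \<union> E ` {..<n})},
      mult = (*), one = 1, zero = 0, add = (+)\<rparr>"

text \<open>\<open>\<Lambda>\<^sub>i\<^sub>,\<^sub>j\<close> is \<open>\<Lambda>\<close> with the indices \<open>0, 1\<close> renamed to \<open>i, j\<close>, and \<open>\<Pi>\<^sub>i\<^sub>,\<^sub>j\<close> is given by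
  \<open>pair_par k i j\<close> and \<open>pair_par \<alpha> i j\<close>.\<close>

definition rename :: "nat \<Rightarrow> nat \<Rightarrow> nat gen list \<Rightarrow> nat gen list" where
  "rename i j = map (map_gen (\<lambda>t. if t = 0 then i else j))"

definition pair_par :: "(nat \<Rightarrow> complex) \<Rightarrow> nat \<Rightarrow> nat \<Rightarrow> nat \<Rightarrow> complex" where
  "pair_par k i j t = (if t = 0 then k i else k j)"

text \<open>Elements of the free algebra that become zero in \<open>B\<^sub>\<Gamma>(\<Pi>, \<kappa>)\<close>.  The base point used for the
  dihedral group \<open>D\<^sub>m\<close> is \<open>p m\<close>.  There are no dihedral relations when \<open>M i j = \<infinity>\<close>.\<close>

inductive_set BMW_relators ::
  "nat \<Rightarrow> (nat \<Rightarrow> nat \<Rightarrow> nat) \<Rightarrow> (nat \<Rightarrow> complex \<times> complex) \<Rightarrow> real \<Rightarrow>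
   (nat \<Rightarrow> complex) \<Rightarrow> (nat \<Rightarrow> complex) \<Rightarrow> complex \<Rightarrow> falg set"
  for n M p \<epsilon> k \<alpha> \<kappa> where
  inv_right: "i < n \<Longrightarrow> mon [X i, Xm i] - 1 \<in> BMW_relators n M p \<epsilon> k \<alpha> \<kappa>"
| inv_left: "i < n \<Longrightarrow> mon [Xm i, X i] - 1 \<in> BMW_relators n M p \<epsilon> k \<alpha> \<kappa>"
| braid: "i < n \<Longrightarrow> j < n \<Longrightarrow> i \<noteq> j \<Longrightarrow>
    mon (alt (X i) (X j) (M i j)) - mon (alt (X j) (X i) (M i j)) \<in> BMW_relators n M p \<epsilon> k \<alpha> \<kappa>"
| quadratic: "i < n \<Longrightarrow>
    cst (inverse (q_par k \<kappa> i) - q_par k \<kappa> i) * mon [E i]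
      - cst (l_par k \<alpha> \<kappa> i) * (mon [X i] - cst (q_par k \<kappa> i)) * (mon [X i] + cst (inverse (q_par k \<kappa> i)))
      \<in> BMW_relators n M p \<epsilon> k \<alpha> \<kappa>"
| XE: "i < n \<Longrightarrow> mon [X i, E i] - cst (inverse (l_par k \<alpha> \<kappa> i)) * mon [E i] \<in> BMW_relators n M p \<epsilon> k \<alpha> \<kappa>"
| EX: "i < n \<Longrightarrow> mon [E i, X i] - cst (inverse (l_par k \<alpha> \<kappa> i)) * mon [E i] \<in> BMW_relators n M p \<epsilon> k \<alpha> \<kappa>"
| EwE_left: "i < j \<Longrightarrow> j < n \<Longrightarrow> M i j \<noteq> 0 \<Longrightarrow> w \<in> Lambda \<Longrightarrow>
    mon ([E i] @ rename i j w @ [E i])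
      - cst (Phi (M i j) (p (M i j)) \<epsilon> (pair_par k i j) (pair_par \<alpha> i j) \<kappa> 0 w) * mon [E i]
      \<in> BMW_relators n M p \<epsilon> k \<alpha> \<kappa>"
| EwE_right: "i < j \<Longrightarrow> j < n \<Longrightarrow> M i j \<noteq> 0 \<Longrightarrow> w \<in> Lambda \<Longrightarrow>
    mon ([E j] @ rename i j w @ [E j])
      - cst (Phi (M i j) (p (M i j)) \<epsilon> (pair_par k i j) (pair_par \<alpha> i j) \<kappa> 1 w) * mon [E j]
      \<in> BMW_relators n M p \<epsilon> k \<alpha> \<kappa>"
| even_left: "i < j \<Longrightarrow> j < n \<Longrightarrow> even (M i j) \<Longrightarrow> M i j > 2 \<Longrightarrow> w \<in> Lambda \<Longrightarrow>
    mon ([E i] @ rename i j w @ [E j]) \<in> BMW_relators n M p \<epsilon> k \<alpha> \<kappa>"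
| even_right: "i < j \<Longrightarrow> j < n \<Longrightarrow> even (M i j) \<Longrightarrow> M i j > 2 \<Longrightarrow> w \<in> Lambda \<Longrightarrow>
    mon ([E j] @ rename i j w @ [E i]) \<in> BMW_relators n M p \<epsilon> k \<alpha> \<kappa>"

definition BMW_ideal ::
  "nat \<Rightarrow> (nat \<Rightarrow> nat \<Rightarrow> nat) \<Rightarrow> (nat \<Rightarrow> complex \<times> complex) \<Rightarrow> real \<Rightarrow>
   (nat \<Rightarrow> complex) \<Rightarrow> (nat \<Rightarrow> complex) \<Rightarrow> complex \<Rightarrow> falg set" where
  "BMW_ideal n M p \<epsilon> k \<alpha> \<kappa> = Idl\<^bsub>free_algebra n\<^esub> (BMW_relators n M p \<epsilon> k \<alpha> \<kappa>)"

text \<open>\<open>B\<^sub>\<Gamma>(\<Pi>, \<kappa>)\<close> as a ring together with its complex scalar multiplication.\<close>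

definition BMW_algebra ::
  "nat \<Rightarrow> (nat \<Rightarrow> nat \<Rightarrow> nat) \<Rightarrow> (nat \<Rightarrow> complex \<times> complex) \<Rightarrow> real \<Rightarrow>
   (nat \<Rightarrow> complex) \<Rightarrow> (nat \<Rightarrow> complex) \<Rightarrow> complex \<Rightarrow> (complex, falg set) module" where
  "BMW_algebra n M p \<epsilon> k \<alpha> \<kappa> =
     (let I = BMW_ideal n M p \<epsilon> k \<alpha> \<kappa>; Q = free_algebra n Quot I in
      ring.extend Q (module.fields (\<lambda>c x. (I +>\<^bsub>free_algebra n\<^esub> cst c) \<otimes>\<^bsub>Q\<^esub> x)))"

definition BMW_parameters ::
  "nat \<Rightarrow> (nat \<Rightarrow> nat \<Rightarrow> nat) \<Rightarrow> (nat \<Rightarrow> complex) \<Rightarrow> (nat \<Rightarrow> complex) \<Rightarrow> bool" where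
  "BMW_parameters n M k \<alpha> \<longleftrightarrow>
     (\<forall>i<n. k i \<noteq> 0) \<and>
     (\<forall>i<n. \<forall>j<n. cox_conjugate n M i j \<longrightarrow> k i = k j \<and> \<alpha> i = \<alpha> j)"

definition BMW_generic ::
  "nat \<Rightarrow> (nat \<Rightarrow> nat \<Rightarrow> nat) \<Rightarrow> (nat \<Rightarrow> complex \<times> complex) \<Rightarrow> real \<Rightarrow>
   (nat \<Rightarrow> complex) \<Rightarrow> (nat \<Rightarrow> complex) \<Rightarrow> complex \<Rightarrow> bool" where
  "BMW_generic n M p \<epsilon> k \<alpha> \<kappa> \<longleftrightarrow>
     (\<forall>i<n. (q_par k \<kappa> i)\<^sup>2 \<noteq> 1) \<and>
     (\<forall>i j. i < j \<and> j < n \<and> M i j \<noteq> 0 \<longrightarrow>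
        (\<forall>t\<in>{0, 1}. vec_space.rank (M i j)
           (e_LK (M i j) (p (M i j)) \<epsilon> (pair_par k i j) (pair_par \<alpha> i j) \<kappa> t) = 1))"


section \<open>The constructions are well-formed\<close>

lemma equivclp_cox_context:
  assumes "equivclp (cox_step n M) u v"
  shows "equivclp (cox_step n M) (x @ u @ y) (x @ v @ y)"
  using assms
proof (induction rule: equivclp_induct)
  case base
  then show ?case by simp
next
  case (step a b)
  have ctx: "cox_step n M (x @ c @ y) (x @ d @ y)" if "cox_step n M c d" for c d
    using that
  proof cases
    case (1 i j u v)
    then show ?thesis
      using cox_step.intros[of i n j M "x @ u" "v @ y"] by simp
  qed
  have "equivclp (cox_step n M) (x @ a @ y) (x @ b @ y)"
    using step.hyps(2) ctx by (meson equivclp_sym r_into_equivclp)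
  with step.IH show ?case by (rule equivclp_trans)
qed

lemma equiv_cox_rel: "equiv (lists {..<n}) (cox_rel n M)"
proof (rule equivI)
  show "cox_rel n M \<subseteq> lists {..<n} \<times> lists {..<n}"
    by (auto simp: cox_rel_def)
  show "refl_on (lists {..<n}) (cox_rel n M)"
    by (auto simp: refl_on_def cox_rel_def)
  show "sym (cox_rel n M)"
    by (auto simp: sym_def cox_rel_def intro: equivclp_sym)
  show "trans (cox_rel n M)"
    by (auto simp: trans_def cox_rel_def intro: equivclp_trans)
qed

lemma cox_rel_append:
  assumes "(a, a') \<in> cox_rel n M" "(b, b') \<in> cox_rel n M"
  shows "(a @ b, a' @ b') \<in> cox_rel n M"
proof -
  have "equivclp (cox_step n M) (a @ b) (a' @ b)"
    using equivclp_cox_context[of n M a a' "[]" b] assms by (simp add: cox_rel_def)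
  moreover have "equivclp (cox_step n M) (a' @ b) (a' @ b')"
    using equivclp_cox_context[of n M b b' a' "[]"] assms by (simp add: cox_rel_def)
  ultimately show ?thesis
    using assms by (auto simp: cox_rel_def intro: equivclp_trans)
qed

lemma coxeter_mult_class:
  assumes "u \<in> lists {..<n}" "v \<in> lists {..<n}"
  shows "cox_rel n M `` {u} \<otimes>\<^bsub>coxeter_group n M\<^esub> cox_rel n M `` {v} = cox_rel n M `` {u @ v}"
proof -
  have *: "cox_rel n M `` {a @ b} = cox_rel n M `` {u @ v}"
    if "a \<in> cox_rel n M `` {u}" "b \<in> cox_rel n M `` {v}" for a b
    using that equiv_class_eq[OF equiv_cox_rel cox_rel_append[of u a n M v b]] by simp
  have "u \<in> cox_rel n M `` {u}" "v \<in> cox_rel n M `` {v}"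
    by (rule equiv_class_self[OF equiv_cox_rel assms(1)], rule equiv_class_self[OF equiv_cox_rel assms(2)])
  then have "(\<Union>a\<in>cox_rel n M `` {u}. \<Union>b\<in>cox_rel n M `` {v}. cox_rel n M `` {a @ b})
      = cox_rel n M `` {u @ v}"
    using * by blast
  then show ?thesis
    by (simp only: coxeter_group_def monoid.simps)
qed

lemma cox_rel_rev:
  assumes "coxeter_matrix n M" "u \<in> lists {..<n}"
  shows "(rev u @ u, []) \<in> cox_rel n M"
  using assms(2)
proof (induction u)
  case Nil
  then show ?case by (simp add: cox_rel_def)
next
  case (Cons i u)
  then have i: "i < n" and u: "u \<in> lists {..<n}" by auto
  have "M i i = 1" using assms(1) i by (simp add: coxeter_matrix_def)
  then have "cox_step n M (rev u @ [i, i] @ u) (rev u @ u)"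
    using cox_step.intros[of i n i M "rev u" u] i by simp
  then have "(rev (i # u) @ i # u, rev u @ u) \<in> cox_rel n M"
    using i u by (auto simp: cox_rel_def)
  with Cons.IH show ?case
    using equiv_cox_rel[of n M] by (meson equivE transE)
qed

lemma group_coxeter_group:
  assumes "coxeter_matrix n M"
  shows "group (coxeter_group n M)"
proof (rule groupI)
  let ?G = "coxeter_group n M"
  have carr: "carrier ?G = lists {..<n} // cox_rel n M"
    and one: "\<one>\<^bsub>?G\<^esub> = cox_rel n M `` {[]}"
    by (simp_all add: coxeter_group_def)
  have rep: "\<exists>u \<in> lists {..<n}. x = cox_rel n M `` {u}" if "x \<in> carrier ?G" for x
    using that unfolding carr by (auto elim!: quotientE)
  have cls: "cox_rel n M `` {u} \<in> carrier ?G" if "u \<in> lists {..<n}" for u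
    using that unfolding carr by (rule quotientI)
  show "\<one>\<^bsub>?G\<^esub> \<in> carrier ?G" unfolding one by (rule cls) simp
  fix x assume x: "x \<in> carrier ?G"
  then obtain u where u: "u \<in> lists {..<n}" "x = cox_rel n M `` {u}" using rep by blast
  show "\<one>\<^bsub>?G\<^esub> \<otimes>\<^bsub>?G\<^esub> x = x"
    unfolding one u(2) using u(1) by (subst coxeter_mult_class) auto
  have "cox_rel n M `` {rev u} \<otimes>\<^bsub>?G\<^esub> x = \<one>\<^bsub>?G\<^esub>"
    unfolding one u(2) using u(1) cox_rel_rev[OF assms u(1)]
    by (subst coxeter_mult_class) (auto simp: equiv_class_eq[OF equiv_cox_rel])
  then show "\<exists>y\<in>carrier ?G. y \<otimes>\<^bsub>?G\<^esub> x = \<one>\<^bsub>?G\<^esub>"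
    using cls[of "rev u"] u(1) by (intro bexI[of _ "cox_rel n M `` {rev u}"]) (simp_all add: in_lists_conv_set)
  fix y assume y: "y \<in> carrier ?G"
  then obtain v where v: "v \<in> lists {..<n}" "y = cox_rel n M `` {v}" using rep by blast
  have "u @ v \<in> lists {..<n}" using u(1) v(1) by auto
  then show "x \<otimes>\<^bsub>?G\<^esub> y \<in> carrier ?G"
    unfolding u(2) v(2) coxeter_mult_class[OF u(1) v(1)] by (rule cls)
  fix z assume z: "z \<in> carrier ?G"
  then obtain w where w: "w \<in> lists {..<n}" "z = cox_rel n M `` {w}" using rep by blast
  have "v @ w \<in> lists {..<n}" using w(1) v(1) by auto
  then show "x \<otimes>\<^bsub>?G\<^esub> y \<otimes>\<^bsub>?G\<^esub> z = x \<otimes>\<^bsub>?G\<^esub> (y \<otimes>\<^bsub>?G\<^esub> z)"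
    using \<open>u @ v \<in> lists {..<n}\<close> u v w by (simp add: coxeter_mult_class)
qed

lemma ring_free_algebra: "ring (free_algebra n)"
proof (rule ringI)
  let ?L = "lists (X ` {..<n} \<union> Xm ` {..<n} \<union> E ` {..<n})"
  let ?R = "free_algebra n"
  show "abelian_group ?R"
  proof (rule abelian_groupI)
    fix x assume "x \<in> carrier ?R"
    then show "\<exists>y\<in>carrier ?R. y \<oplus>\<^bsub>?R\<^esub> x = \<zero>\<^bsub>?R\<^esub>"
      by (intro bexI[of _ "- x"]) (auto simp: free_algebra_def)
  next
    fix x y assume "x \<in> carrier ?R" "y \<in> carrier ?R"
    then show "x \<oplus>\<^bsub>?R\<^esub> y \<in> carrier ?R"
      using keys_add[of x y] by (auto simp: free_algebra_def)
  qed (auto simp: free_algebra_def algebra_simps)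
  show "Group.monoid ?R"
  proof (rule monoidI)
    fix x y assume "x \<in> carrier ?R" "y \<in> carrier ?R"
    then have "Poly_Mapping.keys x \<subseteq> ?L" "Poly_Mapping.keys y \<subseteq> ?L"
      by (simp_all add: free_algebra_def)
    then have "Poly_Mapping.keys (x * y) \<subseteq> ?L"
    proof (intro subsetI)
      fix w assume "w \<in> Poly_Mapping.keys (x * y)"
      then obtain u v where "u \<in> Poly_Mapping.keys x" "v \<in> Poly_Mapping.keys y" "w = u @ v"
        using keys_mult[of x y] unfolding plus_list_def by blast
      with \<open>Poly_Mapping.keys x \<subseteq> ?L\<close> \<open>Poly_Mapping.keys y \<subseteq> ?L\<close> show "w \<in> ?L"
        by (simp add: subset_iff del: in_lists_conv_set)
    qed
    then show "x \<otimes>\<^bsub>?R\<^esub> y \<in> carrier ?R"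
      by (simp add: free_algebra_def)
  qed (auto simp: free_algebra_def algebra_simps zero_list_def)
qed (auto simp: free_algebra_def algebra_simps)

lemma one_falg: "(1 :: falg) = cst 1"
  by (simp add: zero_list_def flip: single_one)

lemma alt_in_lists: "x \<in> A \<Longrightarrow> y \<in> A \<Longrightarrow> alt x y r \<in> lists A"
  by (induction r arbitrary: x y) auto

lemma mon_carrier:
  "w \<in> lists (X ` {..<n} \<union> Xm ` {..<n} \<union> E ` {..<n}) \<Longrightarrow>
     Poly_Mapping.single w c \<in> carrier (free_algebra n)"
  by (auto simp: free_algebra_def)

lemma rename_in_lists:
  "w \<in> Lambda \<Longrightarrow> i < n \<Longrightarrow> j < n \<Longrightarrow>
     rename i j w \<in> lists (X ` {..<n} \<union> Xm ` {..<n} \<union> E ` {..<n})"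
  by (induction w) (auto simp: Lambda_def rename_def)

lemma BMW_relators_carrier: "BMW_relators n M p \<epsilon> k \<alpha> \<kappa> \<subseteq> carrier (free_algebra n)"
proof
  let ?R = "free_algebra n"
  interpret R: ring ?R by (rule ring_free_algebra)
  have add: "x + y \<in> carrier ?R" if "x \<in> carrier ?R" "y \<in> carrier ?R" for x y
    using R.add.m_closed[OF that] by (simp add: free_algebra_def)
  have diff: "x - y \<in> carrier ?R" if "x \<in> carrier ?R" "y \<in> carrier ?R" for x y
    using add[of x "- y"] that by (simp add: free_algebra_def)
  have mult: "x * y \<in> carrier ?R" if "x \<in> carrier ?R" "y \<in> carrier ?R" for x y
    using R.m_closed[OF that] by (simp add: free_algebra_def)
  note intros = add diff mult mon_carrier
  fix x assume "x \<in> BMW_relators n M p \<epsilon> k \<alpha> \<kappa>"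
  then show "x \<in> carrier ?R"
  proof cases
    case (braid i j)
    then show ?thesis
      by (simp only:) (intro intros alt_in_lists; simp)
  next
    case (EwE_left i j w)
    then show ?thesis using rename_in_lists[of w i n j] by (auto intro!: intros)
  next
    case (EwE_right i j w)
    then show ?thesis using rename_in_lists[of w i n j] by (auto intro!: intros)
  next
    case (even_left i j w)
    then show ?thesis using rename_in_lists[of w i n j] by (auto intro!: intros)
  next
    case (even_right i j w)
    then show ?thesis using rename_in_lists[of w i n j] by (auto intro!: intros)
  qed (auto intro!: intros simp: one_falg)
qed

lemma ideal_BMW_ideal: "ideal (BMW_ideal n M p \<epsilon> k \<alpha> \<kappa>) (free_algebra n)"
  unfolding BMW_ideal_def
  by (rule ring.genideal_ideal[OF ring_free_algebra BMW_relators_carrier])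

lemma ring_BMW_algebra: "ring (BMW_algebra n M p \<epsilon> k \<alpha> \<kappa>)"
  and vectorspace_BMW_algebra: "vectorspace class_ring (BMW_algebra n M p \<epsilon> k \<alpha> \<kappa>)"
proof -
  define I where "I = BMW_ideal n M p \<epsilon> k \<alpha> \<kappa>"
  define R where "R = free_algebra n"
  define Q where "Q = R Quot I"
  let ?B = "BMW_algebra n M p \<epsilon> k \<alpha> \<kappa>"
  define h where "h = (\<lambda>c. I +>\<^bsub>R\<^esub> cst c)"
  interpret I: ideal I R unfolding I_def R_def by (rule ideal_BMW_ideal)
  interpret Q: ring Q unfolding Q_def by (rule I.quotient_is_ring)
  interpret h: ring_hom_ring R Q "\<lambda>x. I +>\<^bsub>R\<^esub> x"
    unfolding Q_def by (rule I.rcos_ring_hom_ring)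
  have B: "carrier ?B = carrier Q" "mult ?B = mult Q" "one ?B = one Q" "zero ?B = zero Q"
    "add ?B = add Q" "\<And>c x. c \<odot>\<^bsub>?B\<^esub> x = h c \<otimes>\<^bsub>Q\<^esub> x"
    by (simp_all add: BMW_algebra_def Let_def ring.defs module.defs Q_def h_def I_def R_def)
  have cst: "cst c \<in> carrier R" for c
    unfolding R_def by (rule mon_carrier) simp
  have hc: "h c \<in> carrier Q" for c
    unfolding h_def using cst by simp
  have hadd: "h (a + b) = h a \<oplus>\<^bsub>Q\<^esub> h b" for a b
  proof -
    have "cst (a + b) = cst a \<oplus>\<^bsub>R\<^esub> cst b" by (simp add: R_def free_algebra_def single_add)
    then show ?thesis unfolding h_def using h.hom_add[OF cst cst] by simp
  qed
  have hmult: "h (a * b) = h a \<otimes>\<^bsub>Q\<^esub> h b" for a b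
  proof -
    have "cst (a * b) = cst a \<otimes>\<^bsub>R\<^esub> cst b"
      by (simp add: R_def free_algebra_def mult_single plus_list_def)
    then show ?thesis unfolding h_def using h.hom_mult[OF cst cst] by simp
  qed
  have hone: "h 1 = \<one>\<^bsub>Q\<^esub>"
  proof -
    have "cst 1 = \<one>\<^bsub>R\<^esub>" by (simp add: R_def free_algebra_def one_falg)
    then show ?thesis unfolding h_def using h.hom_one by simp
  qed
  have grp: "abelian_group ?B"
    by (rule abelian_groupI; unfold B)
      (use Q.add.l_inv_ex in \<open>simp_all add: Q.add.m_ac\<close>)
  show "ring ?B"
    by (rule ringI[OF grp], rule monoidI)
      (auto simp: B Q.m_assoc Q.l_distr Q.r_distr)
  have "cring (class_ring :: complex ring)"
    using class_field field.axioms(1) domain.axioms(1) by blast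
  then have "Module.module (class_ring :: complex ring) ?B"
    by (intro moduleI grp)
      (auto simp: B hc hadd hmult hone Q.m_assoc Q.l_distr Q.r_distr)
  then show "vectorspace class_ring ?B"
    using class_field unfolding vectorspace_def by blast
qed

end

theory Submission
  imports Defs "HOL-Analysis.Henstock_Kurzweil_Integration"
begin

text \<open>Write \<open>W\<close> for the finite Coxeter group and \<open>B\<close> for the algebra.  Two kinds of words have to be controlled.

Words in the \<open>X\<^sub>i\<close> alone.  Modulo words that contain some \<open>E\<^sub>k\<close>, the quadratic relation
turns \<open>B\<close> into the Hecke algebra of \<open>W\<close>.  Concretely, a reduced word \<open>X\<^bsub>i1\<^esub> \<dots> X\<^bsub>id\<^esub>\<close> depends,
by the braid relations, only on the element of \<open>W\<close> that it spells (\<open>hecke_unique\<close>), and multiplying it on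
the right by \<open>X\<^sub>k\<close> gives a reduced word or, by \<open>x_square\<close>, a combination of reduced words and of one
reduced word times \<open>E\<^sub>k\<close>.  With the finite set \<open>H\<close> of reduced words this yields
\<open>B = span H + \<Sum>\<^sub>i B E\<^sub>i H\<close> (\<open>finite_dimensional\<close>), so it is enough to bound every left ideal \<open>B E\<^sub>i\<close>.

The left ideals \<open>B E\<^sub>i\<close>.  These behave like the Lawrence-Krammer representation, which has one basis
vector for each reflection.  The locale \<open>lk_module\<close> isolates what is needed: vectors \<open>v\<^sub>t\<close>, one for each
simple root, on which the rank-two subalgebras act as expected.  Starting from the line of \<open>v\<^sub>t\<close> at the simple
root \<open>\<alpha>\<^sub>t\<close>, one climbs to the other positive roots: whenever \<open>X\<^sub>k\<close> is applied at a root \<open>\<gamma>\<close> with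
\<open>\<langle>\<gamma>, \<alpha>\<^sub>k\<rangle> < 0\<close>, the result is placed at \<open>s\<^sub>k \<gamma>\<close>.  The number of steps, the depth, is bounded
because the height of the root increases and there are finitely many roots.  What has to be shown is that the
span of all these layers is stable under every \<open>X\<^sub>k\<close> and \<open>E\<^sub>k\<close>.  This is \<open>stage_all\<close>, a
simultaneous induction on the depth of four statements: \<open>X\<^sub>k\<close> raises the filtration by at most one step;
\<open>E\<^sub>k\<close> maps everything into the line of \<open>v\<^sub>k\<close>; if \<open>\<langle>\<gamma>, \<alpha>\<^sub>j\<rangle> > 0\<close> then the last letter of the climb to
\<open>\<gamma>\<close> can be taken to be \<open>X\<^sub>j\<close>, up to lower layers; and if \<open>\<langle>\<gamma>, \<alpha>\<^sub>j\<rangle> = 0\<close> then \<open>X\<^sub>j\<close> does not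
raise the depth.  Each step descends from \<open>\<gamma>\<close> along an alternating chain \<open>s\<^sub>k, s\<^sub>j, s\<^sub>k, \<dots>\<close> and comes
back on the other side of the dihedral orbit; positive definiteness of the invariant form supplies a
\<open>k\<close> for which the descent is long enough (\<open>exists_direction\<close>), and the alternating word of length
\<open>m - 1\<close>, the ribbon, carries \<open>E\<^sub>j\<close> across (\<open>ribbon_e\<close>).

To obtain the vectors \<open>v\<^sub>t\<close> from \<open>E\<^sub>i\<close>, ribbons are used once more: for an odd bond they conjugate \<open>E\<^sub>j\<close> to
\<open>E\<^sub>k\<close>, and the graph of bonds is a forest, so \<open>E\<^sub>i\<close> can be transported consistently along the odd edges
(\<open>tree_transport\<close>) and \<open>v\<^sub>t\<close> is put to \<open>0\<close> outside the component of \<open>i\<close>.  From the relations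
\<open>E X E = \<Phi>(X) E\<close> the argument takes that the left side is a multiple of \<open>E\<close>, and, for commuting
\<open>s\<^sub>i, s\<^sub>j\<close>, the value \<open>\<Phi>(E\<^sub>j) = 0\<close>, which gives \<open>E\<^sub>i E\<^sub>j = 0\<close>.  For two orthogonal lines the connection is diagonal and its monodromy is computed explicitly.

The transport divides by the scalars \<open>\<delta>\<^sub>i\<close> with \<open>E\<^sub>i\<^sup>2 = \<delta>\<^sub>i E\<^sub>i\<close>.  The rank-one condition for
\<open>m = 2\<close> makes \<open>\<delta>\<^sub>i\<close> nonzero as soon as \<open>s\<^sub>i\<close> commutes with some other generator.  A vanishing
\<open>\<delta>\<^sub>i\<close> therefore forces rank at most two (\<open>rank_le_two\<close>), where \<open>B E\<^sub>i\<close> is spanned by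
alternating words times \<open>E\<^sub>i\<close>.\<close>


section \<open>Reflections and dihedral chains\<close>

text \<open>Vectors are functions on \<open>nat\<close>, read as coordinates with respect to the simple roots; only the coordinates
  below \<open>n\<close> are ever paired.  This avoids a type for each rank.\<close>

definition simple_root :: "nat \<Rightarrow> nat \<Rightarrow> real" where
  "simple_root q = (\<lambda>i. if i = q then 1 else 0)"

locale coxeter_system =
  fixes n :: nat and M :: "nat \<Rightarrow> nat \<Rightarrow> nat"
  assumes coxeter: "coxeter_matrix n M"
begin

text \<open>An infinite bond is encoded by \<open>M i j = 0\<close>; as \<open>x / 0 = 0\<close>, the entry is then \<open>- cos 0 = - 1\<close>, the usual
  convention.\<close>

definition gram :: "nat \<Rightarrow> nat \<Rightarrow> real" where
  "gram i j = - cos (pi / real (M i j))"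

text \<open>The Gram form of \<open>v\<close> with the \<open>i\<close>-th simple root, which has norm \<open>1\<close>.\<close>

definition pair :: "(nat \<Rightarrow> real) \<Rightarrow> nat \<Rightarrow> real" where
  "pair v i = (\<Sum>j<n. v j * gram j i)"

definition reflect :: "nat \<Rightarrow> (nat \<Rightarrow> real) \<Rightarrow> nat \<Rightarrow> real" where
  "reflect k v = (\<lambda>i. v i - 2 * pair v k * simple_root k i)"

text \<open>There are two ways to list a product of alternating reflections.  \<open>chain a b r\<close> applies \<open>s\<^sub>a\<close> first, as in a
  walk through roots that starts in direction \<open>a\<close>; \<open>arefl a b r\<close> is the operator \<open>s\<^sub>a s\<^sub>b s\<^sub>a \<dots>\<close>, as
  in a word that begins with \<open>a\<close>.  The conversion \<open>arefl_conv_chain\<close> depends on the parity of \<open>r\<close>.\<close>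

fun chain :: "nat \<Rightarrow> nat \<Rightarrow> nat \<Rightarrow> (nat \<Rightarrow> real) \<Rightarrow> nat \<Rightarrow> real" where
  "chain a b 0 v = v"
| "chain a b (Suc r) v = chain b a r (reflect a v)"

fun arefl :: "nat \<Rightarrow> nat \<Rightarrow> nat \<Rightarrow> (nat \<Rightarrow> real) \<Rightarrow> nat \<Rightarrow> real" where
  "arefl a b 0 v = v"
| "arefl a b (Suc r) v = reflect a (arefl b a r v)"

definition angle :: "nat \<Rightarrow> nat \<Rightarrow> real" where
  "angle a b = pi / real (M a b)"

lemma M_sym: "i < n \<Longrightarrow> j < n \<Longrightarrow> M i j = M j i"
  and M_diag: "i < n \<Longrightarrow> M i i = 1"
  and M_neq1: "i < n \<Longrightarrow> j < n \<Longrightarrow> i \<noteq> j \<Longrightarrow> M i j \<noteq> 1"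
  using coxeter unfolding coxeter_matrix_def by blast+

lemma gram_sym: "i < n \<Longrightarrow> j < n \<Longrightarrow> gram i j = gram j i"
  by (simp add: gram_def M_sym)

lemma gram_diag [simp]: "i < n \<Longrightarrow> gram i i = 1"
  by (simp add: gram_def M_diag)

lemma gram_nonpos:
  assumes "i < n" "j < n" "i \<noteq> j"
  shows "gram i j \<le> 0"
proof (cases "M i j = 0")
  case True
  then show ?thesis by (simp add: gram_def)
next
  case False
  then have "real (M i j) \<ge> 2"
    using M_neq1[OF assms] by linarith
  then have "pi / real (M i j) \<le> pi / 2" "0 \<le> pi / real (M i j)"
    using divide_left_mono[of 2 "real (M i j)" pi] by auto
  then show ?thesis
    unfolding gram_def using cos_ge_zero[of "pi / real (M i j)"] pi_ge_zero by linarith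
qed

lemma gram_angle: "gram a b = - cos (angle a b)"
  by (simp add: gram_def angle_def)

lemma pair_simple: "q < n \<Longrightarrow> pair (simple_root q) i = gram q i"
  by (simp add: pair_def simple_root_def if_distrib[of "\<lambda>x. x * _"] sum.delta cong: if_cong)

lemma pair_add: "pair (\<lambda>i. u i + v i) k = pair u k + pair v k"
  by (simp add: pair_def algebra_simps sum.distrib)

lemma pair_scale: "pair (\<lambda>i. c * u i) k = c * pair u k"
  by (simp add: pair_def sum_distrib_left mult.assoc)

lemma pair_diff_scale: "pair (\<lambda>i. u i - c * v i) k = pair u k - c * pair v k"
  using pair_add[of u "\<lambda>i. (- c) * v i" k] by (simp only: pair_scale) (simp add: algebra_simps)

lemma pair_reflect: "k < n \<Longrightarrow> pair (reflect k v) i = pair v i - 2 * pair v k * gram k i"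
  by (simp add: reflect_def pair_diff_scale pair_simple)

lemma reflect_reflect [simp]: "k < n \<Longrightarrow> reflect k (reflect k v) = v"
  using pair_reflect[of k v k] by (simp add: reflect_def[of k "reflect k v"]) (simp add: reflect_def)

lemma reflect_eq_self: "pair v k = 0 \<Longrightarrow> reflect k v = v"
  by (simp add: reflect_def)

lemma reflect_simple_self: "k < n \<Longrightarrow> reflect k (simple_root k) = (\<lambda>i. - simple_root k i)"
  by (auto simp: reflect_def pair_simple)

lemma chain_snoc:
  "chain a b (Suc r) v = reflect (if even r then a else b) (chain a b r v)"
  by (induction a b r v rule: chain.induct) auto

lemma arefl_snoc:
  "arefl a b (Suc r) v = arefl a b r (reflect (if even r then a else b) v)"
  by (induction a b r v rule: arefl.induct) auto

lemma arefl_conv_chain: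
  "arefl a b r v = chain (if odd r then a else b) (if odd r then b else a) r v"
  by (induction r arbitrary: a b) (auto simp: chain_snoc simp del: chain.simps(2))

lemma arefl_chain:
  assumes "a < n" "b < n"
  shows "arefl a b r (chain a b r v) = v"
  using assms by (induction r arbitrary: a b v) auto

lemma arefl_add:
  "arefl a b (r + s) v = arefl a b r (if even r then arefl a b s v else arefl b a s v)"
  by (induction r arbitrary: a b) auto

lemma sin_step: "sin ((real s + 2) * t) = 2 * cos t * sin ((real s + 1) * t) - sin (real s * t)"
proof -
  have *: "(real s + 2) * t = (real s + 1) * t + t" "real s * t = (real s + 1) * t - t"
    by (simp_all add: algebra_simps)
  show ?thesis
    unfolding * by (simp only: sin_add sin_diff) simp
qed

text \<open>In the plane of \<open>\<alpha>\<^sub>a\<close> and \<open>\<alpha>\<^sub>b\<close> the walk is a rotation, so the pairings along it obey the recursion of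
  \<open>sin (s \<theta>)\<close>.  The factor \<open>sin \<theta>\<close> is kept on the left so that no case distinction on \<open>\<theta> = 0\<close> arises.\<close>

lemma pair_chain:
  assumes "a < n" "b < n"
  shows "sin (angle a b) * pair (chain a b s v) (if even s then a else b)
       = pair v a * sin ((real s + 1) * angle a b) + pair v b * sin (real s * angle a b)"
  using assms
proof (induction s arbitrary: a b v)
  case 0
  then show ?case by simp
next
  case (Suc s)
  let ?t = "angle a b"
  have t: "angle b a = ?t" using Suc.prems by (simp add: angle_def M_sym)
  have g: "gram a b = - cos ?t" by (rule gram_angle)
  have "sin ?t * pair (chain b a s (reflect a v)) (if even s then b else a)
     = pair (reflect a v) b * sin ((real s + 1) * ?t) + pair (reflect a v) a * sin (real s * ?t)"
    using Suc.IH[of b a "reflect a v"] Suc.prems unfolding t by simp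
  also have "\<dots> = (pair v b + 2 * cos ?t * pair v a) * sin ((real s + 1) * ?t) - pair v a * sin (real s * ?t)"
    using Suc.prems by (simp add: pair_reflect g)
  also have "\<dots> = pair v a * sin ((real s + 2) * ?t) + pair v b * sin ((real s + 1) * ?t)"
    unfolding sin_step by (simp add: algebra_simps)
  finally have *: "sin ?t * pair (chain b a s (reflect a v)) (if even s then b else a)
     = pair v a * sin ((real s + 2) * ?t) + pair v b * sin ((real s + 1) * ?t)" .
  have e: "real (Suc s) + 1 = real s + 2" "real (Suc s) = real s + 1" by simp_all
  show ?case
    unfolding e using * by (cases "even s") (auto simp: add.commute)
qed

text \<open>The two walks from \<open>v\<close> around the dihedral orbit, starting with \<open>a\<close> and with \<open>b\<close>, differ by a multiple of
  \<open>sin (r \<theta>)\<close>.  At \<open>r = m\<close> this vanishes, which is the braid relation; for \<open>r < m\<close> it compares the heights of the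
  two end points.\<close>

lemma chain_swap_diff:
  assumes "a < n" "b < n" "a \<noteq> b"
  shows "sin (angle a b) * (chain a b r v i - chain b a r v i)
    = (if odd r then - 2 * sin (real r * angle a b) * (pair v a * simple_root a i - pair v b * simple_root b i)
       else - 2 * sin (real r * angle a b) * (pair v a * simple_root b i - pair v b * simple_root a i))"
proof (induction r)
  case 0
  then show ?case by simp
next
  case (Suc r)
  let ?t = "angle a b" and ?c = "if even r then a else b" and ?d = "if even r then b else a"
  have t: "angle b a = ?t" using assms by (simp add: angle_def M_sym)
  have 1: "sin ?t * pair (chain a b r v) ?c = pair v a * sin ((real r + 1) * ?t) + pair v b * sin (real r * ?t)"
    using pair_chain[of a b r v] assms by simp
  have 2: "sin ?t * pair (chain b a r v) ?d = pair v b * sin ((real r + 1) * ?t) + pair v a * sin (real r * ?t)"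
    using pair_chain[of b a r v] assms unfolding t by simp
  have "sin ?t * (chain a b (Suc r) v i - chain b a (Suc r) v i)
     = sin ?t * (chain a b r v i - chain b a r v i)
       - 2 * (sin ?t * pair (chain a b r v) ?c) * simple_root ?c i
       + 2 * (sin ?t * pair (chain b a r v) ?d) * simple_root ?d i"
    by (simp only: chain_snoc reflect_def) (simp add: algebra_simps)
  also have "\<dots> = (if odd (Suc r)
       then - 2 * sin (real (Suc r) * ?t) * (pair v a * simple_root a i - pair v b * simple_root b i)
       else - 2 * sin (real (Suc r) * ?t) * (pair v a * simple_root b i - pair v b * simple_root a i))"
    unfolding 1 2 Suc.IH by (cases "even r") (simp_all add: algebra_simps)
  finally show ?case .
qed

lemma sin_angle_pos:
  assumes "a < n" "b < n" "a \<noteq> b" "M a b \<noteq> 0"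
  shows "sin (angle a b) > 0"
proof -
  have "real (M a b) \<ge> 2"
    using M_neq1[OF assms(1-3)] assms(4) by linarith
  then show ?thesis
    unfolding angle_def by (intro sin_gt_zero) (auto simp: field_simps)
qed

lemma chain_braid:
  assumes "a < n" "b < n" "a \<noteq> b"
  shows "chain a b (M a b) v = chain b a (M a b) v"
proof (cases "M a b = 0")
  case False
  \<comment> \<open>At \<open>r = m\<close> the difference carries the factor \<open>sin \<pi>\<close>.\<close>
  have "sin (real (M a b) * angle a b) = 0"
    using False by (simp add: angle_def)
  then have "sin (angle a b) * (chain a b (M a b) v i - chain b a (M a b) v i) = 0" for i
    unfolding chain_swap_diff[OF assms] by simp
  then show ?thesis
    using sin_angle_pos[OF assms False] by fastforce
qed simp

lemma arefl_braid:
  assumes "a < n" "b < n" "a \<noteq> b"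
  shows "arefl a b (M a b) v = arefl b a (M a b) v"
  using chain_braid[OF assms] by (simp add: arefl_conv_chain)

lemma arefl_order:
  assumes "a < n" "b < n" "a \<noteq> b"
  shows "arefl a b (2 * M a b) v = v"
proof -
  let ?m = "M a b"
  have "arefl a b (2 * ?m) v = arefl a b ?m (if even ?m then arefl a b ?m v else arefl b a ?m v)"
    by (simp add: mult_2 arefl_add)
  also have "\<dots> = arefl a b ?m (chain a b ?m v)"
    using arefl_braid[OF assms, of v] by (auto simp: arefl_conv_chain[of a b] arefl_conv_chain[of b a])
  also have "\<dots> = v"
    using assms by (simp add: arefl_chain)
  finally show ?thesis .
qed


text \<open>The geometric representation on words; by \<open>arefl_order\<close> it is well defined on the Coxeter group.\<close>

fun act :: "nat list \<Rightarrow> (nat \<Rightarrow> real) \<Rightarrow> nat \<Rightarrow> real" where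
  "act [] v = v"
| "act (i # w) v = reflect i (act w v)"

lemma act_append: "act (u @ w) v = act u (act w v)"
  by (induction u) auto

lemma act_replicate: "act (concat (replicate m [i, j])) v = arefl i j (2 * m) v"
  by (induction m) auto

lemma act_cox_step:
  assumes "cox_step n M u v"
  shows "act u = act v"
  using assms
proof cases
  case (1 i j x y)
  have "act (concat (replicate (M i j) [i, j])) z = z" for z
  proof (cases "i = j")
    case True
    then show ?thesis using 1 by (simp add: M_diag)
  next
    case False
    then show ?thesis using 1 by (simp add: act_replicate arefl_order)
  qed
  then show ?thesis
    using 1 by (intro ext) (simp only: act_append)
qed

lemma act_cox_rel:
  assumes "(u, v) \<in> cox_rel n M"
  shows "act u = act v"
proof -
  have "equivclp (cox_step n M) u v"
    using assms by (simp add: cox_rel_def)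
  then show ?thesis
    by (induction rule: equivclp_induct) (auto dest: act_cox_step)
qed

lemma reflect_linear:
  "reflect k (\<lambda>i. u i + c * v i) = (\<lambda>i. reflect k u i + c * reflect k v i)"
proof -
  have "pair (\<lambda>i. u i + c * v i) k = pair u k + c * pair v k"
    using pair_add[of u "\<lambda>i. c * v i"] by (simp add: pair_scale)
  then show ?thesis
    by (simp add: reflect_def algebra_simps)
qed

lemma act_linear:
  "act w (\<lambda>i. u i + c * v i) = (\<lambda>i. act w u i + c * act w v i)"
  by (induction w) (auto simp: reflect_linear)

text \<open>The quadratic form of the Gram matrix.\<close>

definition energy :: "(nat \<Rightarrow> real) \<Rightarrow> real" where
  "energy v = (\<Sum>i<n. v i * pair v i)"

end


section \<open>The positive definite form of a finite Coxeter group\<close>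

locale finite_coxeter_system = coxeter_system +
  assumes finite_group: "finite (carrier (coxeter_group n M))"
begin

definition grp :: "((nat \<Rightarrow> real) \<Rightarrow> nat \<Rightarrow> real) set" where
  "grp = act ` lists {..<n}"

lemma finite_grp: "finite grp"
proof -
  have "grp \<subseteq> (\<lambda>A. act (SOME w. w \<in> A)) ` carrier (coxeter_group n M)"
  proof
    fix g assume "g \<in> grp"
    then obtain w where w: "w \<in> lists {..<n}" "g = act w" by (auto simp: grp_def)
    let ?A = "cox_rel n M `` {w}"
    have "?A \<in> carrier (coxeter_group n M)"
      unfolding coxeter_group_def using w(1) by (auto intro: quotientI)
    moreover have "w \<in> ?A"
      using equiv_class_self[OF equiv_cox_rel w(1)] .
    then have "(SOME w'. w' \<in> ?A) \<in> ?A" by (rule someI)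
    then have "act (SOME w'. w' \<in> ?A) = g"
      using act_cox_rel w(2) by auto
    ultimately show "g \<in> (\<lambda>A. act (SOME w. w \<in> A)) ` carrier (coxeter_group n M)" by blast
  qed
  then show ?thesis using finite_group by (rule finite_surj[rotated])
qed

lemma id_in_grp: "(\<lambda>v. v) \<in> grp"
  unfolding grp_def by (rule image_eqI[of _ _ "[]"]) auto

lemma grp_reflect: "g \<in> grp \<Longrightarrow> k < n \<Longrightarrow> (\<lambda>v. g (reflect k v)) \<in> grp"
  unfolding grp_def
proof (elim imageE)
  fix w assume "g = act w" "w \<in> lists {..<n}" "k < n"
  then show "(\<lambda>v. g (reflect k v)) \<in> act ` lists {..<n}"
    by (intro image_eqI[of _ _ "w @ [k]"]) (auto simp: act_append)
qed

lemma reflect_grp: "g \<in> grp \<Longrightarrow> k < n \<Longrightarrow> (\<lambda>v. reflect k (g v)) \<in> grp"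
  unfolding grp_def
proof (elim imageE)
  fix w assume "g = act w" "w \<in> lists {..<n}" "k < n"
  then show "(\<lambda>v. reflect k (g v)) \<in> act ` lists {..<n}"
    by (intro image_eqI[of _ _ "k # w"]) auto
qed

lemma grp_linear: "g \<in> grp \<Longrightarrow> g (\<lambda>i. u i + c * v i) = (\<lambda>i. g u i + c * g v i)"
  by (auto simp: grp_def act_linear)

text \<open>Averaging the standard inner product over the finite group gives an invariant positive definite form.\<close>

definition form :: "(nat \<Rightarrow> real) \<Rightarrow> (nat \<Rightarrow> real) \<Rightarrow> real" where
  "form u v = (\<Sum>g\<in>grp. \<Sum>i<n. g u i * g v i)"

lemma form_sym: "form u v = form v u"
  by (simp add: form_def mult.commute)

lemma form_linear: "form (\<lambda>i. u i + c * v i) w = form u w + c * form v w"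
  unfolding form_def sum_distrib_left sum.distrib[symmetric]
  by (intro sum.cong refl) (simp add: grp_linear algebra_simps)

lemma form_reflect:
  assumes k: "k < n"
  shows "form (reflect k u) (reflect k v) = form u v"
proof -
  have "bij_betw (\<lambda>g v. g (reflect k v)) grp grp"
    by (rule bij_betw_byWitness[where f' = "\<lambda>g v. g (reflect k v)"])
      (use k in \<open>auto simp: grp_reflect\<close>)
  then show ?thesis
    unfolding form_def by (rule sum.reindex_bij_betw)
qed

lemma form_pos:
  assumes "i < n" "v i \<noteq> 0"
  shows "form v v > 0"
proof -
  have "0 < (\<Sum>i<n. v i * v i)"
    using assms by (intro sum_pos2[of _ i]) (auto simp: zero_less_mult_iff linorder_neq_iff)
  also have "\<dots> \<le> form v v"
    unfolding form_def
    by (rule member_le_sum[of "\<lambda>v. v" grp "\<lambda>g. \<Sum>i<n. g v i * g v i"])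
      (use id_in_grp finite_grp in \<open>auto intro: sum_nonneg\<close>)
  finally show ?thesis .
qed

lemma form_minus: "form u (\<lambda>i. - v i) = - form u v"
  using form_linear[of "\<lambda>i. 0" "-1" v u] form_linear[of "\<lambda>i. 0" "-1" "\<lambda>i. 0" u]
  by (simp add: form_sym[of u])

text \<open>Invariance under \<open>s\<^sub>k\<close> determines how any invariant form pairs with \<open>\<alpha>\<^sub>k\<close>, up to the norm of \<open>\<alpha>\<^sub>k\<close>.\<close>

lemma form_simple:
  assumes k: "k < n"
  shows "form v (simple_root k) = pair v k * form (simple_root k) (simple_root k)"
proof -
  have "form v (simple_root k) = form (reflect k v) (reflect k (simple_root k))"
    using k by (simp add: form_reflect)
  also have "\<dots> = form (\<lambda>i. v i + (- 2 * pair v k) * simple_root k i) (\<lambda>i. - simple_root k i)"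
    using k by (simp add: reflect_simple_self) (simp add: reflect_def)
  also have "\<dots> = - form v (simple_root k) + 2 * pair v k * form (simple_root k) (simple_root k)"
    unfolding form_minus form_linear by simp
  finally show ?thesis by simp
qed

lemma form_sum_simple:
  assumes "finite A"
  shows "form (\<lambda>i. \<Sum>k\<in>A. c k * simple_root k i) w = (\<Sum>k\<in>A. c k * form (simple_root k) w)"
  using assms
proof (induction A)
  case empty
  show ?case using form_linear[of "\<lambda>i. 0" "-1" "\<lambda>i. 0" w] by simp
next
  case (insert a A)
  then show ?case
    using form_linear[of "\<lambda>i. \<Sum>k\<in>A. c k * simple_root k i" "c a" "simple_root a" w]
    by (simp add: add.commute)
qed

text \<open>By \<open>form_simple\<close> the averaged form and the Gram form agree after rescaling the simple roots, so the Gram form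
  inherits positive definiteness.\<close>

lemma energy_pos:
  assumes "i < n" "v i \<noteq> 0"
  shows "energy v > 0"
proof -
  \<comment> \<open>The norms of the simple roots in the averaged form; \<open>d\<close> is constant along the edges of the Coxeter graph.\<close>
  define d where "d k = form (simple_root k) (simple_root k)" for k
  define u where "u i = (if i < n then v i / sqrt (d i) else 0)" for i
  have d: "d k > 0" if "k < n" for k
    unfolding d_def using that by (rule form_pos) (simp add: simple_root_def)
  have eq: "d i = d j" if "i < n" "j < n" "gram i j \<noteq> 0" for i j
  proof -
    have "gram i j * d j = gram j i * d i"
      using form_simple[OF that(2), of "simple_root i"] form_simple[OF that(1), of "simple_root j"]
        form_sym[of "simple_root i" "simple_root j"] that(1,2)
      by (simp only: pair_simple d_def)
    then show ?thesis using that by (simp add: gram_sym)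
  qed
  have u: "u = (\<lambda>i. \<Sum>k<n. u k * simple_root k i)"
  proof
    fix i
    have "(\<Sum>k<n. u k * simple_root k i) = (\<Sum>k<n. if i = k then u k else 0)"
      by (rule sum.cong) (auto simp: simple_root_def)
    also have "\<dots> = (if i < n then u i else 0)"
      by simp
    also have "\<dots> = u i"
      by (simp add: u_def)
    finally show "u i = (\<Sum>k<n. u k * simple_root k i)" by simp
  qed
  have "0 < form u u"
    using assms d[OF assms(1)] by (intro form_pos[OF assms(1)]) (simp add: u_def)
  also have "form u u = (\<Sum>k<n. u k * form (simple_root k) u)"
    using form_sum_simple[of "{..<n}" u u] by (simp only: u[symmetric] finite_lessThan)
  also have "\<dots> = (\<Sum>k<n. \<Sum>j<n. u k * (u j * gram j k * d k))"
  proof (intro sum.cong refl)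
    fix k assume "k \<in> {..<n}"
    then have "form (simple_root k) u = pair u k * d k"
      using form_simple[of k u] form_sym[of "simple_root k" u] by (simp only: d_def lessThan_iff)
    then show "u k * form (simple_root k) u = (\<Sum>j<n. u k * (u j * gram j k * d k))"
      by (simp only: pair_def sum_distrib_left sum_distrib_right)
  qed
  also have "\<dots> = (\<Sum>k<n. \<Sum>j<n. v k * (v j * gram j k))"
  proof (intro sum.cong refl)
    fix k j assume kj: "k \<in> {..<n}" "j \<in> {..<n}"
    show "u k * (u j * gram j k * d k) = v k * (v j * gram j k)"
    proof (cases "gram j k = 0")
      case False
      then have *: "d j = d k" using kj by (intro eq) auto
      define s where "s = sqrt (d k)"
      have s: "s \<noteq> 0" "d k = s * s" using d[of k] kj by (simp_all add: s_def)
      have "u k = v k / s" "u j = v j / s"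
        using kj * by (simp_all add: u_def s_def)
      then show ?thesis using s by (simp only:) simp
    next
      case True
      then show ?thesis by (simp only: mult_zero_left mult_zero_right)
    qed
  qed
  also have "\<dots> = energy v"
    by (simp add: energy_def pair_def sum_distrib_left)
  finally show ?thesis .
qed

lemma M_ge2:
  assumes "i < n" "j < n" "i \<noteq> j"
  shows "M i j \<ge> 2"
proof (rule ccontr)
  assume "\<not> M i j \<ge> 2"
  then have "M i j = 0" using M_neq1[OF assms] by linarith
  then have g: "gram i j = - 1" "gram j i = - 1"
    using gram_sym[OF assms(1,2)] by (auto simp: gram_def)
  \<comment> \<open>For an infinite bond this vector would be isotropic.\<close>
  let ?v = "\<lambda>t. simple_root i t + simple_root j t"
  have p: "pair ?v i = 0" "pair ?v j = 0"
    using assms g by (simp_all add: pair_add pair_simple)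
  have z: "?v t * pair ?v t = 0" for t
  proof (cases "t = i \<or> t = j")
    case True
    then show ?thesis using p by auto
  next
    case False
    then have "?v t = 0" by (simp add: simple_root_def)
    then show ?thesis by simp
  qed
  have "energy ?v = 0"
    unfolding energy_def by (rule sum.neutral) (use z in blast)
  moreover have "?v i \<noteq> 0"
    using assms by (simp add: simple_root_def)
  ultimately show False
    using energy_pos[OF assms(1), of ?v] by linarith
qed

definition roots :: "(nat \<Rightarrow> real) set" where
  "roots = (\<lambda>(g, q). g (simple_root q)) ` (grp \<times> {..<n})"

lemma finite_roots: "finite roots"
  by (simp add: roots_def finite_grp)

lemma simple_in_roots: "q < n \<Longrightarrow> simple_root q \<in> roots"
  unfolding roots_def using id_in_grp by (intro image_eqI[of _ _ "(\<lambda>v. v, q)"]) auto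

lemma reflect_in_roots:
  assumes "\<gamma> \<in> roots" "k < n"
  shows "reflect k \<gamma> \<in> roots"
proof -
  obtain g q where "g \<in> grp" "q < n" "\<gamma> = g (simple_root q)"
    using assms by (auto simp: roots_def)
  then show ?thesis
    unfolding roots_def using reflect_grp[of g k] assms(2)
    by (intro image_eqI[of _ _ "(\<lambda>v. reflect k (g v), q)"]) auto
qed

end


section \<open>Pairings along dihedral chains\<close>

context finite_coxeter_system
begin

lemma angle_sym: "a < n \<Longrightarrow> b < n \<Longrightarrow> angle a b = angle b a"
  by (simp add: angle_def M_sym)

lemma angle_mult:
  assumes "a < n" "b < n" "a \<noteq> b"
  shows "real (M a b) * angle a b = pi"
  using M_ge2[OF assms] by (simp add: angle_def)

lemma angle_pos:
  assumes "a < n" "b < n" "a \<noteq> b"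
  shows "angle a b > 0"
  using M_ge2[OF assms] by (simp add: angle_def)

lemma sin_pos:
  assumes "a < n" "b < n" "a \<noteq> b"
  shows "sin (angle a b) > 0"
  using sin_angle_pos[OF assms] M_ge2[OF assms] by simp

lemma sin_cancel:
  assumes "a < n" "b < n" "a \<noteq> b" "sin (angle a b) * x = sin (angle a b) * y"
  shows "x = y"
  using sin_pos[OF assms(1-3)] assms(4) by simp

lemma sin_multiple_pos:
  assumes "a < n" "b < n" "a \<noteq> b" "0 < x" "x < real (M a b)"
  shows "sin (x * angle a b) > 0"
proof (rule sin_gt_zero)
  show "0 < x * angle a b" using angle_pos[OF assms(1-3)] assms(4) by simp
  show "x * angle a b < pi"
    using mult_strict_right_mono[OF assms(5) angle_pos[OF assms(1-3)]] angle_mult[OF assms(1-3)] by simp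
qed

lemma sin_multiple_nonneg:
  assumes "a < n" "b < n" "a \<noteq> b" "s \<le> M a b"
  shows "sin (real s * angle a b) \<ge> 0"
proof (cases "s = 0 \<or> s = M a b")
  case True
  then show ?thesis using angle_mult[OF assms(1-3)] by auto
next
  case False
  then show ?thesis using sin_multiple_pos[OF assms(1-3), of "real s"] assms(4) by simp
qed

text \<open>The pairings along the walk are combinations of \<open>sin ((s + 1) \<theta>)\<close> and \<open>sin (s \<theta>)\<close>, and both sines are nonnegative
  until half a turn is completed.  So a walk that starts where both pairings have the same sign goes on climbing, or, in
  \<open>pair_chain_pos\<close>, goes on descending.\<close>

lemma pair_chain_neg:
  assumes ab: "a < n" "b < n" "a \<noteq> b" and s: "Suc s < M a b" and "pair v a < 0" "pair v b \<le> 0"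
  shows "pair (chain a b s v) (if even s then a else b) < 0"
proof -
  have "pair v a * sin ((real s + 1) * angle a b) < 0"
    using sin_multiple_pos[OF ab, of "real s + 1"] s assms(5) by (simp add: mult_neg_pos)
  moreover have "pair v b * sin (real s * angle a b) \<le> 0"
    using sin_multiple_nonneg[OF ab, of s] s assms(6) by (simp add: mult_nonpos_nonneg)
  ultimately have "sin (angle a b) * pair (chain a b s v) (if even s then a else b) < 0"
    unfolding pair_chain[OF ab(1,2)] by linarith
  then show ?thesis using sin_pos[OF ab] by (simp add: mult_less_0_iff)
qed

lemma pair_chain_pos:
  assumes ab: "a < n" "b < n" "a \<noteq> b" and s: "Suc s < M a b" and "pair v a > 0" "pair v b \<ge> 0"
  shows "pair (chain a b s v) (if even s then a else b) > 0"
proof -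
  have "pair v a * sin ((real s + 1) * angle a b) > 0"
    using sin_multiple_pos[OF ab, of "real s + 1"] s assms(5) by simp
  moreover have "pair v b * sin (real s * angle a b) \<ge> 0"
    using sin_multiple_nonneg[OF ab, of s] s assms(6) by simp
  ultimately have "sin (angle a b) * pair (chain a b s v) (if even s then a else b) > 0"
    unfolding pair_chain[OF ab(1,2)] by linarith
  then show ?thesis using sin_pos[OF ab] by (simp add: zero_less_mult_iff)
qed

lemma pair_chain_last:
  assumes ab: "a < n" "b < n" "a \<noteq> b" and s: "Suc s = M a b"
  shows "pair (chain a b s v) (if even s then a else b) = pair v b"
proof -
  have 1: "(real s + 1) * angle a b = pi"
    using angle_mult[OF ab] s[symmetric] by (simp add: add.commute)
  then have 2: "real s * angle a b = pi - angle a b" by (simp add: algebra_simps)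
  have "sin (angle a b) * pair (chain a b s v) (if even s then a else b) = sin (angle a b) * pair v b"
    unfolding pair_chain[OF ab(1,2)] 1 2 by simp
  then show ?thesis by (rule sin_cancel[OF ab])
qed

lemma pair_chain_prev:
  assumes "a < n" "b < n"
  shows "pair (chain a b (Suc s) v) (if even s then a else b) = - pair (chain a b s v) (if even s then a else b)"
  unfolding chain_snoc using assms by (auto simp: pair_reflect)

lemma pair_chain_end:
  assumes ab: "a < n" "b < n" "a \<noteq> b"
  shows "pair (chain a b (M a b) v) (if even (M a b) then a else b) = - pair v a"
proof -
  have 1: "(real (M a b) + 1) * angle a b = pi + angle a b"
    using angle_mult[OF ab] by (simp add: algebra_simps)
  have "sin (angle a b) * pair (chain a b (M a b) v) (if even (M a b) then a else b)
    = sin (angle a b) * (- pair v a)"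
    unfolding pair_chain[OF ab(1,2)] 1 angle_mult[OF ab] by simp
  then show ?thesis by (rule sin_cancel[OF ab])
qed

lemma pair_chain_pos_strict:
  assumes ab: "a < n" "b < n" "a \<noteq> b" and s: "s < M a b" and "pair v a > 0" "pair v b > 0"
  shows "pair (chain a b s v) (if even s then a else b) > 0"
  using pair_chain_pos[OF ab, of s v] pair_chain_last[OF ab, of s v] assms(4-)
  by (cases "Suc s = M a b") auto

lemma chain_end_neg:
  assumes ab: "a < n" "b < n" "a \<noteq> b" and "pair v a > 0" "pair v b > 0"
  shows "pair (chain a b (M a b) v) a < 0" "pair (chain a b (M a b) v) b < 0"
proof -
  obtain s where s: "M a b = Suc s" using M_ge2[OF ab] by (cases "M a b") auto
  have "pair (chain a b (M a b) v) (if even s then a else b) = - pair v b"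
    using pair_chain_prev[OF ab(1,2), of s v] pair_chain_last[OF ab, of s v] unfolding s by simp
  then show "pair (chain a b (M a b) v) a < 0" "pair (chain a b (M a b) v) b < 0"
    using pair_chain_end[OF ab, of v] assms(4,5) by (auto simp: s split: if_splits)
qed

text \<open>\<open>\<alpha>\<^sub>a + cos \<theta> \<alpha>\<^sub>b\<close> is the component of \<open>\<alpha>\<^sub>a\<close> orthogonal to \<open>\<alpha>\<^sub>b\<close>.  The projection of \<open>v\<close> to the plane lies
  within a quarter turn of it; as \<open>m\<close> steps make half a turn, the descent continues through half of the steps.\<close>

lemma pair_chain_half:
  assumes ab: "a < n" "b < n" "a \<noteq> b" and s: "2 * Suc s \<le> M a b"
    and "pair v b \<le> 0" "pair v a + cos (angle a b) * pair v b > 0"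
  shows "pair (chain a b s v) (if even s then a else b) > 0"
proof -
  let ?t = "angle a b" and ?x = "pair v b" and ?y = "pair v a"
  let ?S = "sin ((real s + 1) * ?t)" and ?C = "cos ((real s + 1) * ?t)"
  have S: "?S > 0" using sin_multiple_pos[OF ab, of "real s + 1"] s by simp
  have "2 * ((real s + 1) * ?t) \<le> real (M a b) * ?t"
    using s angle_pos[OF ab] by (simp add: mult_right_mono flip: mult.assoc of_nat_Suc)
  then have "?C \<ge> 0"
    using angle_mult[OF ab] angle_pos[OF ab] by (intro cos_ge_zero) (auto intro: order_trans[of _ 0])
  have sub: "sin (real s * ?t) = ?S * cos ?t - ?C * sin ?t"
    using sin_diff[of "(real s + 1) * ?t" ?t] by (simp add: algebra_simps)
  have "0 \<le> - ?x * (?C * sin ?t)"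
    using assms(5) \<open>?C \<ge> 0\<close> sin_pos[OF ab] by (intro mult_nonneg_nonneg) auto
  moreover have "0 < (?y + cos ?t * ?x) * ?S" using assms(6) S by simp
  ultimately have "0 < (?y + cos ?t * ?x) * ?S + - ?x * (?C * sin ?t)" by linarith
  also have "\<dots> = sin ?t * pair (chain a b s v) (if even s then a else b)"
    unfolding pair_chain[OF ab(1,2)] sub by (simp add: algebra_simps)
  finally show ?thesis using sin_pos[OF ab] by (simp add: zero_less_mult_iff)
qed

text \<open>For odd \<open>m\<close> the step after the last one covered by \<open>pair_chain_half\<close> lies in the middle.  Its pairing may be
  negative, but since \<open>sin ((r + 2) \<theta>) = sin ((r + 1) \<theta>)\<close> it is outweighed by the preceding one.\<close>

lemma pair_chain_tie:
  assumes ab: "a < n" "b < n" "a \<noteq> b" and r: "2 * Suc r + 1 = M a b"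
    and "pair v a + cos (angle a b) * pair v b > 0"
  shows "pair (chain a b r v) (if even r then a else b)
       + pair (chain a b (Suc r) v) (if even (Suc r) then a else b) > 0"
proof -
  let ?t = "angle a b" and ?x = "pair v b" and ?y = "pair v a"
  let ?S = "sin ((real r + 1) * ?t)" and ?C = "cos ((real r + 1) * ?t)"
  have S: "?S > 0" using sin_multiple_pos[OF ab, of "real r + 1"] r by simp
  have "(2 * (real r + 1) + 1) * ?t = pi"
    using angle_mult[OF ab] unfolding r[symmetric] by (simp add: algebra_simps)
  then have e: "(real r + 2) * ?t = pi - (real r + 1) * ?t" by (simp add: algebra_simps)
  have S2: "sin ((real r + 2) * ?t) = ?S" unfolding e by simp
  have "?S = ?S * cos ?t + ?C * sin ?t"
    using sin_add[of "(real r + 1) * ?t" ?t] S2 by (simp add: algebra_simps)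
  moreover have "sin (real r * ?t) = ?S * cos ?t - ?C * sin ?t"
    using sin_diff[of "(real r + 1) * ?t" ?t] by (simp add: algebra_simps)
  ultimately have S0: "sin (real r * ?t) = 2 * cos ?t * ?S - ?S" by (simp add: algebra_simps)
  have "0 < 2 * ?S * (?y + cos ?t * ?x)" using S assms(5) by simp
  also have "\<dots> = ?y * ?S + ?x * sin (real r * ?t) + (?y * sin ((real r + 2) * ?t) + ?x * ?S)"
    unfolding S2 S0 by (simp add: algebra_simps)
  also have "\<dots> = sin ?t * pair (chain a b r v) (if even r then a else b)
     + sin ?t * pair (chain a b (Suc r) v) (if even (Suc r) then a else b)"
    unfolding pair_chain[OF ab(1,2)] by (simp add: add.commute)
  finally have "0 < sin ?t * (pair (chain a b r v) (if even r then a else b)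
     + pair (chain a b (Suc r) v) (if even (Suc r) then a else b))"
    by (simp only: distrib_left)
  then show ?thesis using sin_pos[OF ab] by (simp add: zero_less_mult_iff)
qed

definition height :: "(nat \<Rightarrow> real) \<Rightarrow> real" where
  "height v = (\<Sum>i<n. v i)"

lemma height_simple [simp]: "k < n \<Longrightarrow> height (simple_root k) = 1"
  by (simp add: height_def simple_root_def)

lemma height_reflect: "k < n \<Longrightarrow> height (reflect k v) = height v - 2 * pair v k"
  using height_simple[of k]
  by (simp add: height_def reflect_def sum_subtractf sum_distrib_left[symmetric])

lemma height_swap:
  assumes ab: "a < n" "b < n" "a \<noteq> b"
  shows "sin (angle a b) * (height (chain a b r v) - height (chain b a r v))
    = - 2 * sin (real r * angle a b) * (pair v a - pair v b)"
proof -
  \<comment> \<open>Both parities of \<open>chain_swap_diff\<close> have the same sum, as simple roots have height \<open>1\<close>.\<close>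
  have key: "(\<Sum>i<n. c * (x * f i - y * g i)) = c * (x * (\<Sum>i<n. f i) - y * (\<Sum>i<n. g i))"
    for c x y :: real and f g
    by (simp add: sum_subtractf sum_distrib_left right_diff_distrib)
  have "sin (angle a b) * (height (chain a b r v) - height (chain b a r v))
     = (\<Sum>i<n. sin (angle a b) * (chain a b r v i - chain b a r v i))"
    by (simp add: height_def sum_subtractf sum_distrib_left right_diff_distrib)
  also have "\<dots> = - 2 * sin (real r * angle a b) *
      (if odd r then pair v a * height (simple_root a) - pair v b * height (simple_root b)
       else pair v a * height (simple_root b) - pair v b * height (simple_root a))"
    unfolding chain_swap_diff[OF ab] height_def
    by (cases "even r") (simp_all only: if_True if_False key not_True_eq_False not_False_eq_True)
  also have "\<dots> = - 2 * sin (real r * angle a b) * (pair v a - pair v b)"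
    using ab by simp
  finally show ?thesis .
qed

text \<open>This breaks the tie left open by \<open>pair_chain_tie\<close>: of the two ways around the orbit, the one that starts with
  the larger pairing ends lower.\<close>

lemma height_swap_less:
  assumes ab: "a < n" "b < n" "a \<noteq> b" and "0 < r" "r < M a b" and "pair v b < pair v a"
  shows "height (chain a b r v) < height (chain b a r v)"
proof -
  have "sin (angle a b) * (height (chain a b r v) - height (chain b a r v)) < 0"
    unfolding height_swap[OF ab] using sin_multiple_pos[OF ab, of "real r"] assms(4-)
    by (simp add: mult_pos_pos)
  then show ?thesis using sin_pos[OF ab] by (simp add: mult_less_0_iff)
qed

text \<open>If no such \<open>k\<close> existed, the component \<open>w\<close> of \<open>v\<close> orthogonal to \<open>\<alpha>\<^sub>j\<close> would have nonnegative coordinates and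
  nonpositive pairings with all simple roots.  Positive definiteness forces \<open>w = 0\<close>, so that \<open>v\<close> is a nonpositive
  multiple of \<open>\<alpha>\<^sub>j\<close>.\<close>

lemma exists_direction:
  assumes "\<And>i. v i \<ge> 0" "i0 < n" "v i0 > 0" "j < n" "pair v j \<le> 0"
  shows "\<exists>k<n. k \<noteq> j \<and> pair v k + cos (angle k j) * pair v j > 0"
proof (rule ccontr)
  assume no: "\<not> ?thesis"
  define x where "x = pair v j"
  \<comment> \<open>As \<open>x \<le> 0\<close>, subtracting \<open>x \<alpha>\<^sub>j\<close> keeps the coordinates nonnegative.\<close>
  define w where "w = (\<lambda>i. v i - x * simple_root j i)"
  have pw: "pair w i = pair v i - x * gram j i" for i
    using assms(4) by (simp add: w_def pair_diff_scale pair_simple)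
  have "w i * pair w i \<le> 0" if "i < n" for i
  proof (cases "i = j")
    case True
    then show ?thesis using assms(4) by (simp add: pw x_def)
  next
    case False
    have "pair v i + cos (angle i j) * x \<le> 0"
      using no False that unfolding x_def by force
    then have "pair w i \<le> 0"
      unfolding pw gram_angle using angle_sym[of i j] that assms(4) by (simp add: algebra_simps)
    then show ?thesis
      using False assms(1)[of i] by (simp add: w_def simple_root_def mult_nonneg_nonpos)
  qed
  then have "energy w \<le> 0"
    unfolding energy_def by (intro sum_nonpos) auto
  then have w0: "w i = 0" if "i < n" for i
    using energy_pos[of i w] that by force
  have "v i0 = x * simple_root j i0"
    using w0[OF assms(2)] by (simp add: w_def)
  then show False
    using assms(3,5) by (simp add: x_def simple_root_def split: if_splits)
qed

lemma simple_pair_pos: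
  assumes "t < n" "j < n" "pair (simple_root t) j > 0"
  shows "t = j"
  using gram_nonpos[of t j] assms by (fastforce simp: pair_simple)

lemma simple_pair_zero:
  assumes "t < n" "j < n" "pair (simple_root t) j = 0"
  shows "t \<noteq> j" "M t j = 2"
proof -
  show tj: "t \<noteq> j" using assms by (auto simp: pair_simple)
  have ge: "M t j \<ge> 2" by (rule M_ge2[OF assms(1,2) tj])
  show "M t j = 2"
  proof (rule ccontr)
    assume "M t j \<noteq> 2"
    then have "real (M t j) > 2" using ge by simp
    then have "pi / real (M t j) < pi / 2" "0 < pi / real (M t j)"
      using divide_strict_left_mono[of 2 "real (M t j)" pi] by auto
    then have "cos (pi / real (M t j)) > 0"
      by (intro cos_gt_zero_pi) auto
    then show False using assms by (simp add: pair_simple gram_def)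
  qed
qed

lemma arefl_minus: "arefl a b r (\<lambda>i. - v i) = (\<lambda>i. - arefl a b r v i)"
proof -
  have "pair (\<lambda>i. - w i) k = - pair w k" for w k
    using pair_scale[of "- 1" w k] by simp
  then have "reflect k (\<lambda>i. - w i) = (\<lambda>i. - reflect k w i)" for w k
    by (simp add: reflect_def algebra_simps)
  then show ?thesis by (induction r arbitrary: a b) auto
qed

text \<open>A climb that starts at a simple root \<open>\<alpha>\<^sub>b\<close> meets the angles \<open>\<theta>, 2 \<theta>, \<dots>\<close> one after the other.\<close>

lemma pair_chain_simple:
  assumes ab: "a < n" "b < n" "a \<noteq> b"
  shows "pair (chain a b s (simple_root b)) (if even s then a else b) = - cos ((real s + 1) * angle a b)"
proof -
  let ?t = "angle a b"
  have sub: "sin (real s * ?t) = sin ((real s + 1) * ?t) * cos ?t - cos ((real s + 1) * ?t) * sin ?t"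
    using sin_diff[of "(real s + 1) * ?t" ?t] by (simp add: algebra_simps)
  have g: "gram b a = - cos ?t" using ab gram_sym[of a b] by (simp add: gram_angle)
  have "sin ?t * pair (chain a b s (simple_root b)) (if even s then a else b)
      = sin ?t * (- cos ((real s + 1) * ?t))"
    unfolding pair_chain[OF ab(1,2)] sub using ab g by (simp add: pair_simple algebra_simps)
  then show ?thesis by (rule sin_cancel[OF ab])
qed

text \<open>Writing the longest element of the dihedral group in its two ways shows that the image \<open>z\<close> of the simple root
  satisfies \<open>s\<^sub>b z = - z\<close>.  Hence \<open>z\<close> is a multiple of \<open>\<alpha>\<^sub>b\<close>, and the last pairing of the climb identifies the
  multiple as \<open>1\<close>.\<close>

lemma ribbon_root:
  assumes ab: "a < n" "b < n" "a \<noteq> b"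
  shows "arefl a b (M a b - 1) (simple_root (if odd (M a b) then a else b)) = simple_root b"
proof -
  let ?t = "if odd (M a b) then a else b"
  obtain m where m: "M a b = Suc m" using M_ge2[OF ab] by (cases "M a b") auto
  define z where "z = arefl a b m (simple_root ?t)"
  have t: "?t < n" "?t = (if even m then a else b)" using ab by (auto simp: m)
  have "arefl a b (Suc m) (simple_root ?t) = (\<lambda>i. - z i)"
    unfolding arefl_snoc t(2)[symmetric] reflect_simple_self[OF t(1)] arefl_minus z_def ..
  then have "reflect b z = (\<lambda>i. - z i)"
    using arefl_braid[OF ab, of "simple_root ?t"] unfolding m z_def by simp
  then have "z i - 2 * (pair z b * simple_root b i) = - z i" for i
    unfolding reflect_def fun_eq_iff by (simp only: mult.assoc)
  then have *: "z i = pair z b * simple_root b i" for i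
    by (smt (verit))
  have pi: "(real m + 1) * angle a b = pi" "(real m + 1) * angle b a = pi"
    using angle_mult[OF ab] angle_sym[OF ab(1,2)] by (simp_all add: m add.commute)
  have "pair z b = 1"
  proof (cases "even m")
    case True
    then have "z = chain b a m (simple_root a)" by (simp add: z_def arefl_conv_chain m)
    then show ?thesis
      using pair_chain_simple[OF ab(2,1) not_sym[OF ab(3)], of m] True unfolding pi by simp
  next
    case False
    then have "z = chain a b m (simple_root b)" by (simp add: z_def arefl_conv_chain m)
    then show ?thesis
      using pair_chain_simple[OF ab, of m] False unfolding pi by simp
  qed
  then have "z = simple_root b" using * by (intro ext) simp
  then show ?thesis by (simp add: z_def m)
qed

lemma cos_multiple_pos_iff:
  assumes ab: "a < n" "b < n" "a \<noteq> b" and s: "s \<le> M a b"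
  shows "cos (real s * angle a b) > 0 \<longleftrightarrow> 2 * s < M a b"
    and "cos (real s * angle a b) \<le> 0 \<longleftrightarrow> M a b \<le> 2 * s"
proof -
  have t: "angle a b > 0" "real (M a b) * angle a b = pi"
    using angle_pos[OF ab] angle_mult[OF ab] .
  have "real s * angle a b \<le> real (M a b) * angle a b"
    using t(1) s by (intro mult_right_mono) auto
  then have le: "real s * angle a b \<le> pi" unfolding t(2) .
  have 1: "cos (real s * angle a b) > 0" if "2 * s < M a b"
  proof (rule cos_gt_zero_pi)
    have "(2 * real s) * angle a b < real (M a b) * angle a b"
      using that t(1) by (intro mult_strict_right_mono) linarith+
    then show "real s * angle a b < pi / 2" unfolding t(2) mult.assoc by linarith
    show "- (pi / 2) < real s * angle a b"
      using t(1) pi_gt_zero mult_nonneg_nonneg[of "real s" "angle a b"] by linarith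
  qed
  have 2: "cos (real s * angle a b) \<le> 0" if "M a b \<le> 2 * s"
  proof -
    have "real (M a b) * angle a b \<le> (2 * real s) * angle a b"
      using that t(1) by (intro mult_right_mono) linarith+
    then have "pi / 2 \<le> real s * angle a b" unfolding t(2) mult.assoc by linarith
    then have "cos (real s * angle a b) \<le> cos (pi / 2)"
      using le by (intro cos_monotone_0_pi_le) auto
    then show ?thesis by simp
  qed
  show "cos (real s * angle a b) > 0 \<longleftrightarrow> 2 * s < M a b"
    "cos (real s * angle a b) \<le> 0 \<longleftrightarrow> M a b \<le> 2 * s"
  proof -
    have "2 * s < M a b \<or> M a b \<le> 2 * s" by linarith
    then show "cos (real s * angle a b) > 0 \<longleftrightarrow> 2 * s < M a b"
      "cos (real s * angle a b) \<le> 0 \<longleftrightarrow> M a b \<le> 2 * s"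
      using 1 2 not_less not_le by blast+
  qed
qed

end


section \<open>Constraints on the Coxeter graph\<close>

context finite_coxeter_system
begin

lemma gram_le_half:
  assumes "i < n" "j < n" "M i j \<ge> 3"
  shows "gram i j \<le> - 1 / 2"
proof -
  have "real (M i j) \<ge> 3" using assms(3) by linarith
  then have "pi / real (M i j) \<le> pi / 3" "0 \<le> pi / real (M i j)"
    using divide_left_mono[of 3 "real (M i j)" pi] by auto
  then have "cos (pi / 3) \<le> cos (pi / real (M i j))"
    by (intro cos_monotone_0_pi_le) auto
  then show ?thesis by (simp add: gram_def cos_60)
qed

text \<open>A bond of label at least \<open>4\<close> has \<open>gram i j \<le> - sqrt 2 / 2\<close>.\<close>

lemma gram_le_sqrt:
  assumes "i < n" "j < n" "M i j \<ge> 4"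
  shows "sqrt 2 * gram i j \<le> - 1"
proof -
  have "real (M i j) \<ge> 4" using assms(3) by linarith
  then have "pi / real (M i j) \<le> pi / 4" "0 \<le> pi / real (M i j)"
    using divide_left_mono[of 4 "real (M i j)" pi] by auto
  then have "cos (pi / 4) \<le> cos (pi / real (M i j))"
    by (intro cos_monotone_0_pi_le) auto
  then have "sqrt 2 * (sqrt 2 / 2) \<le> sqrt 2 * cos (pi / real (M i j))"
    by (intro mult_left_mono) (simp_all add: cos_45)
  then show ?thesis by (simp add: gram_def)
qed

text \<open>A set of vertices each of which has two neighbours in the set would make the sum of its simple roots a vector of
  nonpositive energy.  So every induced subgraph has a vertex of degree at most one, which is how the forest property is
  used below.\<close>

lemma exists_leaf:
  assumes "S \<subseteq> {..<n}" "S \<noteq> {}"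
  shows "\<exists>q\<in>S. \<forall>s\<in>S. \<forall>t\<in>S. s \<noteq> q \<and> t \<noteq> q \<and> M q s \<ge> 3 \<and> M q t \<ge> 3 \<longrightarrow> s = t"
proof (rule ccontr)
  assume no: "\<not> ?thesis"
  define v where "v = (\<lambda>i. if i \<in> S then 1 else 0 :: real)"
  have fin: "finite S" using assms(1) finite_subset by blast
  have Sn: "{..<n} \<inter> S = S" using assms(1) by auto
  have p: "pair v q = (\<Sum>t\<in>S. gram t q)" for q
  proof -
    have "pair v q = (\<Sum>t<n. if t \<in> S then gram t q else 0)"
      unfolding pair_def v_def by (intro sum.cong) auto
    then show ?thesis using Sn by (simp add: sum.inter_restrict[symmetric])
  qed
  have "pair v q \<le> 0" if q: "q \<in> S" for q
  proof -
    from no q obtain s t where st: "s \<in> S" "t \<in> S" "s \<noteq> q" "t \<noteq> q" "M q s \<ge> 3" "M q t \<ge> 3" "s \<noteq> t"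
      by blast
    have n: "q < n" "s < n" "t < n" using st q assms(1) by auto
    have "(\<Sum>u\<in>S. gram u q) = gram q q + gram s q + gram t q + (\<Sum>u\<in>S - {q} - {s} - {t}. gram u q)"
      using fin st q by (simp add: sum.remove[of S q] sum.remove[of "S - {q}" s] sum.remove[of "S - {q} - {s}" t])
    also have "(\<Sum>u\<in>S - {q} - {s} - {t}. gram u q) \<le> 0"
      using assms(1) n by (intro sum_nonpos gram_nonpos) auto
    finally have "pair v q \<le> gram q q + gram s q + gram t q" unfolding p by simp
    moreover have "gram s q \<le> - 1 / 2"
      by (rule gram_le_half[OF n(2,1)]) (use st M_sym[OF n(2,1)] in simp)
    moreover have "gram t q \<le> - 1 / 2"
      by (rule gram_le_half[OF n(3,1)]) (use st M_sym[OF n(3,1)] in simp)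
    ultimately show ?thesis using gram_diag[OF n(1)] by linarith
  qed
  then have "energy v \<le> 0"
    unfolding energy_def by (intro sum_nonpos) (auto simp: v_def)
  moreover obtain q where "q \<in> S" using assms(2) by blast
  ultimately show False
    using energy_pos[of q v] assms(1) by (auto simp: v_def)
qed

text \<open>Positivity on \<open>x \<alpha>\<^sub>i + \<alpha>\<^sub>j + \<alpha>\<^sub>k\<close>.  The weights \<open>x = 1\<close> and \<open>x = sqrt 2\<close> are those of the null vectors of
  the affine diagrams \<open>A\<^sub>2\<close> and \<open>C\<^sub>2\<close>.\<close>

lemma energy_three:
  assumes "i < n" "j < n" "k < n" "i \<noteq> j" "i \<noteq> k" "j \<noteq> k" "x \<noteq> 0"
  shows "x * x + 1 + 1 + 2 * (x * gram i j + x * gram i k + gram j k) > 0"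
proof -
  define v where "v = (\<lambda>t. x * simple_root i t + (simple_root j t + simple_root k t))"
  have p: "pair v t = x * gram i t + (gram j t + gram k t)" for t
    using assms(1-3) unfolding v_def by (simp only: pair_add pair_scale pair_simple)
  have pick: "(\<Sum>t<n. simple_root u t * f t) = f u" if "u < n" for u f
  proof -
    have "(\<Sum>t<n. simple_root u t * f t) = (\<Sum>t<n. if t = u then f t else 0)"
      by (intro sum.cong) (auto simp: simple_root_def)
    then show ?thesis using that by simp
  qed
  have "energy v = (\<Sum>t<n. x * (simple_root i t * pair v t) + (simple_root j t * pair v t + simple_root k t * pair v t))"
    unfolding energy_def v_def by (intro sum.cong) (auto simp: algebra_simps)
  also have "\<dots> = x * pair v i + (pair v j + pair v k)"
    using assms(1-3) by (simp only: sum.distrib sum_distrib_left[symmetric] pick)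
  finally have "energy v = x * x + 1 + 1 + 2 * (x * gram i j + x * gram i k + gram j k)"
    using gram_sym[OF assms(2,1)] gram_sym[OF assms(3,1)] gram_sym[OF assms(3,2)] assms(1-3)
    by (simp add: p algebra_simps)
  moreover have "v i \<noteq> 0" using assms by (simp add: v_def simple_root_def)
  ultimately show ?thesis using energy_pos[OF assms(1), of v] by simp
qed

lemma no_triangle:
  assumes "i < n" "j < n" "k < n" "i \<noteq> j" "i \<noteq> k" "j \<noteq> k" "M i j \<ge> 3" "M i k \<ge> 3"
  shows "M j k = 2"
proof (rule ccontr)
  assume "M j k \<noteq> 2"
  then have "M j k \<ge> 3" using M_ge2[OF assms(2,3,6)] by linarith
  then show False
    using energy_three[OF assms(1-6), of 1] gram_le_half[OF assms(1,2,7)] gram_le_half[OF assms(1,3,8)]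
      gram_le_half[OF assms(2,3)] by simp
qed

lemma no_double_even:
  assumes "i < n" "j < n" "k < n" "i \<noteq> j" "i \<noteq> k" "j \<noteq> k" "M i j \<ge> 4" "M i k \<ge> 4"
  shows False
  using energy_three[OF assms(1-6), of "sqrt 2"] gram_le_sqrt[OF assms(1,2,7)] gram_le_sqrt[OF assms(1,3,8)]
    gram_nonpos[OF assms(2,3,6)] by simp

end


section \<open>Spans modulo a two-sided ideal\<close>

text \<open>Computations take place in a ring of type \<open>'r\<close> modulo a two-sided ideal \<open>J\<close>; \<open>sc\<close> embeds the scalars in the
  centre.  Working with congruences instead of a quotient keeps the ambient type-class arithmetic available.\<close>

locale quotient_span =
  fixes J :: "'r::ring_1 set" and sc :: "complex \<Rightarrow> 'r"
  assumes zero_J: "0 \<in> J"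
    and add_J: "x \<in> J \<Longrightarrow> y \<in> J \<Longrightarrow> x + y \<in> J"
    and left_J: "x \<in> J \<Longrightarrow> r * x \<in> J"
    and right_J: "x \<in> J \<Longrightarrow> x * r \<in> J"
    and sc_one: "sc 1 = 1"
    and sc_add: "sc (a + b) = sc a + sc b"
    and sc_mult: "sc (a * b) = sc a * sc b"
    and sc_central: "sc c * r = r * sc c"
begin

text \<open>The preimage of the linear span of \<open>S\<close> in the quotient by \<open>J\<close>.  Containing \<open>J\<close> makes it stable under
  congruence.\<close>

inductive_set spn :: "'r set \<Rightarrow> 'r set" for S where
  ideal: "z \<in> J \<Longrightarrow> z \<in> spn S"
| base: "s \<in> S \<Longrightarrow> s \<in> spn S"
| add: "u \<in> spn S \<Longrightarrow> v \<in> spn S \<Longrightarrow> u + v \<in> spn S"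
| scale: "u \<in> spn S \<Longrightarrow> sc c * u \<in> spn S"

definition eqv :: "'r \<Rightarrow> 'r \<Rightarrow> bool" (infix "\<approx>\<^sub>J" 50) where
  "x \<approx>\<^sub>J y \<longleftrightarrow> x - y \<in> J"

lemma sc_zero [simp]: "sc 0 = 0"
  using sc_add[of 0 0] by simp

lemma sc_minus: "sc (- c) = - sc c"
  using sc_add[of c "- c"] by (simp add: eq_neg_iff_add_eq_0 add.commute)

lemma sc_diff: "sc (a - b) = sc a - sc b"
  using sc_add[of "a - b" b] by (simp add: eq_diff_eq)

lemma sc_collapse: "sc a * (sc b * x) = sc (a * b) * x"
  by (simp add: sc_mult mult.assoc)

lemma sc_left_commute: "x * (sc c * y) = sc c * (x * y)"
  by (metis mult.assoc sc_central)

lemma uminus_J: "x \<in> J \<Longrightarrow> - x \<in> J"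
  using left_J[of x "- 1"] by simp

lemma spn_uminus: "u \<in> spn S \<Longrightarrow> - u \<in> spn S"
  using scale[of u S "- 1"] by (simp add: sc_minus sc_one)

lemma spn_diff: "u \<in> spn S \<Longrightarrow> v \<in> spn S \<Longrightarrow> u - v \<in> spn S"
  using add[of u S "- v"] spn_uminus by simp

lemma spn_zero [simp]: "0 \<in> spn S"
  by (rule ideal[OF zero_J])

lemma eqv_refl [simp]: "x \<approx>\<^sub>J x"
  by (simp add: eqv_def zero_J)

lemma eqv_sym: "x \<approx>\<^sub>J y \<Longrightarrow> y \<approx>\<^sub>J x"
  unfolding eqv_def using uminus_J[of "x - y"] by simp

lemma eqv_trans [trans]: "x \<approx>\<^sub>J y \<Longrightarrow> y \<approx>\<^sub>J z \<Longrightarrow> x \<approx>\<^sub>J z"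
  unfolding eqv_def using add_J[of "x - y" "y - z"] by simp

lemma eqv_mult:
  assumes "x \<approx>\<^sub>J x'" "y \<approx>\<^sub>J y'"
  shows "x * y \<approx>\<^sub>J x' * y'"
proof -
  have "x * y - x' * y' = (x - x') * y + x' * (y - y')" by (simp add: algebra_simps)
  then show ?thesis
    using add_J[OF right_J[of "x - x'" y] left_J[of "y - y'" x']] assms unfolding eqv_def by simp
qed

lemma eqv_left: "y \<approx>\<^sub>J y' \<Longrightarrow> x * y \<approx>\<^sub>J x * y'"
  and eqv_right: "x \<approx>\<^sub>J x' \<Longrightarrow> x * y \<approx>\<^sub>J x' * y"
  by (simp_all add: eqv_mult)

lemma eqv_add: "x \<approx>\<^sub>J x' \<Longrightarrow> y \<approx>\<^sub>J y' \<Longrightarrow> x + y \<approx>\<^sub>J x' + y'"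
  unfolding eqv_def using add_J[of "x - x'" "y - y'"] by (simp add: algebra_simps)

lemma eqv_uminus: "x \<approx>\<^sub>J x' \<Longrightarrow> - x \<approx>\<^sub>J - x'"
  using eqv_mult[of "- 1" "- 1" x x'] by simp

lemma eqv_diff: "x \<approx>\<^sub>J x' \<Longrightarrow> y \<approx>\<^sub>J y' \<Longrightarrow> x - y \<approx>\<^sub>J x' - y'"
  using eqv_add[of x x' "- y" "- y'"] eqv_uminus by simp

lemma spn_eqv: "v \<approx>\<^sub>J u \<Longrightarrow> u \<in> spn S \<Longrightarrow> v \<in> spn S"
  unfolding eqv_def using add[of "v - u" S u] ideal[of "v - u" S] by simp

lemma spn_left:
  assumes "u \<in> spn S" "\<And>s. s \<in> S \<Longrightarrow> a * s \<in> spn S'"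
  shows "a * u \<in> spn S'"
  using assms(1)
proof induction
  case (scale u c)
  then show ?case using spn.scale[OF scale.IH, of c] by (simp add: sc_left_commute[of a])
qed (auto intro: spn.intros left_J assms(2) simp: distrib_left)

lemma spn_right:
  assumes "u \<in> spn S" "\<And>s. s \<in> S \<Longrightarrow> s * a \<in> spn S'"
  shows "u * a \<in> spn S'"
  using assms(1)
proof induction
  case (scale u c)
  then show ?case using spn.scale[OF scale.IH, of c] by (simp add: mult.assoc)
qed (auto intro: spn.intros right_J assms(2) simp: distrib_right)

lemma spn_subset: "(\<And>s. s \<in> S \<Longrightarrow> s \<in> spn S') \<Longrightarrow> u \<in> spn S \<Longrightarrow> u \<in> spn S'"
  using spn_left[of u S 1 S'] by simp

lemma spn_mono: "S \<subseteq> S' \<Longrightarrow> u \<in> spn S \<Longrightarrow> u \<in> spn S'"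
  by (rule spn_subset) (auto intro: spn.base)

lemma spn_singleton: "u \<in> spn {s} \<longleftrightarrow> (\<exists>c. u \<approx>\<^sub>J sc c * s)"
proof
  assume "u \<in> spn {s}"
  then show "\<exists>c. u \<approx>\<^sub>J sc c * s"
  proof induction
    case (ideal z)
    then show ?case by (intro exI[of _ 0]) (simp add: eqv_def)
  next
    case (base t)
    then show ?case by (intro exI[of _ 1]) (simp add: sc_one)
  next
    case (add u v)
    then obtain a b where "u \<approx>\<^sub>J sc a * s" "v \<approx>\<^sub>J sc b * s" by blast
    then have "u + v \<approx>\<^sub>J sc (a + b) * s"
      using eqv_add by (simp add: sc_add distrib_right)
    then show ?case by blast
  next
    case (scale u c)
    then obtain a where "u \<approx>\<^sub>J sc a * s" by blast
    then have "sc c * u \<approx>\<^sub>J sc (c * a) * s"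
      using eqv_left by (simp add: sc_mult mult.assoc)
    then show ?case by blast
  qed
next
  assume "\<exists>c. u \<approx>\<^sub>J sc c * s"
  then show "u \<in> spn {s}" using spn_eqv scale base by blast
qed

end


section \<open>Braid, quadratic and ribbon relations\<close>

fun altw :: "'r::monoid_mult \<Rightarrow> 'r \<Rightarrow> nat \<Rightarrow> 'r" where
  "altw x y 0 = 1"
| "altw x y (Suc r) = x * altw y x r"

lemma altw_snoc: "altw x y (Suc r) = altw x y r * (if even r then x else y)"
  by (induction x y r rule: altw.induct) (auto simp: mult.assoc)

text \<open>The relations on which the filtration argument and the Hecke argument rest: inverses, braid, quadratic and
  eigenvalue relations.  \<open>odd_par\<close> says that generators joined by an odd bond carry the same parameters.\<close>

locale bmw_relations = finite_coxeter_system n M + quotient_span J sc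
  for n :: nat and M :: "nat \<Rightarrow> nat \<Rightarrow> nat" and J :: "'r::ring_1 set" and sc +
  fixes gx gy ge :: "nat \<Rightarrow> 'r" and q l :: "nat \<Rightarrow> complex"
  assumes xy: "i < n \<Longrightarrow> gx i * gy i \<approx>\<^sub>J 1"
    and yx: "i < n \<Longrightarrow> gy i * gx i \<approx>\<^sub>J 1"
    and braid: "i < n \<Longrightarrow> j < n \<Longrightarrow> i \<noteq> j \<Longrightarrow>
      altw (gx i) (gx j) (M i j) \<approx>\<^sub>J altw (gx j) (gx i) (M i j)"
    and q_nz: "i < n \<Longrightarrow> q i \<noteq> 0" and q_sq: "i < n \<Longrightarrow> (q i)\<^sup>2 \<noteq> 1" and l_nz: "i < n \<Longrightarrow> l i \<noteq> 0"
    and quadratic: "i < n \<Longrightarrow>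
      sc (inverse (q i) - q i) * ge i \<approx>\<^sub>J sc (l i) * (gx i - sc (q i)) * (gx i + sc (inverse (q i)))"
    and xe: "i < n \<Longrightarrow> gx i * ge i \<approx>\<^sub>J sc (inverse (l i)) * ge i"
    and ex: "i < n \<Longrightarrow> ge i * gx i \<approx>\<^sub>J sc (inverse (l i)) * ge i"
    and odd_par: "i < n \<Longrightarrow> j < n \<Longrightarrow> odd (M i j) \<Longrightarrow> q i = q j \<and> l i = l j"
begin

definition eta :: "nat \<Rightarrow> complex" where
  "eta i = inverse (q i) - q i"

lemma eta_nz: "i < n \<Longrightarrow> eta i \<noteq> 0"
  using q_nz[of i] q_sq[of i] by (auto simp: eta_def field_simps power2_eq_square)

lemma quadratic_expand:
  assumes "i < n"
  shows "sc (l i) * (gx i - sc (q i)) * (gx i + sc (inverse (q i)))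
    = sc (l i) * (gx i * gx i) + sc (l i * eta i) * gx i - sc (l i)"
proof -
  have 1: "sc (q i) * sc (inverse (q i)) = 1"
    using q_nz[OF assms] by (simp add: sc_mult[symmetric] sc_one)
  have 2: "gx i * sc (inverse (q i)) = sc (inverse (q i)) * gx i"
    by (rule sc_central[symmetric])
  have "(gx i - sc (q i)) * (gx i + sc (inverse (q i)))
     = gx i * gx i + (sc (inverse (q i)) - sc (q i)) * gx i - 1"
    by (simp add: algebra_simps 1 2)
  moreover have "sc (inverse (q i)) - sc (q i) = sc (eta i)"
    by (simp only: eta_def sc_diff)
  ultimately have e: "(gx i - sc (q i)) * (gx i + sc (inverse (q i)))
     = gx i * gx i + sc (eta i) * gx i - 1"
    by simp
  show ?thesis
    unfolding mult.assoc e by (simp add: distrib_left right_diff_distrib sc_collapse)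
qed

text \<open>The quadratic relation makes \<open>E\<^sub>i\<close> a polynomial in \<open>X\<^sub>i\<close>, so whatever conjugates \<open>X\<^sub>j\<close> to \<open>X\<^sub>k\<close> conjugates
  \<open>E\<^sub>j\<close> to \<open>E\<^sub>k\<close> when the parameters agree.\<close>

lemma e_expand:
  assumes "i < n"
  shows "ge i \<approx>\<^sub>J sc (l i / eta i) * (gx i * gx i) + sc (l i) * gx i - sc (l i / eta i)"
proof -
  have "ge i = sc (1 / eta i) * (sc (eta i) * ge i)"
    using eta_nz[OF assms] by (simp add: sc_collapse sc_one)
  also have "\<dots> \<approx>\<^sub>J sc (1 / eta i) * (sc (l i) * (gx i * gx i) + sc (l i * eta i) * gx i - sc (l i))"
    using quadratic[OF assms] unfolding quadratic_expand[OF assms] eta_def[symmetric] by (rule eqv_left)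
  also have "\<dots> = sc (l i / eta i) * (gx i * gx i) + sc (l i) * gx i - sc (l i / eta i)"
    using eta_nz[OF assms]
    by (simp add: distrib_left right_diff_distrib sc_collapse sc_mult[symmetric])
  finally show ?thesis .
qed

lemma x_square:
  assumes "i < n"
  shows "gx i * gx i \<approx>\<^sub>J 1 - sc (eta i) * gx i + sc (eta i / l i) * ge i"
proof -
  have "sc (eta i / l i) * ge i
      \<approx>\<^sub>J sc (eta i / l i) * (sc (l i / eta i) * (gx i * gx i) + sc (l i) * gx i - sc (l i / eta i))"
    by (rule eqv_left[OF e_expand[OF assms]])
  also have "\<dots> = gx i * gx i + sc (eta i) * gx i - 1"
    using eta_nz[OF assms] l_nz[OF assms]
    by (simp add: distrib_left right_diff_distrib sc_collapse sc_mult[symmetric] sc_one)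
  finally have "sc (eta i / l i) * ge i - (gx i * gx i + sc (eta i) * gx i - 1) \<in> J"
    by (simp add: eqv_def)
  then have "gx i * gx i - (1 - sc (eta i) * gx i + sc (eta i / l i) * ge i) \<in> J"
    by (drule_tac uminus_J, simp add: algebra_simps)
  then show ?thesis by (simp add: eqv_def)
qed

lemma ye:
  assumes "i < n"
  shows "gy i * ge i \<approx>\<^sub>J sc (l i) * ge i"
proof -
  have "gy i * ge i = sc (l i) * (gy i * (sc (inverse (l i)) * ge i))"
    using l_nz[OF assms] by (simp add: sc_left_commute[of "gy i"] sc_collapse sc_one)
  also have "\<dots> \<approx>\<^sub>J sc (l i) * (gy i * (gx i * ge i))"
    by (intro eqv_left eqv_sym[OF xe[OF assms]])
  also have "\<dots> = sc (l i) * ((gy i * gx i) * ge i)" by (simp add: mult.assoc)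
  also have "\<dots> \<approx>\<^sub>J sc (l i) * (1 * ge i)"
    by (intro eqv_left eqv_right yx[OF assms])
  finally show ?thesis by simp
qed

text \<open>Inverses can be traded for \<open>X\<^sub>i\<close>, up to a scalar and a multiple of \<open>E\<^sub>i\<close>.\<close>

lemma y_expand:
  assumes "i < n"
  shows "gy i \<approx>\<^sub>J gx i + sc (eta i) - sc (eta i) * ge i"
proof -
  have "gx i = 1 * gx i" by simp
  also have "\<dots> \<approx>\<^sub>J (gy i * gx i) * gx i" by (intro eqv_right eqv_sym[OF yx[OF assms]])
  also have "\<dots> = gy i * (gx i * gx i)" by (simp add: mult.assoc)
  also have "\<dots> \<approx>\<^sub>J gy i * (1 - sc (eta i) * gx i + sc (eta i / l i) * ge i)"
    by (rule eqv_left[OF x_square[OF assms]])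
  also have "\<dots> = gy i - sc (eta i) * (gy i * gx i) + sc (eta i / l i) * (gy i * ge i)"
    by (simp add: distrib_left right_diff_distrib sc_left_commute[of "gy i"])
  also have "\<dots> \<approx>\<^sub>J gy i - sc (eta i) * 1 + sc (eta i / l i) * (sc (l i) * ge i)"
    by (intro eqv_add eqv_diff eqv_left eqv_refl yx[OF assms] ye[OF assms])
  also have "\<dots> = gy i - sc (eta i) + sc (eta i) * ge i"
    using l_nz[OF assms] by (simp add: sc_collapse)
  finally have "gx i - (gy i - sc (eta i) + sc (eta i) * ge i) \<in> J" by (simp add: eqv_def)
  then have "gy i - (gx i + sc (eta i) - sc (eta i) * ge i) \<in> J"
    by (drule_tac uminus_J, simp add: algebra_simps)
  then show ?thesis by (simp add: eqv_def)
qed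

text \<open>The eigenvalue of \<open>E\<^sub>i\<close> on its own image, see \<open>ee\<close>.\<close>

definition delta :: "nat \<Rightarrow> complex" where
  "delta i = l i / eta i * (inverse (l i))\<^sup>2 + 1 - l i / eta i"

lemma ee:
  assumes "i < n"
  shows "ge i * ge i \<approx>\<^sub>J sc (delta i) * ge i"
proof -
  let ?a = "l i / eta i" and ?m = "inverse (l i)"
  have xxe: "gx i * gx i * ge i \<approx>\<^sub>J sc ?m * (sc ?m * ge i)"
  proof -
    have "gx i * gx i * ge i \<approx>\<^sub>J gx i * (sc ?m * ge i)"
      unfolding mult.assoc by (rule eqv_left[OF xe[OF assms]])
    also have "\<dots> = sc ?m * (gx i * ge i)" by (rule sc_left_commute)
    also have "\<dots> \<approx>\<^sub>J sc ?m * (sc ?m * ge i)" by (rule eqv_left[OF xe[OF assms]])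
    finally show ?thesis .
  qed
  have "ge i * ge i \<approx>\<^sub>J (sc ?a * (gx i * gx i) + sc (l i) * gx i - sc ?a) * ge i"
    by (rule eqv_right[OF e_expand[OF assms]])
  also have "\<dots> = sc ?a * (gx i * gx i * ge i) + sc (l i) * (gx i * ge i) - sc ?a * ge i"
    by (simp add: distrib_right left_diff_distrib mult.assoc)
  also have "\<dots> \<approx>\<^sub>J sc ?a * (sc ?m * (sc ?m * ge i)) + sc (l i) * (sc ?m * ge i) - sc ?a * ge i"
    by (intro eqv_add eqv_diff eqv_left xxe xe[OF assms] eqv_refl)
  also have "\<dots> = (sc (?a * ?m * ?m) + sc (l i * ?m) - sc ?a) * ge i"
    by (simp only: distrib_right left_diff_distrib sc_mult mult.assoc)
  also have "sc (?a * ?m * ?m) + sc (l i * ?m) - sc ?a = sc (delta i)"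
  proof -
    have "?a * ?m * ?m + l i * ?m - ?a = delta i"
      using l_nz[OF assms] by (simp add: delta_def power2_eq_square)
    then show ?thesis by (simp only: sc_add[symmetric] sc_diff[symmetric])
  qed
  finally show ?thesis .
qed

text \<open>The braid relation of length \<open>m\<close>, read as a commutation rule for the alternating word of length \<open>m - 1\<close>.  For odd
  \<open>m\<close> the index changes, for even \<open>m\<close> it does not.\<close>

lemma ribbon_x:
  assumes "j < n" "k < n" "j \<noteq> k"
  shows "gx j * altw (gx k) (gx j) (M j k - 1)
    \<approx>\<^sub>J altw (gx k) (gx j) (M j k - 1) * gx (if odd (M j k) then k else j)"
proof -
  obtain m where m: "M j k = Suc m" using M_ge2[OF assms] by (cases "M j k") auto
  have "gx j * altw (gx k) (gx j) m = altw (gx j) (gx k) (M j k)" by (simp add: m)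
  also have "\<dots> \<approx>\<^sub>J altw (gx k) (gx j) (Suc m)"
    using braid[OF assms] unfolding m .
  also have "\<dots> = altw (gx k) (gx j) m * gx (if even m then k else j)"
    unfolding altw_snoc by simp
  finally show ?thesis by (simp add: m)
qed

lemma ribbon_e:
  assumes "j < n" "k < n" "j \<noteq> k"
  shows "ge j * altw (gx k) (gx j) (M j k - 1)
    \<approx>\<^sub>J altw (gx k) (gx j) (M j k - 1) * ge (if odd (M j k) then k else j)"
proof -
  let ?g = "altw (gx k) (gx j) (M j k - 1)" and ?p = "if odd (M j k) then k else j"
  have p: "?p < n" "q ?p = q j" "l ?p = l j" "eta ?p = eta j"
    using assms odd_par[of j k] by (auto simp: eta_def)
  note r = ribbon_x[OF assms]
  have xx: "gx j * gx j * ?g \<approx>\<^sub>J ?g * (gx ?p * gx ?p)"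
  proof -
    have "gx j * gx j * ?g \<approx>\<^sub>J gx j * (?g * gx ?p)"
      unfolding mult.assoc by (rule eqv_left[OF r])
    also have "\<dots> = gx j * ?g * gx ?p" by (simp only: mult.assoc)
    also have "\<dots> \<approx>\<^sub>J ?g * gx ?p * gx ?p" by (rule eqv_right[OF r])
    finally show ?thesis by (simp only: mult.assoc)
  qed
  let ?a = "l j / eta j"
  have "ge j * ?g \<approx>\<^sub>J (sc ?a * (gx j * gx j) + sc (l j) * gx j - sc ?a) * ?g"
    by (rule eqv_right[OF e_expand[OF assms(1)]])
  also have "\<dots> = sc ?a * (gx j * gx j * ?g) + sc (l j) * (gx j * ?g) - sc ?a * ?g"
    by (simp only: distrib_right left_diff_distrib mult.assoc)
  also have "\<dots> \<approx>\<^sub>J sc ?a * (?g * (gx ?p * gx ?p)) + sc (l j) * (?g * gx ?p) - sc ?a * ?g"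
    by (intro eqv_add eqv_diff eqv_left xx r eqv_refl)
  also have "\<dots> = ?g * (sc ?a * (gx ?p * gx ?p) + sc (l j) * gx ?p - sc ?a)"
    by (simp only: distrib_left right_diff_distrib sc_left_commute[of ?g] sc_central[of _ ?g, symmetric])
  also have "\<dots> \<approx>\<^sub>J ?g * ge ?p"
    using e_expand[OF p(1)] unfolding p(3,4) by (rule eqv_left[OF eqv_sym])
  finally show ?thesis .
qed

end

context bmw_relations
begin

text \<open>A short alternating word is a longer one followed by inverses.  This is how words of length \<open>m - 1\<close> are
  created so that \<open>ribbon_e\<close> applies.\<close>

lemma altw_cancel_right:
  assumes "a < n" "b < n"
  shows "altw (gx a) (gx b) r \<approx>\<^sub>J altw (gx a) (gx b) (r + s) *
    altw (gy (if odd (r + s) then a else b)) (gy (if odd (r + s) then b else a)) s"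
proof (induction s)
  case 0
  then show ?case by simp
next
  case (Suc s)
  let ?c = "if odd (r + Suc s) then a else b" and ?d = "if odd (r + Suc s) then b else a"
  let ?A = "altw (gx a) (gx b) (r + s)" and ?B = "altw (gy ?d) (gy ?c) s"
  have "altw (gx a) (gx b) (r + Suc s) = ?A * gx ?c"
    using altw_snoc[of "gx a" "gx b" "r + s"] by auto
  then have e: "altw (gx a) (gx b) (r + Suc s) * altw (gy ?c) (gy ?d) (Suc s)
      = ?A * (gx ?c * gy ?c) * ?B"
    by (simp add: mult.assoc)
  have "altw (gx a) (gx b) r \<approx>\<^sub>J ?A * ?B"
    using Suc.IH by (auto split: if_splits)
  also have "?A * ?B = ?A * 1 * ?B" by simp
  also have "\<dots> \<approx>\<^sub>J ?A * (gx ?c * gy ?c) * ?B"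
    using assms by (intro eqv_right eqv_left eqv_sym[OF xy]) auto
  finally show ?case unfolding e .
qed

lemma altw_cancel_left:
  assumes "k < n" "j < n"
  shows "altw (gx k) (gx j) r \<approx>\<^sub>J altw (gy j) (gy k) s *
    altw (gx (if even s then k else j)) (gx (if even s then j else k)) (s + r)"
proof (induction s)
  case 0
  then show ?case by simp
next
  case (Suc s)
  let ?c = "if even s then k else j" and ?d = "if even s then j else k"
  let ?A = "altw (gy j) (gy k) s" and ?B = "altw (gx ?c) (gx ?d) (s + r)"
  have "altw (gy j) (gy k) (Suc s) = ?A * gy ?d"
    by (simp only: altw_snoc if_distrib[of gy])
  moreover have "altw (gx (if even (Suc s) then k else j)) (gx (if even (Suc s) then j else k)) (Suc s + r)
      = gx ?d * ?B" by simp
  ultimately have e: "altw (gy j) (gy k) (Suc s) *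
      altw (gx (if even (Suc s) then k else j)) (gx (if even (Suc s) then j else k)) (Suc s + r)
      = ?A * (gy ?d * gx ?d) * ?B"
    by (simp only: mult.assoc)
  have "altw (gx k) (gx j) r \<approx>\<^sub>J ?A * ?B" by (rule Suc.IH)
  also have "?A * ?B = ?A * 1 * ?B" by simp
  also have "\<dots> \<approx>\<^sub>J ?A * (gy ?d * gx ?d) * ?B"
    using assms by (intro eqv_right eqv_left eqv_sym[OF yx]) auto
  finally show ?case unfolding e .
qed

end


section \<open>Modules filtered by positive roots\<close>

text \<open>An abstract form of a Lawrence-Krammer module: \<open>v t\<close> is attached to the simple root \<open>\<alpha>\<^sub>t\<close>, ribbons move one
  simple root to another (as in \<open>ribbon_root\<close>), and a cup \<open>E\<^sub>j\<close> applied within a rank-two subsystem returns to the line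
  of \<open>v j\<close>.\<close>

locale lk_module = bmw_relations n M J sc gx gy ge q l
  for n :: nat and M :: "nat \<Rightarrow> nat \<Rightarrow> nat" and J :: "'r::ring_1 set" and sc
    and gx gy ge :: "nat \<Rightarrow> 'r" and q l :: "nat \<Rightarrow> complex" +
  fixes v :: "nat \<Rightarrow> 'r"
  assumes x_v: "j < n \<Longrightarrow> gx j * v j \<in> spn {v j}"
    and e_v: "j < n \<Longrightarrow> ge j * v j \<in> spn {v j}"
    and ribbon_v: "j < n \<Longrightarrow> k < n \<Longrightarrow> j \<noteq> k \<Longrightarrow>
      altw (gx k) (gx j) (M j k - 1) * v (if odd (M j k) then k else j) \<in> spn {v j}"
    and dihedral_v: "j < n \<Longrightarrow> k < n \<Longrightarrow> j \<noteq> k \<Longrightarrow> d < M j k \<Longrightarrow>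
      ge j * (altw (gx k) (gx j) d * v (if even d then k else j)) \<in> spn {v j}"
begin

text \<open>\<open>layer d \<gamma> u\<close>: the element \<open>u\<close> sits at the positive root \<open>\<gamma>\<close>, reached by \<open>d\<close> climbing steps from a simple
  root.  Elements over the same root and depth may be added even if they come from different climbs.\<close>

inductive layer :: "nat \<Rightarrow> (nat \<Rightarrow> real) \<Rightarrow> 'r \<Rightarrow> bool" where
  base: "t < n \<Longrightarrow> u \<in> spn {v t} \<Longrightarrow> layer 0 (simple_root t) u"
| up: "layer d \<gamma> u \<Longrightarrow> k < n \<Longrightarrow> pair \<gamma> k < 0 \<Longrightarrow> layer (Suc d) (reflect k \<gamma>) (gx k * u)"
| add: "layer d \<gamma> u \<Longrightarrow> layer d \<gamma> u' \<Longrightarrow> layer d \<gamma> (u + u')"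

definition filt :: "nat \<Rightarrow> 'r set" where
  "filt d = spn {u. \<exists>e<d. \<exists>\<gamma>. layer e \<gamma> u}"

lemma layer_filt: "layer e \<gamma> u \<Longrightarrow> e < d \<Longrightarrow> u \<in> filt d"
  unfolding filt_def by (rule spn.base) blast

lemma filt_mono: "u \<in> filt d \<Longrightarrow> d \<le> d' \<Longrightarrow> u \<in> filt d'"
  unfolding filt_def by (erule spn_mono[rotated]) (force intro: less_le_trans)

lemma filt_add: "u \<in> filt d \<Longrightarrow> w \<in> filt d \<Longrightarrow> u + w \<in> filt d"
  and filt_diff: "u \<in> filt d \<Longrightarrow> w \<in> filt d \<Longrightarrow> u - w \<in> filt d"
  and filt_scale: "u \<in> filt d \<Longrightarrow> sc c * u \<in> filt d"
  and filt_zero [simp]: "0 \<in> filt d"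
  and filt_ideal: "z \<in> J \<Longrightarrow> z \<in> filt d"
  and filt_eqv: "u \<approx>\<^sub>J w \<Longrightarrow> w \<in> filt d \<Longrightarrow> u \<in> filt d"
  unfolding filt_def by (auto intro: spn.intros spn_diff spn_eqv)

lemma spn_v_filt: "t < n \<Longrightarrow> u \<in> spn {v t} \<Longrightarrow> u \<in> filt (Suc d)"
  by (rule layer_filt[OF base]) auto

lemma layer_nonneg: "layer d \<gamma> u \<Longrightarrow> \<gamma> i \<ge> 0"
proof (induction rule: layer.induct)
  case (up d \<gamma> u k)
  then show ?case
    by (cases "i = k") (auto simp: reflect_def simple_root_def)
qed (auto simp: simple_root_def)

lemma layer_height: "layer d \<gamma> u \<Longrightarrow> height \<gamma> \<ge> 1"
  by (induction rule: layer.induct) (auto simp: height_reflect)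

lemma layer_root: "layer d \<gamma> u \<Longrightarrow> \<gamma> \<in> roots"
  by (induction rule: layer.induct) (auto simp: simple_in_roots reflect_in_roots)

text \<open>The height takes finitely many values on roots; counting the roots below turns it into a natural number that
  bounds the depth and serves for inductions over a single depth.\<close>

definition rank_below :: "(nat \<Rightarrow> real) \<Rightarrow> nat" where
  "rank_below \<gamma> = card {\<delta> \<in> roots. height \<delta> < height \<gamma>}"

lemma rank_below_less:
  assumes "\<gamma> \<in> roots" "height \<gamma> < height \<gamma>'"
  shows "rank_below \<gamma> < rank_below \<gamma>'"
  unfolding rank_below_def
  by (rule psubset_card_mono) (use finite_roots assms in \<open>auto intro: less_trans\<close>)

lemma layer_bound: "layer d \<gamma> u \<Longrightarrow> d \<le> rank_below \<gamma>"
proof (induction rule: layer.induct)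
  case (up d \<gamma> u k)
  then have "rank_below \<gamma> < rank_below (reflect k \<gamma>)"
    by (intro rank_below_less layer_root[OF up.hyps(1)]) (simp add: height_reflect)
  then show ?case using up.IH by simp
qed auto

lemma layer_positive:
  assumes "layer d \<gamma> u"
  obtains i where "i < n" "\<gamma> i > 0"
proof -
  have "\<exists>i<n. \<gamma> i > 0"
  proof (rule ccontr)
    assume "\<not> ?thesis"
    then have "\<gamma> i \<le> 0" if "i < n" for i
      using that by force
    then have "height \<gamma> \<le> 0"
      unfolding height_def by (intro sum_nonpos) auto
    then show False using layer_height[OF assms] by simp
  qed
  then show ?thesis using that by blast
qed

lemma layer_0:
  assumes "layer 0 \<gamma> u"
  obtains t where "t < n" "\<gamma> = simple_root t" "u \<in> spn {v t}"
proof -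
  have "\<exists>t<n. \<gamma> = simple_root t \<and> u \<in> spn {v t}"
    using assms
  proof (induction "0::nat" \<gamma> u rule: layer.induct)
    case (add \<gamma> u u')
    then obtain t t' where t: "t < n" "t' < n" "\<gamma> = simple_root t" "\<gamma> = simple_root t'"
      "u \<in> spn {v t}" "u' \<in> spn {v t'}" by blast
    then have "simple_root t t = simple_root t' t" by simp
    then have "t = t'" by (simp add: simple_root_def split: if_splits)
    then show ?case using t by (auto intro: spn.add)
  qed auto
  then show ?thesis using that by blast
qed

lemma layer_ups:
  assumes "layer e \<gamma> u" "a < n" "b < n"
    and "\<And>s. s < r \<Longrightarrow> pair (chain a b s \<gamma>) (if even s then a else b) < 0"
  shows "layer (e + r) (chain a b r \<gamma>)
    (altw (gx (if odd r then a else b)) (gx (if odd r then b else a)) r * u)"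
  using assms(4)
proof (induction r)
  case 0
  then show ?case using assms(1) by simp
next
  case (Suc r)
  let ?c = "if even r then a else b"
  have "layer (e + r) (chain a b r \<gamma>)
      (altw (gx (if odd r then a else b)) (gx (if odd r then b else a)) r * u)"
    using Suc by simp
  then have "layer (Suc (e + r)) (reflect ?c (chain a b r \<gamma>))
      (gx ?c * (altw (gx (if odd r then a else b)) (gx (if odd r then b else a)) r * u))"
    by (rule layer.up) (use Suc.prems[of r] assms(2,3) in auto)
  then show ?case
    unfolding chain_snoc by (cases "even r") (simp_all add: mult.assoc)
qed

text \<open>If \<open>\<langle>\<gamma>, \<alpha>\<^sub>j\<rangle> > 0\<close>, an element over \<open>\<gamma>\<close> may be written with \<open>X\<^sub>j\<close> as its last climbing step, modulo
  smaller depth.\<close>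

definition descends :: "nat \<Rightarrow> bool" where
  "descends d \<longleftrightarrow> (\<forall>\<gamma> u j. layer (Suc d) \<gamma> u \<longrightarrow> j < n \<longrightarrow> pair \<gamma> j > 0 \<longrightarrow>
     (\<exists>u1. layer d (reflect j \<gamma>) u1 \<and> u - gx j * u1 \<in> filt (Suc d)))"

text \<open>The simultaneous induction hypothesis.  In the third clause the bound is one smaller than in the others, since
  \<open>descends e\<close> speaks about layers of depth \<open>e + 1\<close>.\<close>

definition stage :: "nat \<Rightarrow> bool" where
  "stage d \<longleftrightarrow>
     (\<forall>k<n. \<forall>u\<in>filt d. gx k * u \<in> filt (Suc d)) \<and>
     (\<forall>k<n. \<forall>u\<in>filt d. ge k * u \<in> spn {v k}) \<and>
     (\<forall>e. Suc e < d \<longrightarrow> descends e) \<and>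
     (\<forall>e<d. \<forall>\<gamma> u j. layer e \<gamma> u \<longrightarrow> j < n \<longrightarrow> pair \<gamma> j = 0 \<longrightarrow> gx j * u \<in> filt (Suc e))"

lemma filt_left:
  assumes "u \<in> filt d" "\<And>e \<gamma> w. layer e \<gamma> w \<Longrightarrow> e < d \<Longrightarrow> a * w \<in> spn S"
  shows "a * u \<in> spn S"
  using assms(1) unfolding filt_def by (rule spn_left) (use assms(2) in auto)

text \<open>Repeated use of \<open>descends\<close> along an alternating walk.  The errors made in earlier steps stay in the filtration
  because the letters applied to them raise it by one at a time.\<close>

lemma descent_chain:
  assumes "\<And>e'. Suc e' \<le> e \<Longrightarrow> descends e'"
    and "\<And>e' k u. e' \<le> e \<Longrightarrow> 0 < e' \<Longrightarrow> k < n \<Longrightarrow> u \<in> filt (e' - 1) \<Longrightarrow> gx k * u \<in> filt e'"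
    and "layer e \<gamma> u" "k < n" "j < n" "r \<le> e"
    and "\<And>s. s < r \<Longrightarrow> pair (chain k j s \<gamma>) (if even s then k else j) > 0"
  shows "\<exists>u0. layer (e - r) (chain k j r \<gamma>) u0 \<and> u - altw (gx k) (gx j) r * u0 \<in> filt e"
  using assms
proof (induction r arbitrary: e \<gamma> u k j)
  case 0
  then show ?case by (intro exI[of _ u]) simp
next
  case (Suc r)
  obtain e' where e: "e = Suc e'" using Suc.prems(6) by (cases e) auto
  have "pair \<gamma> k > 0" using Suc.prems(7)[of 0] by simp
  then obtain u1 where u1: "layer e' (reflect k \<gamma>) u1" "u - gx k * u1 \<in> filt e"
    using Suc.prems(1)[of e'] Suc.prems(3,4) unfolding e descends_def by blast
  have "\<exists>u0. layer (e' - r) (chain j k r (reflect k \<gamma>)) u0 \<and> u1 - altw (gx j) (gx k) r * u0 \<in> filt e'"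
  proof (rule Suc.IH)
    show "pair (chain j k s (reflect k \<gamma>)) (if even s then j else k) > 0" if "s < r" for s
      using Suc.prems(7)[of "Suc s"] that by (simp split: if_splits)
  qed (use Suc.prems(1-6) u1 e in auto)
  then obtain u0 where u0: "layer (e' - r) (chain j k r (reflect k \<gamma>)) u0"
    "u1 - altw (gx j) (gx k) r * u0 \<in> filt e'" by blast
  have "gx k * (u1 - altw (gx j) (gx k) r * u0) \<in> filt e"
    using Suc.prems(2)[of e k] u0(2) Suc.prems(4) e by simp
  then have "(u - gx k * u1) + gx k * (u1 - altw (gx j) (gx k) r * u0) \<in> filt e"
    by (rule filt_add[OF u1(2)])
  then have "u - altw (gx k) (gx j) (Suc r) * u0 \<in> filt e"
    by (simp add: right_diff_distrib mult.assoc)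
  then show ?case
    using u0(1) e by (intro exI[of _ u0]) simp
qed

text \<open>If the descent ends prematurely at a simple root, then everything happens inside the rank-two subsystem, and
  \<open>pair_chain_simple\<close> read backwards gives the pairings of \<open>\<gamma>\<close> from the number of steps.\<close>

lemma chain_stop:
  assumes kj: "k < n" "j < n" "k \<noteq> j" and t: "t < n" "chain k j r \<gamma> = simple_root t"
    and r: "r < M k j" and pos: "pair (chain k j r \<gamma>) (if even r then k else j) > 0"
  shows "t = (if even r then k else j)"
    and "pair \<gamma> j = - cos ((real r + 1) * angle k j)"
    and "0 < r \<Longrightarrow> pair \<gamma> k = cos (real r * angle k j)"
proof -
  show t_eq: "t = (if even r then k else j)"
    using simple_pair_pos[of t "if even r then k else j"] t pos kj by auto
  let ?c = "if even r then j else k"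
  have c: "?c < n" "t < n" "?c \<noteq> t" "angle ?c t = angle k j"
    using kj t angle_sym[of k j] by (auto simp: t_eq)
  have g: "\<gamma> = chain ?c t r (simple_root t)"
  proof -
    have "\<gamma> = arefl k j r (simple_root t)"
      using arefl_chain[OF kj(1,2), of r \<gamma>] t(2) by simp
    then show ?thesis
      unfolding arefl_conv_chain t_eq by (auto split: if_splits)
  qed
  have "(if even r then ?c else t) = j" by (simp add: t_eq)
  then show "pair \<gamma> j = - cos ((real r + 1) * angle k j)"
    using pair_chain_simple[OF c(1-3), of r] unfolding g[symmetric] c(4) by simp
  assume "0 < r"
  then obtain r' where r': "r = Suc r'" by (cases r) auto
  have "(if even r' then ?c else t) = k" by (simp add: t_eq r')
  then have "pair \<gamma> k = cos ((real r' + 1) * angle k j)"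
    using pair_chain_simple[OF c(1-3), of r'] pair_chain_prev[OF c(1,2), of r' "simple_root t"]
    unfolding g[symmetric] c(4) r'[symmetric] by simp
  then show "pair \<gamma> k = cos (real r * angle k j)" by (simp add: r' add.commute)
qed

context
  fixes d
  assumes IH: "\<And>e. e \<le> d \<Longrightarrow> stage e"
begin

lemma x_filt: "e \<le> d \<Longrightarrow> k < n \<Longrightarrow> u \<in> filt e \<Longrightarrow> gx k * u \<in> filt (Suc e)"
  using IH unfolding stage_def by blast

lemma e_filt: "e \<le> d \<Longrightarrow> k < n \<Longrightarrow> u \<in> filt e \<Longrightarrow> ge k * u \<in> spn {v k}"
  using IH unfolding stage_def by blast

lemma descends_below: "Suc e < d \<Longrightarrow> descends e"
  using IH[of d] unfolding stage_def by blast

lemma zero_below: "e < d \<Longrightarrow> layer e \<gamma> u \<Longrightarrow> j < n \<Longrightarrow> pair \<gamma> j = 0 \<Longrightarrow> gx j * u \<in> filt (Suc e)"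
  using IH[of d] unfolding stage_def by blast

lemma x_filt_pred: "e' \<le> e \<Longrightarrow> e \<le> Suc d \<Longrightarrow> 0 < e' \<Longrightarrow> k < n \<Longrightarrow> u \<in> filt (e' - 1) \<Longrightarrow> gx k * u \<in> filt e'"
  using x_filt[of "e' - 1" k u] by simp

lemma altx_filt:
  assumes "a < n" "b < n" "u \<in> filt e" "e + r \<le> Suc d"
  shows "altw (gx a) (gx b) r * u \<in> filt (e + r)"
  using assms
proof (induction r arbitrary: a b)
  case (Suc r)
  then have "altw (gx b) (gx a) r * u \<in> filt (e + r)" by simp
  then have "gx a * (altw (gx b) (gx a) r * u) \<in> filt (Suc (e + r))"
    using Suc.prems by (intro x_filt) auto
  then show ?case by (simp add: mult.assoc)
qed simp

text \<open>On the filtration \<open>X\<close> and its inverse agree up to smaller depth; the term with \<open>E\<^sub>a\<close> in \<open>y_expand\<close>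
  falls to the line of \<open>v a\<close>.\<close>

lemma y_minus_x:
  assumes "Suc e \<le> d" "a < n" "u \<in> filt (Suc e)"
  shows "gy a * u - gx a * u \<in> filt (Suc e)"
proof -
  have "gy a * u \<approx>\<^sub>J (gx a + sc (eta a) - sc (eta a) * ge a) * u"
    by (rule eqv_right[OF y_expand[OF assms(2)]])
  then have "gy a * u - gx a * u \<approx>\<^sub>J (gx a + sc (eta a) - sc (eta a) * ge a) * u - gx a * u"
    by (rule eqv_diff) simp
  also have "\<dots> = sc (eta a) * u - sc (eta a) * (ge a * u)"
    by (simp add: algebra_simps)
  finally show ?thesis
    by (rule filt_eqv)
      (use assms e_filt in \<open>auto intro!: filt_diff filt_scale intro: spn_v_filt\<close>)
qed

lemma alty_minus_altx:
  assumes "a < n" "b < n" "u \<in> filt (Suc e)" "e + r \<le> d"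
  shows "altw (gy a) (gy b) r * u - altw (gx a) (gx b) r * u \<in> filt (e + r)"
  using assms
proof (induction r arbitrary: a b)
  case (Suc r)
  let ?Y = "altw (gy b) (gy a) r * u" and ?X = "altw (gx b) (gx a) r * u"
  have diff: "?Y - ?X \<in> filt (e + r)" using Suc by simp
  have X: "?X \<in> filt (Suc (e + r))"
    using altx_filt[of b a u "Suc e" r] Suc.prems by simp
  have Y: "?Y \<in> filt (Suc (e + r))"
    using filt_add[OF X filt_mono[OF diff]] by simp
  have y: "gy a * ?Y - gx a * ?Y \<in> filt (Suc (e + r))"
    by (rule y_minus_x) (use Y Suc.prems in auto)
  have "gx a * (?Y - ?X) \<in> filt (Suc (e + r))"
    using diff Suc.prems by (intro x_filt) auto
  then have "(gy a * ?Y - gx a * ?Y) + gx a * (?Y - ?X) \<in> filt (Suc (e + r))"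
    by (rule filt_add[OF y])
  then show ?case by (simp add: algebra_simps)
qed simp

lemma alty_filt:
  assumes "a < n" "b < n" "u \<in> filt (Suc e)" "e + r \<le> d"
  shows "altw (gy a) (gy b) r * u \<in> filt (Suc (e + r))"
proof -
  have "altw (gx a) (gx b) r * u \<in> filt (Suc (e + r))"
    using altx_filt[of a b u "Suc e" r] assms by simp
  then show ?thesis
    using filt_add[OF _ filt_mono[OF alty_minus_altx[OF assms]]] by fastforce
qed

text \<open>Let the last step of the climb to \<open>\<gamma>\<close> be \<open>X\<^sub>k\<close> with \<open>k \<noteq> j\<close>.  Both \<open>s\<^sub>k\<close> and \<open>s\<^sub>j\<close> lower \<open>\<gamma>\<close>, so one
  descends to the bottom of its orbit under the dihedral group of \<open>s\<^sub>k, s\<^sub>j\<close>, applies the braid relation there and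
  climbs the other side, which ends with \<open>X\<^sub>j\<close>.  If a simple root is met before the bottom, the orbit is the set of
  roots of the rank-two subsystem, \<open>\<gamma>\<close> is its middle root, and the two climbs are compared through the ribbon.\<close>

lemma descends_step:
  assumes d: "d = Suc e"
  shows "descends e"
proof -
  have gen: "\<exists>u1. layer e (reflect j \<gamma>) u1 \<and> u - gx j * u1 \<in> filt d"
    if u': "layer e \<gamma>' u'" and k: "k < n" "pair \<gamma>' k < 0" and u: "\<gamma> = reflect k \<gamma>'" "u = gx k * u'"
      and j: "j < n" "pair \<gamma> j > 0" for \<gamma> \<gamma>' u u' j k
  proof (cases "j = k")
    case True
    then show ?thesis using u' u k by (intro exI[of _ u']) simp
  next
    case False
    then have kj: "k < n" "j < n" "k \<noteq> j" using k j by auto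
    have g': "reflect k \<gamma> = \<gamma>'" using u k by simp
    have yk: "pair \<gamma> k > 0" using k u by (simp add: pair_reflect)
    let ?m = "M k j"
    have pos: "pair (chain k j s \<gamma>) (if even s then k else j) > 0" if "s < ?m" for s
      by (rule pair_chain_pos_strict[OF kj that yk j(2)])
    have pos': "pair (chain j k s \<gamma>') (if even s then j else k) > 0" if "Suc s < ?m" for s
      using pos[OF that] by (simp add: g' split: if_splits)
    \<comment> \<open>Descend from \<open>\<gamma>'\<close> along \<open>j, k, j, \<dots>\<close>.\<close>
    have down: "\<exists>u0. layer (e - r) (chain j k r \<gamma>') u0 \<and> u' - altw (gx j) (gx k) r * u0 \<in> filt e"
      if "r \<le> e" "r < ?m" for r
      by (rule descent_chain[OF _ _ u' kj(2,1) that(1)])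
        (use that d descends_below pos' in \<open>auto intro: x_filt_pred[of _ e]\<close>)
    show ?thesis
    proof (cases "?m \<le> d")
      \<comment> \<open>The depth suffices to reach the bottom \<open>\<gamma>0\<close> of the dihedral orbit.\<close>
      case True
      obtain m where m: "?m = Suc m" using M_ge2[OF kj] by (cases ?m) auto
      then obtain u0 where u0: "layer (e - m) (chain j k m \<gamma>') u0" "u' - altw (gx j) (gx k) m * u0 \<in> filt e"
        using down[of m] True d by auto
      define \<gamma>0 where "\<gamma>0 = chain k j ?m \<gamma>"
      have g0: "chain j k m \<gamma>' = \<gamma>0" by (simp add: \<gamma>0_def m g')
      have neg: "pair \<gamma>0 k < 0" "pair \<gamma>0 j < 0"
        unfolding \<gamma>0_def by (rule chain_end_neg[OF kj yk j(2)])+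
      have "gx k * (u' - altw (gx j) (gx k) m * u0) \<in> filt d"
        unfolding d using x_filt[of e k] u0(2) kj d by simp
      then have 1: "u - altw (gx k) (gx j) ?m * u0 \<in> filt d"
        by (simp add: u m right_diff_distrib mult.assoc)
      have "altw (gx k) (gx j) ?m * u0 - altw (gx j) (gx k) ?m * u0 \<in> filt d"
        using eqv_right[OF braid[OF kj], of u0] filt_ideal unfolding eqv_def by blast
      then have 2: "u - altw (gx j) (gx k) ?m * u0 \<in> filt d"
        using filt_add[OF 1] by fastforce
      let ?a = "if odd m then k else j" and ?b = "if odd m then j else k"
      have "layer (e - m + m) (chain ?a ?b m \<gamma>0)
          (altw (gx (if odd m then ?a else ?b)) (gx (if odd m then ?b else ?a)) m * u0)"
      proof (rule layer_ups)
        fix s assume "s < m"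
        then show "pair (chain ?a ?b s \<gamma>0) (if even s then ?a else ?b) < 0"
          using kj neg m M_sym[of k j] by (intro pair_chain_neg) (auto split: if_splits)
      qed (use u0 g0 kj in auto)
      moreover have "chain ?a ?b m \<gamma>0 = arefl k j m \<gamma>0" by (simp add: arefl_conv_chain)
      moreover have "arefl k j m \<gamma>0 = reflect j \<gamma>"
      proof -
        have "\<gamma> = arefl k j ?m \<gamma>0" unfolding \<gamma>0_def using kj by (simp only: arefl_chain)
        also have "\<dots> = reflect j (arefl k j m \<gamma>0)" using arefl_braid[OF kj, of \<gamma>0] by (simp add: m)
        finally show ?thesis using kj by simp
      qed
      ultimately have "layer e (reflect j \<gamma>) (altw (gx k) (gx j) m * u0)"
        using True m d by (simp split: if_splits)
      then show ?thesis
        using 2 by (intro exI[of _ "altw (gx k) (gx j) m * u0"]) (simp add: m mult.assoc)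
    next
      case False
      \<comment> \<open>A simple root is met after \<open>e\<close> steps, before the bottom.\<close>
      then obtain u0 where u0: "layer 0 (chain j k e \<gamma>') u0" "u' - altw (gx j) (gx k) e * u0 \<in> filt e"
        using down[of e] d by auto
      then obtain t where t: "t < n" "chain j k e \<gamma>' = simple_root t" "u0 \<in> spn {v t}"
        using layer_0 by blast
      have ct: "chain k j d \<gamma> = simple_root t" using t g' d by simp
      have dm: "d < ?m" "0 < d" using False d by auto
      note stop = chain_stop[OF kj t(1) ct dm(1) pos[OF dm(1)]]
      have "cos (real (Suc d) * angle k j) \<le> 0"
        using stop(2) j(2) by (simp add: add.commute)
      then have "?m \<le> 2 * Suc d"
        using cos_multiple_pos_iff(2)[OF kj, of "Suc d"] dm by simp
      moreover have "2 * d < ?m"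
        using cos_multiple_pos_iff(1)[OF kj, of d] dm stop(3)[OF dm(2)] yk by simp
      ultimately have "?m \<in> {2 * d + 1, 2 * d + 2}" by auto
      \<comment> \<open>For \<open>m = 2 d + 2\<close> the root \<open>\<gamma>\<close> would be orthogonal to \<open>\<alpha>\<^sub>j\<close>.\<close>
      moreover have "?m \<noteq> 2 * d + 2"
      proof
        assume m: "?m = 2 * d + 2"
        have "2 * ((real d + 1) * angle k j) = pi"
          using angle_mult[OF kj] unfolding m by (simp add: algebra_simps)
        then have "cos ((real d + 1) * angle k j) = cos (pi / 2)"
          by (intro arg_cong[of _ _ cos]) simp
        then show False using stop(2) j(2) by simp
      qed
      ultimately have m: "?m = 2 * d + 1" by simp
      let ?a = "if even d then k else j" and ?b = "if even d then j else k"
      have ab: "?a < n" "?b < n" "?a \<noteq> ?b" "M ?a ?b = ?m" "angle ?a ?b = angle k j"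
        using kj M_sym[of k j] angle_sym[of k j] by auto
      have ta: "t = ?a" using stop(1) by simp
      \<comment> \<open>The ribbon has length \<open>m - 1 = d + d\<close> and connects the two simple roots of the plane.\<close>
      define w where "w = altw (gx ?a) (gx ?b) (d + d) * u0"
      have w: "w \<in> spn {v ?b}"
        unfolding w_def
      proof (rule spn_left[OF t(3)])
        fix x assume "x \<in> {v t}"
        then show "altw (gx ?a) (gx ?b) (d + d) * x \<in> spn {v ?b}"
          using ribbon_v[OF ab(2,1) not_sym[OF ab(3)]] ab M_sym[of ?a ?b]
          by (simp add: m ta mult_2)
      qed
      have "gx k * (u' - altw (gx j) (gx k) e * u0) \<in> filt d"
        unfolding d using x_filt[of e k] u0(2) kj d by simp
      then have 1: "u - altw (gx k) (gx j) d * u0 \<in> filt d"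
        by (simp add: u d right_diff_distrib mult.assoc)
      have "altw (gx k) (gx j) d * u0 \<approx>\<^sub>J altw (gy j) (gy k) d * w"
        unfolding w_def using eqv_right[OF altw_cancel_left[OF kj(1,2), of d d], of u0]
        by (simp add: mult.assoc)
      then have 2: "altw (gx k) (gx j) d * u0 - altw (gy j) (gy k) d * w \<in> filt d"
        unfolding eqv_def by (rule filt_ideal)
      have 3: "altw (gy j) (gy k) d * w - altw (gx j) (gx k) d * w \<in> filt d"
        using alty_minus_altx[of j k w 0 d] spn_v_filt[OF ab(2) w] kj by simp
      have 4: "u - altw (gx j) (gx k) d * w \<in> filt d"
        using filt_add[OF filt_add[OF 1 2] 3] by simp
      have "layer (0 + e) (chain ?a ?b e (simple_root ?b))
          (altw (gx (if odd e then ?a else ?b)) (gx (if odd e then ?b else ?a)) e * w)"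
      proof (rule layer_ups)
        show "layer 0 (simple_root ?b) w" by (rule layer.base[OF ab(2) w])
        fix s assume s: "s < e"
        have "cos (real (Suc s) * angle k j) > 0"
          using cos_multiple_pos_iff(1)[OF kj, of "Suc s"] s d m by simp
        then show "pair (chain ?a ?b s (simple_root ?b)) (if even s then ?a else ?b) < 0"
          using pair_chain_simple[OF ab(1-3), of s] unfolding ab(5) by (simp add: add.commute)
      qed (use ab in auto)
      moreover have "chain ?a ?b e (simple_root ?b) = arefl k j e (simple_root ?b)"
        unfolding arefl_conv_chain d by simp
      moreover have "arefl k j e (simple_root ?b) = reflect j \<gamma>"
      proof -
        have rib: "arefl ?a ?b (d + d) (simple_root ?a) = simple_root ?b"
          using ribbon_root[OF ab(1-3)] unfolding ab(4) m by (simp add: mult_2)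
        have "\<gamma> = arefl k j d (simple_root ?a)"
          using arefl_chain[OF kj(1,2), of d \<gamma>] ct ta by simp
        also have "\<dots> = arefl j k d (arefl ?a ?b d (arefl k j d (simple_root ?a)))"
        proof -
          have "arefl ?a ?b d z = chain j k d z" for z
            unfolding arefl_conv_chain by (simp split: if_splits)
          then show ?thesis by (simp only: arefl_chain[OF kj(2,1)])
        qed
        also have "arefl ?a ?b d (arefl k j d (simple_root ?a)) = simple_root ?b"
          using rib unfolding arefl_add by (simp split: if_splits)
        finally have "\<gamma> = reflect j (arefl k j e (simple_root ?b))" by (simp add: d)
        then show ?thesis using kj by simp
      qed
      moreover have "altw (gx (if odd e then ?a else ?b)) (gx (if odd e then ?b else ?a)) e = altw (gx k) (gx j) e"
        by (simp add: d)
      ultimately have "layer e (reflect j \<gamma>) (altw (gx k) (gx j) e * w)" by simp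
      then show ?thesis
        using 4 by (intro exI[of _ "altw (gx k) (gx j) e * w"]) (simp add: d mult.assoc)
    qed
  qed
  have "\<exists>u1. layer e (reflect j \<gamma>) u1 \<and> u - gx j * u1 \<in> filt d"
    if "layer (Suc e) \<gamma> u" "j < n" "pair \<gamma> j > 0" for \<gamma> u j
    using that
  proof (induction "Suc e" \<gamma> u rule: layer.induct)
    case (up \<gamma>' u' k)
    then show ?case by (intro gen[of \<gamma>' u' k]) auto
  next
    case (add \<gamma> u u')
    then obtain u1 u1' where "layer e (reflect j \<gamma>) u1" "u - gx j * u1 \<in> filt d"
      "layer e (reflect j \<gamma>) u1'" "u' - gx j * u1' \<in> filt d" by blast
    moreover from this have "(u - gx j * u1) + (u' - gx j * u1') \<in> filt d" by (intro filt_add)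
    ultimately show ?case
      by (intro exI[of _ "u1 + u1'"]) (auto intro: layer.add simp: algebra_simps)
  qed
  then show ?thesis unfolding descends_def d by blast
qed

lemma descends_le:
  assumes "Suc e \<le> d"
  shows "descends e"
  using descends_below[of e] descends_step[of e] assms by (cases "Suc e = d") auto

lemma down:
  assumes "layer e \<gamma> u" "e \<le> d" "k < n" "j < n" "r \<le> e"
    and "\<And>s. s < r \<Longrightarrow> pair (chain k j s \<gamma>) (if even s then k else j) > 0"
  obtains u0 where "layer (e - r) (chain k j r \<gamma>) u0" "u - altw (gx k) (gx j) r * u0 \<in> filt e"
proof -
  have "\<exists>u0. layer (e - r) (chain k j r \<gamma>) u0 \<and> u - altw (gx k) (gx j) r * u0 \<in> filt e"
    by (rule descent_chain[OF _ _ assms(1,3,4,5,6)])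
      (use assms(2) descends_le in \<open>auto intro: x_filt_pred[of _ e]\<close>)
  then show ?thesis using that by blast
qed

text \<open>Here \<open>s\<^sub>j \<gamma> = \<gamma>\<close>.  One descends in a direction \<open>k\<close> with \<open>\<langle>\<gamma>, \<alpha>\<^sub>k\<rangle> > 0\<close> along \<open>m - 1\<close> steps to a root that
  is again orthogonal to a simple root, where induction applies, and moves \<open>X\<^sub>j\<close> down to it by the braid relation.
  If a simple root is met first, the word \<open>X\<^sub>j X\<^sub>k X\<^sub>j \<dots>\<close> is completed to a ribbon at the cost of at most \<open>d\<close>
  inverse letters.\<close>

lemma zero_step:
  assumes "layer d \<gamma> u" "j < n" "pair \<gamma> j = 0"
  shows "gx j * u \<in> filt (Suc d)"
proof (cases "d = 0")
  case True
  then obtain t where t: "t < n" "\<gamma> = simple_root t" "u \<in> spn {v t}"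
    using assms(1) layer_0 by blast
  have tj: "t \<noteq> j" "M t j = 2"
    using simple_pair_zero[OF t(1) assms(2)] assms(3) t(2) by auto
  have "gx j * u \<in> spn {v t}"
    using t(3) by (rule spn_left) (use ribbon_v[OF t(1) assms(2) tj(1)] tj(2) in auto)
  then show ?thesis by (rule spn_v_filt[OF t(1)])
next
  case False
  obtain i0 where i0: "i0 < n" "\<gamma> i0 > 0" using layer_positive[OF assms(1)] .
  obtain k where k: "k < n" "k \<noteq> j" "pair \<gamma> k > 0"
    using exists_direction[of \<gamma> i0 j, OF layer_nonneg[OF assms(1)] i0 assms(2)] assms(3) by auto
  have kj: "k < n" "j < n" "k \<noteq> j" using k assms by auto
  let ?m = "M k j"
  obtain m where m: "?m = Suc m" "m > 0" using M_ge2[OF kj] by (cases ?m) auto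
  have pos: "pair (chain k j s \<gamma>) (if even s then k else j) > 0" if "s < m" for s
    using pair_chain_pos[OF kj, of s \<gamma>] that m k assms(3) by simp
  show ?thesis
  proof (cases "m \<le> d")
    case True
    obtain u0 where u0: "layer (d - m) (chain k j m \<gamma>) u0" "u - altw (gx k) (gx j) m * u0 \<in> filt d"
      by (rule down[OF assms(1) order_refl kj(1,2) True]) (use pos in auto)
    let ?c = "if even m then k else j"
    have "pair (chain k j m \<gamma>) ?c = 0"
      using pair_chain_last[OF kj, of m \<gamma>] m assms(3) by simp
    then have "gx ?c * u0 \<in> filt (Suc (d - m))"
      using zero_below[of "d - m" _ u0 ?c] u0(1) kj m True by auto
    then have 1: "altw (gx k) (gx j) m * (gx ?c * u0) \<in> filt (Suc d)"
      using altx_filt[of k j "gx ?c * u0" "Suc (d - m)" m] kj True by simp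
    have "gx j * (altw (gx k) (gx j) m * u0) = altw (gx j) (gx k) (Suc m) * u0"
      by (simp add: mult.assoc)
    also have "\<dots> \<approx>\<^sub>J altw (gx k) (gx j) (Suc m) * u0"
      using eqv_right[OF eqv_sym[OF braid[OF kj]], of u0] m by simp
    also have "\<dots> = altw (gx k) (gx j) m * (gx ?c * u0)"
      by (simp only: altw_snoc mult.assoc if_distrib[of gx])
    finally have 2: "gx j * (altw (gx k) (gx j) m * u0) \<in> filt (Suc d)"
      using 1 by (rule filt_eqv)
    have "gx j * (u - altw (gx k) (gx j) m * u0) \<in> filt (Suc d)"
      by (rule x_filt[OF order_refl kj(2) u0(2)])
    from filt_add[OF this 2] show ?thesis by (simp add: right_diff_distrib)
  next
    case False
    obtain u0 where u0: "layer 0 (chain k j d \<gamma>) u0" "u - altw (gx k) (gx j) d * u0 \<in> filt d"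
      using down[OF assms(1) order_refl kj(1,2) order_refl] pos False by auto
    then obtain t where t: "t < n" "chain k j d \<gamma> = simple_root t" "u0 \<in> spn {v t}"
      using layer_0 by blast
    have dm: "d < ?m" "d < m" using False m by auto
    note stop = chain_stop[OF kj t(1,2) dm(1) pos[OF dm(2)]]
    have "cos (real (Suc d) * angle k j) = 0"
      using stop(2) assms(3) by (simp add: add.commute)
    then have "?m \<le> 2 * Suc d"
      using cos_multiple_pos_iff(2)[OF kj, of "Suc d"] dm m by simp
    moreover have "Suc d \<le> m" using dm by simp
    \<comment> \<open>The number of letters missing from the word \<open>X\<^sub>j X\<^sub>k X\<^sub>j \<dots>\<close> of length \<open>d + 1\<close> to a ribbon.\<close>
    define s where "s = m - Suc d"
    ultimately have s: "s \<le> d" "s + Suc d = m" using m dm by (auto simp: s_def)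
    let ?a = "if even s then j else k" and ?b = "if even s then k else j"
    have ab: "?a < n" "?b < n" "?a \<noteq> ?b" "M ?a ?b = ?m"
      using kj M_sym[of k j] by auto
    have "even m \<longleftrightarrow> (even s \<longleftrightarrow> odd d)"
      using s(2) by presburger
    then have ta: "t = (if even m then ?a else ?b)"
      using stop(1) by (cases "even s"; cases "even d") simp_all
    have mb: "M ?b ?a = Suc m" using kj m M_sym[of k j] by auto
    define w where "w = altw (gx ?a) (gx ?b) m * u0"
    have w: "w \<in> spn {v ?b}"
      unfolding w_def
    proof (rule spn_left[OF t(3)])
      fix x assume "x \<in> {v t}"
      then show "altw (gx ?a) (gx ?b) m * x \<in> spn {v ?b}"
        using ribbon_v[OF ab(2,1) not_sym[OF ab(3)]] unfolding mb by (simp add: ta)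
    qed
    have "gx j * (altw (gx k) (gx j) d * u0) = altw (gx j) (gx k) (Suc d) * u0"
      by (simp add: mult.assoc)
    also have "\<dots> \<approx>\<^sub>J altw (gy k) (gy j) s * w"
      unfolding w_def s(2)[symmetric]
      using eqv_right[OF altw_cancel_left[OF kj(2,1), of "Suc d" s], of u0] by (simp only: mult.assoc)
    finally have "gx j * (altw (gx k) (gx j) d * u0) \<approx>\<^sub>J altw (gy k) (gy j) s * w" .
    moreover have "altw (gy k) (gy j) s * w \<in> filt (Suc (0 + s))"
      by (rule alty_filt[OF kj(1,2) spn_v_filt[OF ab(2) w]]) (use s in simp)
    ultimately have 2: "gx j * (altw (gx k) (gx j) d * u0) \<in> filt (Suc d)"
      using s(1) by (auto intro: filt_eqv filt_mono)
    have "gx j * (u - altw (gx k) (gx j) d * u0) \<in> filt (Suc d)"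
      by (rule x_filt[OF order_refl kj(2) u0(2)])
    from filt_add[OF this 2] show ?thesis by (simp add: right_diff_distrib)
  qed
qed

text \<open>If \<open>\<langle>\<gamma>, \<alpha>\<^sub>j\<rangle> > 0\<close>, write the element as \<open>X\<^sub>j u\<^sub>1\<close> and absorb \<open>X\<^sub>j\<close> in \<open>E\<^sub>j\<close>.  Otherwise choose \<open>k\<close> by
  \<open>exists_direction\<close>, descend \<open>r\<close> steps as far as the pairings stay positive, and complete the alternating word to a
  ribbon by \<open>s = m - 1 - r\<close> inverse letters.  The ribbon moves \<open>E\<^sub>j\<close> next to these letters.  As \<open>2 r + 1 \<ge> m\<close>, they
  climb no higher than before the descent, so the induction on the depth applies; when \<open>s = r\<close> the depth is the same,
  and an inner induction on the height of the root is used.  A simple root met on the way leaves a computation inside the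
  rank-two subsystem, which is \<open>dihedral_v\<close>.\<close>

lemma e_step:
  assumes "layer d \<gamma> u" "j < n"
  shows "ge j * u \<in> spn {v j}"
  using assms
proof (induction "rank_below \<gamma>" arbitrary: \<gamma> u j rule: less_induct)
  case less
  note u = less.prems(1) and j = less.prems(2)
  have lower: "ge j * u \<in> spn {v j}" if "u - w \<in> filt d" "ge j * w \<in> spn {v j}" for w
    using spn.add[OF e_filt[OF order_refl j that(1)] that(2)] by (simp add: right_diff_distrib)
  show ?case
  proof (cases "d = 0")
    case True
    then obtain t where t: "t < n" "u \<in> spn {v t}" using u layer_0 by blast
    show ?thesis
    proof (rule spn_left[OF t(2)])
      fix x assume "x \<in> {v t}"
      then show "ge j * x \<in> spn {v j}"
        using e_v[of j] dihedral_v[of j t 0] t j M_ge2[of j t] by (cases "t = j") auto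
    qed
  next
    case False
    then obtain e where e: "d = Suc e" by (cases d) auto
    show ?thesis
    proof (cases "pair \<gamma> j > 0")
      case True
      obtain u1 where u1: "layer e (reflect j \<gamma>) u1" "u - gx j * u1 \<in> filt d"
        using descends_le[of e] u True j unfolding e descends_def by blast
      have "ge j * u1 \<in> spn {v j}"
        using layer_filt[OF u1(1), of d] e j by (intro e_filt) auto
      then have "sc (inverse (l j)) * (ge j * u1) \<in> spn {v j}" by (rule spn.scale)
      moreover have "ge j * (gx j * u1) \<approx>\<^sub>J sc (inverse (l j)) * (ge j * u1)"
        using eqv_right[OF ex[OF j], of u1] by (simp add: mult.assoc)
      ultimately show ?thesis using lower[OF u1(2)] spn_eqv by blast
    next
      case nonpos: False
      obtain i0 where i0: "i0 < n" "\<gamma> i0 > 0" using layer_positive[OF u] .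
      obtain k where k: "k < n" "k \<noteq> j" and dir: "pair \<gamma> k + cos (angle k j) * pair \<gamma> j > 0"
        using exists_direction[of \<gamma> i0 j, OF layer_nonneg[OF u] i0 j] nonpos by auto
      have kj: "k < n" "j < n" "k \<noteq> j" using k j by auto
      let ?m = "M k j" and ?p = "\<lambda>s. pair (chain k j s \<gamma>) (if even s then k else j)"
      obtain m where m: "?m = Suc m" "m > 0" using M_ge2[OF kj] by (cases ?m) auto
      have mj: "M j k = Suc m" using m M_sym kj by simp
      \<comment> \<open>The first place where the descent along \<open>k, j, k, \<dots>\<close> stops; \<open>pair_chain_last\<close> shows that there is one.\<close>
      define r where "r = (LEAST r. \<not> ?p r > 0)"
      have "\<not> ?p m > 0"
        using pair_chain_last[OF kj, of m \<gamma>] m nonpos by simp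
      then have r: "\<not> ?p r > 0" "r \<le> m" and pos: "\<And>s. s < r \<Longrightarrow> ?p s > 0"
        unfolding r_def by (rule LeastI, rule Least_le) (use not_less_Least in blast)
      \<comment> \<open>By the choice of \<open>k\<close> the descent goes at least half of the way around.\<close>
      have half: "?m \<le> 2 * r + 1"
        using pair_chain_half[OF kj, of r \<gamma>] nonpos dir r(1) by force
      show ?thesis
      proof (cases "d < r")
        case True
        obtain u0 where u0: "layer 0 (chain k j d \<gamma>) u0" "u - altw (gx k) (gx j) d * u0 \<in> filt d"
          using down[OF u order_refl kj(1,2) order_refl] pos True by auto
        then obtain t where t: "t < n" "chain k j d \<gamma> = simple_root t" "u0 \<in> spn {v t}"
          using layer_0 by blast
        have dm: "d < ?m" using True r m by simp
        have ta: "t = (if even d then k else j)"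
          by (rule chain_stop(1)[OF kj t(1,2) dm pos[OF True]])
        have "ge j * altw (gx k) (gx j) d * u0 \<in> spn {v j}"
        proof (rule spn_left[OF t(3)])
          fix x assume "x \<in> {v t}"
          then show "ge j * altw (gx k) (gx j) d * x \<in> spn {v j}"
            using dihedral_v[OF kj(2,1) not_sym[OF kj(3)], of d] dm m mj ta by (simp add: mult.assoc)
        qed
        then show ?thesis using lower[OF u0(2)] by (simp add: mult.assoc)
      next
        case False
        then have rd: "r \<le> d" by simp
        obtain u0 where u0: "layer (d - r) (chain k j r \<gamma>) u0" "u - altw (gx k) (gx j) r * u0 \<in> filt d"
          by (rule down[OF u order_refl kj(1,2) rd]) (use pos in auto)
        define s where "s = m - r"
        have s: "r + s = m" "s \<le> r" using r half m by (auto simp: s_def)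
        let ?L = "if odd m then k else j" and ?P = "if odd m then j else k"
        define W where "W = altw (gy ?L) (gy ?P) s"
        have P: "?P < n" "?L < n" "?P = (if odd (M j k) then k else j)" using kj mj by auto
        have g: "altw (gx k) (gx j) r \<approx>\<^sub>J altw (gx k) (gx j) m * W"
          unfolding W_def using altw_cancel_right[OF kj(1,2), of r s] by (simp add: s(1))
        have "ge j * (altw (gx k) (gx j) r * u0) \<approx>\<^sub>J ge j * (altw (gx k) (gx j) m * W * u0)"
          by (intro eqv_left eqv_right g)
        also have "\<dots> = ge j * altw (gx k) (gx j) m * (W * u0)" by (simp add: mult.assoc)
        also have "\<dots> \<approx>\<^sub>J altw (gx k) (gx j) m * ge ?P * (W * u0)"
          using ribbon_e[OF kj(2,1) not_sym[OF kj(3)]] unfolding P(3)[symmetric]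
          by (intro eqv_right) (simp add: mj)
        also have "\<dots> = altw (gx k) (gx j) m * (ge ?P * (W * u0))" by (simp only: mult.assoc)
        finally have move: "ge j * (altw (gx k) (gx j) r * u0) \<approx>\<^sub>J
            altw (gx k) (gx j) m * (ge ?P * (W * u0))" .
        have u0f: "u0 \<in> filt (Suc (d - r))" by (rule layer_filt[OF u0(1)]) simp
        have "ge ?P * (W * u0) \<in> spn {v ?P}"
        proof (cases "s < r")
          case True
          have "W * u0 \<in> filt (Suc (d - r + s))"
            unfolding W_def by (rule alty_filt[OF P(2,1) u0f]) (use True rd in simp)
          then show ?thesis
            by (rule e_filt[rotated 2]) (use True rd P in auto)
        next
          case False
          then have sr: "s = r" "m = 2 * r" "r > 0" using s m by auto
          have Pk: "?P = k" "?L = j" by (simp_all add: sr)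
          \<comment> \<open>The tie \<open>m = 2 r\<close>, in terms of the ribbon length: inverse letters are replaced by letters, which climb back to the same depth on the other side of the orbit.\<close>
          let ?X = "altw (gx j) (gx k) r * u0"
          have "W * u0 - ?X \<in> filt (d - r + r)"
            unfolding W_def Pk sr(1) by (rule alty_minus_altx[OF kj(2,1) u0f]) (use rd in simp)
          then have diff: "W * u0 - ?X \<in> filt d" using rd by simp
          let ?g0 = "chain k j r \<gamma>"
          let ?a = "if even r then k else j" and ?b = "if even r then j else k"
          have ab: "?a < n" "?b < n" "?a \<noteq> ?b" "M ?a ?b = ?m"
            using kj M_sym[of k j] by auto
          obtain r' where r': "r = Suc r'" using sr by (cases r) auto
          have prev: "pair ?g0 ?b = - ?p r'"
            using pair_chain_prev[OF kj(1,2), of r' \<gamma>] r' by (simp split: if_splits)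
          \<comment> \<open>This inequality makes the root at the end of the climb lower than \<open>\<gamma>\<close>.\<close>
          have tie: "?p r' + ?p r > 0"
            using pair_chain_tie[OF kj, of r' \<gamma>] dir sr m r' by simp
          have "ge k * ?X \<in> spn {v k}"
          proof (cases "pair ?g0 ?a = 0")
            case True
            then have "gx ?a * u0 \<in> filt (Suc (d - r))"
              using zero_below[OF _ u0(1), of ?a] ab sr rd by auto
            then have "altw (gx j) (gx k) r' * (gx ?a * u0) \<in> filt (Suc (d - r) + r')"
              using altx_filt[of j k "gx ?a * u0" "Suc (d - r)" r'] kj rd r' by simp
            moreover have "altw (gx j) (gx k) r' * (gx ?a * u0) = ?X"
              unfolding r' altw_snoc by (simp add: mult.assoc)
            moreover have "Suc (d - r) + r' = d" using rd r' by simp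
            ultimately have "?X \<in> filt d" by simp
            then show ?thesis by (rule e_filt[OF order_refl kj(1)])
          next
            case False
            then have na: "pair ?g0 ?a < 0" using r(1) by simp
            have nb: "pair ?g0 ?b < 0" using prev pos[of r'] r' by simp
            have up: "layer (d - r + r) (chain ?a ?b r ?g0)
              (altw (gx (if odd r then ?a else ?b)) (gx (if odd r then ?b else ?a)) r * u0)"
            proof (rule layer_ups[OF u0(1) ab(1,2)])
              fix i assume "i < r"
              then show "pair (chain ?a ?b i ?g0) (if even i then ?a else ?b) < 0"
                using ab(4) m sr na nb by (intro pair_chain_neg[OF ab(1-3)]) auto
            qed
            have ret: "chain ?b ?a r ?g0 = \<gamma>"
            proof -
              have "\<gamma> = arefl k j r ?g0" by (simp only: arefl_chain[OF kj(1,2)])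
              then show ?thesis unfolding arefl_conv_chain by (simp split: if_splits)
            qed
            have "height (chain ?a ?b r ?g0) < height (chain ?b ?a r ?g0)"
              by (rule height_swap_less[OF ab(1-3)]) (use sr ab(4) m tie prev in auto)
            then have "height (chain ?a ?b r ?g0) < height \<gamma>" unfolding ret .
            moreover have "chain ?a ?b r ?g0 \<in> roots" by (rule layer_root[OF up])
            ultimately have "rank_below (chain ?a ?b r ?g0) < rank_below \<gamma>"
              by (intro rank_below_less)
            moreover have "layer d (chain ?a ?b r ?g0) ?X"
              using up rd by (simp split: if_splits)
            ultimately show ?thesis using less.hyps kj(1) by blast
          qed
          then have "ge k * (W * u0 - ?X) + ge k * ?X \<in> spn {v k}"
            using spn.add[OF e_filt[OF order_refl kj(1) diff]] by blast
          then show ?thesis unfolding Pk by (simp add: right_diff_distrib)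
        qed
        then have "altw (gx k) (gx j) m * (ge ?P * (W * u0)) \<in> spn {v j}"
        proof (rule spn_left)
          fix x assume "x \<in> {v ?P}"
          then show "altw (gx k) (gx j) m * x \<in> spn {v j}"
            using ribbon_v[OF kj(2,1) not_sym[OF kj(3)]] unfolding P(3)[symmetric] by (simp add: mj)
        qed
        then have "ge j * (altw (gx k) (gx j) r * u0) \<in> spn {v j}"
          by (rule spn_eqv[OF move])
        then show ?thesis by (rule lower[OF u0(2)])
      qed
    qed
  qed
qed

text \<open>The three signs of the pairing: a climb, \<open>zero_step\<close>, or a descent followed by \<open>x_square\<close>.\<close>

lemma x_step:
  assumes "layer d \<gamma> u" "k < n"
  shows "gx k * u \<in> filt (Suc (Suc d))"
proof -
  consider "pair \<gamma> k < 0" | "pair \<gamma> k = 0" | "pair \<gamma> k > 0" by linarith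
  then show ?thesis
  proof cases
    case 1
    then show ?thesis using layer.up[OF assms] by (intro layer_filt) auto
  next
    case 2
    then show ?thesis using zero_step[OF assms] by (auto intro: filt_mono)
  next
    case 3
    show ?thesis
    proof (cases "d = 0")
      case True
      then obtain t where t: "t < n" "\<gamma> = simple_root t" "u \<in> spn {v t}"
        using assms(1) layer_0 by blast
      have "t = k" using simple_pair_pos[OF t(1) assms(2)] 3 t(2) by simp
      then have "gx k * u \<in> spn {v k}"
        using t(3) x_v[OF assms(2)] by (auto intro: spn_left)
      then show ?thesis by (rule spn_v_filt[OF assms(2)])
    next
      case False
      then obtain e where e: "d = Suc e" by (cases d) auto
      obtain u1 where u1: "layer e (reflect k \<gamma>) u1" "u - gx k * u1 \<in> filt d"
        using descends_le[of e] assms 3 unfolding e descends_def by blast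
      have u1f: "u1 \<in> filt d" using layer_filt[OF u1(1), of d] e by simp
      have "gx k * (gx k * u1) \<approx>\<^sub>J (1 - sc (eta k) * gx k + sc (eta k / l k) * ge k) * u1"
        using eqv_right[OF x_square[OF assms(2)], of u1] by (simp only: mult.assoc)
      also have "\<dots> = u1 - sc (eta k) * (gx k * u1) + sc (eta k / l k) * (ge k * u1)"
        by (simp add: distrib_right left_diff_distrib mult.assoc)
      finally have "gx k * (gx k * u1) \<in> filt (Suc d)"
      proof (rule filt_eqv)
        show "u1 - sc (eta k) * (gx k * u1) + sc (eta k / l k) * (ge k * u1) \<in> filt (Suc d)"
          using filt_mono[OF u1f, of "Suc d"] x_filt[OF order_refl assms(2) u1f]
            spn_v_filt[OF assms(2) e_filt[OF order_refl assms(2) u1f], of d]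
          by (intro filt_add filt_diff filt_scale) auto
      qed
      then have "gx k * (u - gx k * u1) + gx k * (gx k * u1) \<in> filt (Suc d)"
        using x_filt[OF order_refl assms(2) u1(2)] by (intro filt_add)
      then show ?thesis by (auto simp: right_diff_distrib intro: filt_mono)
    qed
  qed
qed

lemma stage_Suc: "stage (Suc d)"
  unfolding stage_def
proof (intro conjI allI ballI impI)
  fix k u assume k: "k < n" and u: "u \<in> filt (Suc d)"
  show "gx k * u \<in> filt (Suc (Suc d))"
    unfolding filt_def[of "Suc (Suc d)"]
  proof (rule filt_left[OF u, folded filt_def])
    fix e \<gamma> w assume w: "layer e \<gamma> w" "e < Suc d"
    have "gx k * w \<in> filt (Suc (Suc d))"
    proof (cases "e = d")
      case True
      then show ?thesis using x_step w k by blast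
    next
      case False
      then have "gx k * w \<in> filt (Suc d)"
        using w layer_filt[OF w(1), of d] by (intro x_filt[OF order_refl k]) auto
      then show ?thesis by (auto intro: filt_mono)
    qed
    then show "gx k * w \<in> spn {u. \<exists>e<Suc (Suc d). \<exists>\<gamma>. layer e \<gamma> u}"
      by (simp add: filt_def)
  qed
  show "ge k * u \<in> spn {v k}"
  proof (rule filt_left[OF u])
    fix e \<gamma> w assume w: "layer e \<gamma> w" "e < Suc d"
    show "ge k * w \<in> spn {v k}"
    proof (cases "e = d")
      case True
      then show ?thesis using e_step w k by blast
    next
      case False
      then show ?thesis
        using w layer_filt[OF w(1), of d] by (intro e_filt[OF order_refl k]) auto
    qed
  qed
next
  fix e assume "Suc e < Suc d"
  then show "descends e" by (intro descends_le) simp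
next
  fix e \<gamma> u j assume "e < Suc d" "layer e \<gamma> u" "j < n" "pair \<gamma> j = 0"
  then show "gx j * u \<in> filt (Suc e)"
    using zero_below zero_step by (cases "e = d") auto
qed

end

theorem stage_all: "stage d"
proof (induction d rule: less_induct)
  case (less d)
  show ?case
  proof (cases d)
    case 0
    have "u \<in> spn {}" if "u \<in> filt 0" for u using that by (simp add: filt_def)
    then show ?thesis
      unfolding stage_def 0 by (auto simp: filt_def intro: spn_left)
  next
    case (Suc d')
    then show ?thesis using stage_Suc[of d'] less by simp
  qed
qed

end


section \<open>Finiteness of the filtered modules\<close>

context bmw_relations
begin

text \<open>The subalgebra generated by the letters, together with \<open>J\<close>.  The ambient ring may be larger.\<close>

inductive_set alg :: "'r set" where
  ideal: "z \<in> J \<Longrightarrow> z \<in> alg"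
| one: "1 \<in> alg"
| x: "k < n \<Longrightarrow> gx k \<in> alg"
| y: "k < n \<Longrightarrow> gy k \<in> alg"
| e: "k < n \<Longrightarrow> ge k \<in> alg"
| mult: "u \<in> alg \<Longrightarrow> w \<in> alg \<Longrightarrow> u * w \<in> alg"
| add: "u \<in> alg \<Longrightarrow> w \<in> alg \<Longrightarrow> u + w \<in> alg"
| scale: "u \<in> alg \<Longrightarrow> sc c * u \<in> alg"

lemma spn_y_left:
  assumes "k < n" "gx k * u \<in> spn S" "ge k * u \<in> spn S" "u \<in> spn S"
  shows "gy k * u \<in> spn S"
proof -
  have "gy k * u \<approx>\<^sub>J (gx k + sc (eta k) - sc (eta k) * ge k) * u"
    by (rule eqv_right[OF y_expand[OF assms(1)]])
  also have "\<dots> = gx k * u + sc (eta k) * u - sc (eta k) * (ge k * u)"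
    by (simp add: distrib_right left_diff_distrib mult.assoc)
  finally show ?thesis
    by (rule spn_eqv) (intro spn_diff spn.add spn.scale assms)
qed

text \<open>Stability under \<open>gx\<close> and \<open>ge\<close> suffices, as \<open>y_expand\<close> expresses \<open>gy\<close> through them.\<close>

lemma alg_stable:
  assumes x: "\<And>k s. k < n \<Longrightarrow> s \<in> S \<Longrightarrow> gx k * s \<in> spn S"
    and e: "\<And>k s. k < n \<Longrightarrow> s \<in> S \<Longrightarrow> ge k * s \<in> spn S"
    and "a \<in> alg" "u \<in> spn S"
  shows "a * u \<in> spn S"
  using assms(3,4)
proof (induction a arbitrary: u)
  case (x k)
  then show ?case using assms(1) by (auto intro: spn_left)
next
  case (e k)
  then show ?case using assms(2) by (auto intro: spn_left)
next
  case (y k)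
  have "gx k * u \<in> spn S" "ge k * u \<in> spn S"
    using y assms(1,2) by (auto intro: spn_left)
  then show ?case using y by (intro spn_y_left)
qed (auto intro: spn.intros right_J simp: distrib_right mult.assoc)

end

context lk_module
begin

lemma layer_words:
  assumes "layer d \<gamma> u"
  shows "u \<in> spn ((\<lambda>(w, t). prod_list (map gx w) * v t) ` ({w. set w \<subseteq> {..<n} \<and> length w = d} \<times> {..<n}))"
  using assms
proof (induction rule: layer.induct)
  case (base t u)
  show ?case
    by (rule spn_mono[OF _ base(2)]) (use base(1) in \<open>force intro!: image_eqI[of _ _ "([], t)"]\<close>)
next
  case (up d \<gamma> u k)
  show ?case
  proof (rule spn_left[OF up.IH])
    fix s assume "s \<in> (\<lambda>(w, t). prod_list (map gx w) * v t) ` ({w. set w \<subseteq> {..<n} \<and> length w = d} \<times> {..<n})"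
    then obtain w t where "set w \<subseteq> {..<n}" "length w = d" "t < n" "s = prod_list (map gx w) * v t"
      by auto
    then show "gx k * s \<in> spn ((\<lambda>(w, t). prod_list (map gx w) * v t) `
        ({w. set w \<subseteq> {..<n} \<and> length w = Suc d} \<times> {..<n}))"
      using up.hyps(2)
      by (intro spn.base image_eqI[of _ _ "(k # w, t)"]) (auto simp: mult.assoc)
  qed
qed (rule spn.add)

text \<open>The depth is bounded by the number of roots, so the filtration is stationary and its last term is stable
  by \<open>stage_all\<close>.  It is spanned by the climbing words, of which there are finitely many up to that length.\<close>

lemma module_finite:
  "\<exists>S. finite S \<and> (\<forall>a\<in>alg. \<forall>t<n. a * v t \<in> spn S)"
proof -
  define N where "N = card roots"
  define S where "S = (\<lambda>(w, t). prod_list (map gx w) * v t) ` ({w. set w \<subseteq> {..<n} \<and> length w \<le> N} \<times> {..<n})"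
  define Q where "Q = {u. \<exists>e<Suc N. \<exists>\<gamma>. layer e \<gamma> u}"
  have bound: "d < Suc N" if "layer d \<gamma> u" for d \<gamma> u
  proof -
    have "rank_below \<gamma> \<le> N"
      unfolding rank_below_def N_def by (rule card_mono[OF finite_roots]) auto
    then show ?thesis using layer_bound[OF that] by simp
  qed
  have Q: "spn Q = filt (Suc N)" by (simp add: Q_def filt_def)
  have Q': "u \<in> spn Q" if "u \<in> filt d" for u d
    using that unfolding filt_def
    by (rule spn_mono[rotated]) (use bound in \<open>auto simp: Q_def\<close>)
  have "finite S"
    unfolding S_def using finite_lists_length_le[of "{..<n}" N] by (intro finite_imageI) auto
  moreover have "a * v t \<in> spn S" if a: "a \<in> alg" "t < n" for a t
  proof -
    have "a * v t \<in> spn Q"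
    proof (rule alg_stable[OF _ _ a(1)])
      fix k s assume k: "k < n" and "s \<in> Q"
      then have s: "s \<in> filt (Suc N)" using Q spn.base by blast
      show "gx k * s \<in> spn Q"
        using stage_all[of "Suc N"] s k Q' unfolding stage_def by blast
      have "ge k * s \<in> spn {v k}"
        using stage_all[of "Suc N"] s k unfolding stage_def by blast
      then show "ge k * s \<in> spn Q" using spn_v_filt[OF k] Q' by blast
    next
      show "v t \<in> spn Q"
        using spn_v_filt[OF a(2) spn.base[of "v t"]] Q' by blast
    qed
    then show ?thesis
    proof (rule spn_subset[rotated])
      fix u assume "u \<in> Q"
      then obtain e \<gamma> where "e \<le> N" "layer e \<gamma> u" by (auto simp: Q_def less_Suc_eq_le)
      then show "u \<in> spn S"
        using layer_words[of e \<gamma> u] unfolding S_def by (auto intro: spn_mono[rotated])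
    qed
  qed
  ultimately show ?thesis by blast
qed

end


section \<open>Sign coherence of roots and Hecke words\<close>

context finite_coxeter_system
begin

lemma height_linear: "height (\<lambda>i. u i + c * w i) = height u + c * height w"
  by (simp only: height_def sum.distrib sum_distrib_left)

lemma quotient_span_trivial: "quotient_span UNIV (\<lambda>c :: complex. c)"
  by (rule quotient_span.intro) (auto simp: mult.commute)

text \<open>With \<open>J = UNIV\<close> all relations hold trivially, and the statements on layers become statements on roots alone.\<close>

lemma lk_module_trivial:
  "lk_module n M UNIV (\<lambda>c. c) (\<lambda>_. 0 :: complex) (\<lambda>_. 0) (\<lambda>_. 0) (\<lambda>_. 2) (\<lambda>_. 1) (\<lambda>_. 0)"
proof -
  note eqv = quotient_span.eqv_def[OF quotient_span_trivial]
  have "bmw_relations n M UNIV (\<lambda>c. c) (\<lambda>_. 0 :: complex) (\<lambda>_. 0) (\<lambda>_. 0) (\<lambda>_. 2) (\<lambda>_. 1)"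
    by (rule bmw_relations.intro[OF finite_coxeter_system_axioms quotient_span_trivial],
        rule bmw_relations_axioms.intro) (simp_all add: eqv)
  then show ?thesis
    by (rule lk_module.intro, intro lk_module_axioms.intro)
      (simp_all add: quotient_span.spn_zero[OF quotient_span_trivial])
qed

text \<open>A root or its negative carries a layer, hence has nonnegative coordinates and height at least \<open>1\<close>.  That the
  positive roots in this sense are permuted by \<open>s\<^sub>i\<close>, except for the sign change of \<open>\<alpha>\<^sub>i\<close>, is the clause
  \<open>descends\<close> for the trivial module.\<close>

lemma height_root_nonzero:
  assumes "g \<in> grp" "k < n"
  shows "height (g (simple_root k)) \<noteq> 0"
proof -
  interpret lk_module n M UNIV "\<lambda>c. c" "\<lambda>_. 0 :: complex" "\<lambda>_. 0" "\<lambda>_. 0" "\<lambda>_. 2" "\<lambda>_. 1" "\<lambda>_. 0"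
    by (rule lk_module_trivial)
  define P where "P \<gamma> \<longleftrightarrow> (\<exists>d u. layer d \<gamma> u)" for \<gamma>
  \<comment> \<open>The set of roots that carry a layer, together with its negative, is stable under simple reflections.\<close>
  have step: "P (reflect i \<gamma>) \<or> P (\<lambda>t. - reflect i \<gamma> t)" if "P \<gamma>" "i < n" for \<gamma> i
  proof -
    obtain d u where l: "layer d \<gamma> u" using \<open>P \<gamma>\<close> unfolding P_def by blast
    consider "pair \<gamma> i < 0" | "pair \<gamma> i = 0" | "pair \<gamma> i > 0" by linarith
    then show ?thesis
    proof cases
      case 1
      then show ?thesis using layer.up[OF l that(2)] P_def by blast
    next
      case 2
      then show ?thesis using that(1) by (simp add: reflect_eq_self)
    next
      case 3
      show ?thesis
      proof (cases d)
        case 0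
        then obtain t where t: "t < n" "\<gamma> = simple_root t" using l layer_0 by blast
        have "t = i" using simple_pair_pos[OF t(1) that(2)] 3 t by simp
        then have "(\<lambda>t. - reflect i \<gamma> t) = \<gamma>"
          using t that(2) by (simp add: reflect_simple_self)
        then show ?thesis using that(1) by simp
      next
        case (Suc e)
        then have "descends e" using stage_all[of "Suc (Suc e)"] unfolding stage_def by blast
        then show ?thesis
          using l 3 that(2) unfolding Suc descends_def P_def by blast
      qed
    qed
  qed
  have neg: "reflect i (\<lambda>t. - w t) = (\<lambda>t. - reflect i w t)" for i w
    using arefl_minus[of i i "Suc 0" w] unfolding arefl.simps .
  have all: "set w \<subseteq> {..<n} \<longrightarrow> P (act w (simple_root k)) \<or> P (\<lambda>t. - act w (simple_root k) t)" for w
  proof (induct w rule: list.induct)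
    case Nil
    have "layer 0 (simple_root k) 0" by (rule layer.base[OF assms(2) spn_zero])
    then have "P (act [] (simple_root k))" unfolding P_def act.simps by (intro exI)
    then show ?case by (intro impI disjI1)
  next
    case (Cons i w)
    show ?case
    proof
      assume "set (i # w) \<subseteq> {..<n}"
      then have i: "i < n" and ih: "P (act w (simple_root k)) \<or> P (\<lambda>t. - act w (simple_root k) t)"
        using Cons by (simp_all only: list.set insert_subset lessThan_iff)
      from ih show "P (act (i # w) (simple_root k)) \<or> P (\<lambda>t. - act (i # w) (simple_root k) t)"
      proof
        assume "P (act w (simple_root k))"
        from step[OF this i] show ?thesis unfolding act.simps .
      next
        assume "P (\<lambda>t. - act w (simple_root k) t)"
        from step[OF this i] show ?thesis
          unfolding neg minus_minus act.simps by (rule disj_commute[THEN iffD1])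
      qed
    qed
  qed
  then obtain \<gamma> where "P \<gamma>" "g (simple_root k) = \<gamma> \<or> \<gamma> = (\<lambda>t. - g (simple_root k) t)"
    using assms(1) all unfolding grp_def lists_eq_set by blast
  moreover from this have "height \<gamma> \<ge> 1" using layer_height P_def by blast
  ultimately show ?thesis by (auto simp: height_def sum_negf)
qed

text \<open>The roots of a rank-two subsystem are sine combinations of its two simple roots, with nonnegative coefficients
  for \<open>s < m\<close>.\<close>

lemma arefl_simple:
  assumes "a < n" "b < n"
  shows "sin (angle a b) * arefl a b s (simple_root (if even s then a else b)) i
    = sin ((real s + 1) * angle a b) * simple_root a i + sin (real s * angle a b) * simple_root b i"
  using assms
proof (induction s arbitrary: a b i)
  case 0
  then show ?case by simp
next
  case (Suc s)
  let ?t = "angle a b" and ?r = "arefl b a s (simple_root (if even s then b else a))"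
  have t: "angle b a = ?t" using Suc.prems by (simp add: angle_sym)
  have r: "sin ?t * ?r i = sin ((real s + 1) * ?t) * simple_root b i + sin (real s * ?t) * simple_root a i" for i
    using Suc.IH[of b a i] Suc.prems by (simp add: t)
  have "sin ?t * pair ?r a = pair (\<lambda>i. sin ?t * ?r i) a" by (simp add: pair_scale)
  also have "\<dots> = sin ((real s + 1) * ?t) * gram b a + sin (real s * ?t)"
    unfolding r using Suc.prems by (simp add: pair_add pair_scale pair_simple)
  finally have p: "sin ?t * pair ?r a = - cos ?t * sin ((real s + 1) * ?t) + sin (real s * ?t)"
    using Suc.prems gram_sym[of b a] by (simp add: gram_angle)
  have "sin ?t * reflect a ?r i = sin ?t * ?r i - 2 * (sin ?t * pair ?r a) * simple_root a i"
    by (simp add: reflect_def algebra_simps)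
  also have "\<dots> = sin ((real s + 2) * ?t) * simple_root a i + sin ((real s + 1) * ?t) * simple_root b i"
    unfolding r p sin_step by (simp add: algebra_simps)
  finally have *: "sin ?t * reflect a ?r i = \<dots>" .
  have e: "real (Suc s) + 1 = real s + 2" "real (Suc s) = real s + 1" by simp_all
  have "arefl a b (Suc s) (simple_root (if even (Suc s) then a else b)) = reflect a ?r"
    by simp
  then show ?case unfolding e using * by (cases "even s") (simp_all add: add.commute)
qed

lemma height_arefl:
  assumes "g \<in> grp" "a < n" "b < n"
  shows "sin (angle a b) * height (g (arefl a b s (simple_root (if even s then a else b))))
    = height (g (simple_root a)) * sin ((real s + 1) * angle a b)
      + height (g (simple_root b)) * sin (real s * angle a b)"
proof -
  let ?r = "arefl a b s (simple_root (if even s then a else b))"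
  let ?S = "sin ((real s + 1) * angle a b)" and ?S' = "sin (real s * angle a b)"
  have lin: "height (g (\<lambda>i. u i + c * w i)) = height (g u) + c * height (g w)" for u c w
    using grp_linear[OF assms(1)] by (simp add: height_linear)
  have z: "height (g (\<lambda>i. 0)) = 0" using lin[of "\<lambda>i. 0" "-1" "\<lambda>i. 0"] by simp
  have sc: "height (g (\<lambda>i. c * w i)) = c * height (g w)" for c w
    using lin[of "\<lambda>i. 0" c w] z by simp
  have "sin (angle a b) * height (g ?r) = height (g (\<lambda>i. sin (angle a b) * ?r i))" by (rule sc[symmetric])
  also have "(\<lambda>i. sin (angle a b) * ?r i) = (\<lambda>i. ?S * simple_root a i + ?S' * simple_root b i)"
    using arefl_simple[OF assms(2,3)] by (intro ext)
  also have "height (g (\<lambda>i. ?S * simple_root a i + ?S' * simple_root b i))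
      = ?S * height (g (simple_root a)) + ?S' * height (g (simple_root b))"
    by (simp only: lin sc)
  finally show ?thesis by (simp add: mult.commute)
qed

lemma height_arefl_sign:
  assumes g: "g \<in> grp" and ab: "a < n" "b < n" "a \<noteq> b" and s: "s < M a b"
    and c: "c * height (g (simple_root a)) > 0" "c * height (g (simple_root b)) > 0"
  shows "c * height (g (arefl a b s (simple_root (if even s then a else b)))) > 0"
proof -
  let ?r = "arefl a b s (simple_root (if even s then a else b))"
  have "sin (angle a b) * (c * height (g ?r)) = c * (sin (angle a b) * height (g ?r))" by simp
  also have "\<dots> = c * height (g (simple_root a)) * sin ((real s + 1) * angle a b)
      + c * height (g (simple_root b)) * sin (real s * angle a b)"
    unfolding height_arefl[OF g ab(1,2)] by (simp add: algebra_simps)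
  also have "\<dots> > 0"
  proof (cases "Suc s = M a b")
    case True
    then have "sin (real s * angle a b) > 0"
      using sin_multiple_pos[OF ab, of "real s"] M_ge2[OF ab] by simp
    moreover have "sin ((real s + 1) * angle a b) \<ge> 0"
    proof -
      have "real s + 1 = real (M a b)" unfolding True[symmetric] by simp
      then show ?thesis using sin_multiple_nonneg[OF ab order_refl] by simp
    qed
    ultimately show ?thesis
      using mult_nonneg_nonneg[OF less_imp_le[OF c(1)]] mult_pos_pos[OF c(2)] by (meson add_nonneg_pos)
  next
    case False
    then have "sin ((real s + 1) * angle a b) > 0"
      using sin_multiple_pos[OF ab, of "real s + 1"] s by simp
    moreover have "sin (real s * angle a b) \<ge> 0"
      using sin_multiple_nonneg[OF ab, of s] s by simp
    ultimately show ?thesis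
      using mult_nonneg_nonneg[OF less_imp_le[OF c(2)]] mult_pos_pos[OF c(1)] by (meson add_pos_nonneg)
  qed
  finally show ?thesis using sin_pos[OF ab] by (simp add: zero_less_mult_iff)
qed

lemma arefl_longest:
  assumes ab: "a < n" "b < n" "a \<noteq> b"
  shows "arefl a b (M a b) (simple_root (if even (M a b) then a else b)) = (\<lambda>i. - simple_root a i)"
    and "arefl a b (M a b) (simple_root (if even (M a b) then b else a)) = (\<lambda>i. - simple_root b i)"
proof -
  have 0: "sin (real (M a b) * angle a b) = 0" "sin ((real (M a b) + 1) * angle a b) = - sin (angle a b)"
    using angle_mult[OF ab] by (simp_all add: distrib_right)
  have "sin (angle a b) * arefl a b (M a b) (simple_root (if even (M a b) then a else b)) i
      = sin (angle a b) * (- simple_root a i)" for i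
    unfolding arefl_simple[OF ab(1,2)] 0 by simp
  then show "arefl a b (M a b) (simple_root (if even (M a b) then a else b)) = (\<lambda>i. - simple_root a i)"
    using sin_cancel[OF ab] by blast
  have "sin (angle b a) * arefl b a (M a b) (simple_root (if even (M a b) then b else a)) i
      = sin (angle b a) * (- simple_root b i)" for i
    unfolding arefl_simple[OF ab(2,1)] unfolding angle_sym[OF ab(2,1)] 0 by simp
  then have "arefl b a (M a b) (simple_root (if even (M a b) then b else a)) i = - simple_root b i" for i
    by (rule sin_cancel[OF ab(2,1) not_sym[OF ab(3)]])
  then show "arefl a b (M a b) (simple_root (if even (M a b) then b else a)) = (\<lambda>i. - simple_root b i)"
    unfolding arefl_braid[OF ab] by (intro ext)
qed

end

context bmw_relations
begin

text \<open>\<open>hecke d g h\<close>: \<open>h\<close> is the value of a word of length \<open>d\<close> spelling \<open>g\<close>, in which a letter \<open>k\<close> is appended only to an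
  element that sends \<open>\<alpha>\<^sub>k\<close> to a positive root; by sign coherence these are the reduced words.\<close>

inductive hecke :: "nat \<Rightarrow> ((nat \<Rightarrow> real) \<Rightarrow> nat \<Rightarrow> real) \<Rightarrow> 'r \<Rightarrow> bool" where
  one: "hecke 0 (\<lambda>v. v) 1"
| step: "hecke d g h \<Longrightarrow> k < n \<Longrightarrow> height (g (simple_root k)) > 0 \<Longrightarrow>
    hecke (Suc d) (\<lambda>v. g (reflect k v)) (h * gx k)"

lemma hecke_grp: "hecke d g h \<Longrightarrow> g \<in> grp"
  by (induction rule: hecke.induct) (auto simp: id_in_grp grp_reflect)

lemma hecke_alg: "hecke d g h \<Longrightarrow> h \<in> alg"
  by (induction rule: hecke.induct) (auto intro: alg.intros)

lemma hecke_ups: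
  assumes "hecke e g h" "a < n" "b < n"
    and "\<And>s. s < r \<Longrightarrow> height (g (arefl a b s (simple_root (if even s then a else b)))) > 0"
  shows "hecke (e + r) (\<lambda>v. g (arefl a b r v)) (h * altw (gx a) (gx b) r)"
  using assms(4)
proof (induction r)
  case 0
  then show ?case using assms(1) by simp
next
  case (Suc r)
  let ?c = "if even r then a else b"
  have "hecke (e + r) (\<lambda>v. g (arefl a b r v)) (h * altw (gx a) (gx b) r)"
    using Suc by simp
  then have "hecke (Suc (e + r)) (\<lambda>v. g (arefl a b r (reflect ?c v))) (h * altw (gx a) (gx b) r * gx ?c)"
    by (rule hecke.step) (use Suc.prems[of r] assms(2,3) in auto)
  then show ?case
    unfolding arefl_snoc altw_snoc by (simp add: mult.assoc if_distrib[of gx])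
qed

text \<open>The exchange property: a Hecke word whose group element sends \<open>\<alpha>\<^sub>j\<close> to a negative root can be rewritten so as to
  end in \<open>X\<^sub>j\<close>.  The conjunct \<open>d = Suc e\<close> also shows that rewriting preserves the length.\<close>

definition hecke_descends :: "nat \<Rightarrow> bool" where
  "hecke_descends d \<longleftrightarrow> (\<forall>g h j. hecke d g h \<longrightarrow> j < n \<longrightarrow> height (g (simple_root j)) < 0 \<longrightarrow>
     (\<exists>e h1. d = Suc e \<and> hecke e (\<lambda>v. g (reflect j v)) h1 \<and> h \<approx>\<^sub>J h1 * gx j))"

lemma hecke_downs:
  assumes "\<And>e'. e' \<le> e \<Longrightarrow> hecke_descends e'" "hecke e g h" "k < n" "j < n"
    and "\<And>s. s < r \<Longrightarrow> height (g (arefl k j s (simple_root (if even s then k else j)))) < 0"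
  shows "\<exists>e0 h0. hecke e0 (\<lambda>v. g (arefl k j r v)) h0 \<and> e = e0 + r \<and>
    h \<approx>\<^sub>J h0 * altw (gx (if odd r then k else j)) (gx (if odd r then j else k)) r"
  using assms
proof (induction r arbitrary: e g h k j)
  case 0
  then show ?case by (intro exI[of _ e] exI[of _ h]) simp
next
  case (Suc r)
  have "height (g (simple_root k)) < 0" using Suc.prems(5)[of 0] by simp
  then obtain e1 h1 where h1: "e = Suc e1" "hecke e1 (\<lambda>v. g (reflect k v)) h1" "h \<approx>\<^sub>J h1 * gx k"
    using Suc.prems(1)[OF order_refl] Suc.prems(2,3) unfolding hecke_descends_def by blast
  have "\<exists>e0 h0. hecke e0 (\<lambda>v. g (reflect k (arefl j k r v))) h0 \<and> e1 = e0 + r \<and>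
    h1 \<approx>\<^sub>J h0 * altw (gx (if odd r then j else k)) (gx (if odd r then k else j)) r"
  proof (rule Suc.IH)
    show "height (g (reflect k (arefl j k s (simple_root (if even s then j else k))))) < 0" if "s < r" for s
      using Suc.prems(5)[of "Suc s"] that by (simp split: if_splits)
  qed (use Suc.prems h1 in auto)
  then obtain e0 h0 where h0: "hecke e0 (\<lambda>v. g (reflect k (arefl j k r v))) h0" "e1 = e0 + r"
    "h1 \<approx>\<^sub>J h0 * altw (gx (if odd r then j else k)) (gx (if odd r then k else j)) r" by blast
  have "h \<approx>\<^sub>J h0 * altw (gx (if odd r then j else k)) (gx (if odd r then k else j)) r * gx k"
    by (rule eqv_trans[OF h1(3) eqv_right[OF h0(3)]])
  also have "\<dots> = h0 * altw (gx (if odd (Suc r) then k else j)) (gx (if odd (Suc r) then j else k)) (Suc r)"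
    unfolding altw_snoc by (cases "even r") (simp_all add: mult.assoc)
  finally show ?case
    using h0(1,2) h1(1) by (intro exI[of _ e0] exI[of _ h0]) simp
qed

text \<open>If the word ends in \<open>X\<^sub>k\<close> with \<open>k \<noteq> j\<close>, then \<open>g\<close> makes both \<open>\<alpha>\<^sub>k\<close> and \<open>\<alpha>\<^sub>j\<close> negative.  Stripping an
  alternating word of length \<open>m\<close> leaves an element that makes both positive, and the braid relation replaces the
  stripped word by the one ending in \<open>X\<^sub>j\<close>.\<close>

lemma hecke_descends_all: "hecke_descends d"
proof (induction d rule: less_induct)
  case (less d)
  show ?case
    unfolding hecke_descends_def
  proof (intro allI impI)
    fix g h j assume gh: "hecke d g h" and j: "j < n" and neg: "height (g (simple_root j)) < 0"
    from gh show "\<exists>e h1. d = Suc e \<and> hecke e (\<lambda>v. g (reflect j v)) h1 \<and> h \<approx>\<^sub>J h1 * gx j"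
    proof cases
      case one
      then show ?thesis using neg j by simp
    next
      case (step e g' h' k)
      note st = step
      have k: "k < n" by fact
      have gg: "(\<lambda>v. g (reflect k v)) = g'" using step k by simp
      have g: "g \<in> grp" by (rule hecke_grp[OF gh])
      show ?thesis
      proof (cases "k = j")
        case True
        then show ?thesis using step gg by (intro exI[of _ e] exI[of _ h']) auto
      next
        case False
        then have kj: "k < n" "j < n" "k \<noteq> j" using k j by auto
        have negk: "height (g (simple_root k)) < 0"
        proof -
          have "height (\<lambda>i. - g' (simple_root k) i) < 0"
            using step by (simp add: height_def sum_negf)
          moreover have "g (simple_root k) = (\<lambda>i. - g' (simple_root k) i)"
            using grp_linear[OF hecke_grp[OF step(4)], of "simple_root k" "- 2" "simple_root k"]
            unfolding step(2) reflect_simple_self[OF k] by simp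
          ultimately show ?thesis by simp
        qed
        have sgn: "height (g (arefl k j s (simple_root (if even s then k else j)))) < 0" if "s < M k j" for s
          using height_arefl_sign[OF g kj that, of "- 1"] neg negk by simp
        obtain m where m: "M k j = Suc m" using M_ge2[OF kj] by (cases "M k j") auto
        have "\<exists>e0 h0. hecke e0 (\<lambda>v. g' (arefl j k m v)) h0 \<and> e = e0 + m \<and>
          h' \<approx>\<^sub>J h0 * altw (gx (if odd m then j else k)) (gx (if odd m then k else j)) m"
        proof (rule hecke_downs)
          show "height (g' (arefl j k s (simple_root (if even s then j else k)))) < 0" if "s < m" for s
            using sgn[of "Suc s"] that m unfolding gg[symmetric] by (simp split: if_splits)
        qed (use less step kj in auto)
        then obtain e0 h0 where h0: "hecke e0 (\<lambda>v. g' (arefl j k m v)) h0" "e = e0 + m"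
          "h' \<approx>\<^sub>J h0 * altw (gx (if odd m then j else k)) (gx (if odd m then k else j)) m" by blast
        let ?a = "if odd m then k else j" and ?b = "if odd m then j else k"
        let ?g0 = "\<lambda>v. g (arefl k j (M k j) v)"
        have g0: "hecke e0 ?g0 h0" using h0(1) unfolding gg[symmetric] m by simp
        have "h = h' * gx k" by fact
        also have "\<dots> \<approx>\<^sub>J h0 * altw (gx ?b) (gx ?a) m * gx k"
          using h0(3) by (intro eqv_right) (simp split: if_splits)
        also have "\<dots> = h0 * altw (gx ?b) (gx ?a) (M k j)"
          unfolding m altw_snoc by (cases "even m") (simp_all add: mult.assoc)
        also have "\<dots> \<approx>\<^sub>J h0 * altw (gx ?a) (gx ?b) (M k j)"
          using braid[OF kj] eqv_sym by (intro eqv_left) auto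
        also have "\<dots> = h0 * altw (gx ?a) (gx ?b) m * gx j"
          unfolding m altw_snoc by (cases "even m") (simp_all add: mult.assoc)
        finally have h: "h \<approx>\<^sub>J h0 * altw (gx ?a) (gx ?b) m * gx j" .
        have ab: "?a < n" "?b < n" "?a \<noteq> ?b" "M ?a ?b = Suc m"
          using kj m M_sym[of k j] by auto
        have neg0: "height (g (\<lambda>i. - simple_root t i)) > 0" if "height (g (simple_root t)) < 0" for t
        proof -
          have "g (\<lambda>i. - simple_root t i) = (\<lambda>i. - g (simple_root t) i)"
            using grp_linear[OF g, of "\<lambda>i. 0" "- 1" "simple_root t"] grp_linear[OF g, of "\<lambda>i. 0" "- 1" "\<lambda>i. 0"]
            by (simp add: fun_eq_iff)
          then show ?thesis using that by (simp add: height_def sum_negf)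
        qed
        have "height (?g0 (simple_root k)) > 0 \<and> height (?g0 (simple_root j)) > 0"
          using arefl_longest[OF kj] neg0[OF neg] neg0[OF negk] by (simp split: if_splits)
        then have pos0: "height (?g0 (simple_root ?a)) > 0" "height (?g0 (simple_root ?b)) > 0" by auto
        have "hecke (e0 + m) (\<lambda>v. ?g0 (arefl ?a ?b m v)) (h0 * altw (gx ?a) (gx ?b) m)"
        proof (rule hecke_ups[OF g0 ab(1,2)])
          fix s assume "s < m"
          then show "height (?g0 (arefl ?a ?b s (simple_root (if even s then ?a else ?b)))) > 0"
            using height_arefl_sign[OF hecke_grp[OF g0] ab(1-3), of s 1] pos0 ab(4) by simp
        qed
        moreover have "?g0 (arefl ?a ?b m w) = g (reflect j w)" for w
        proof -
          have "arefl ?a ?b m w = chain k j m w"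
            unfolding arefl_conv_chain by (simp split: if_splits)
          moreover have "arefl k j (M k j) (chain k j m w) = reflect j (arefl k j m (chain k j m w))"
            using arefl_braid[OF kj] by (simp add: m)
          ultimately show ?thesis by (simp only: arefl_chain[OF kj(1,2)])
        qed
        ultimately have "hecke e (\<lambda>v. g (reflect j v)) (h0 * altw (gx ?a) (gx ?b) m)"
          by (simp only: h0(2))
        then show ?thesis using h step by blast
      qed
    qed
  qed
qed

lemma hecke_unique: "hecke d g h \<Longrightarrow> hecke d' g h' \<Longrightarrow> h \<approx>\<^sub>J h'"
proof (induction d g h arbitrary: d' h' rule: hecke.induct)
  case one
  from one show ?case
  proof cases
    case (step d g h k)
    have g: "(\<lambda>v. v) = (\<lambda>v. g (reflect k v))" by fact
    have "g (simple_root k) = g (reflect k (reflect k (simple_root k)))"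
      using step by simp
    also have "\<dots> = reflect k (simple_root k)"
      by (rule fun_cong[OF g, symmetric])
    also have "\<dots> = (\<lambda>i. - simple_root k i)" using step by (simp only: reflect_simple_self)
    finally have "g (simple_root k) = (\<lambda>i. - simple_root k i)" .
    then have "height (g (simple_root k)) = - height (simple_root k)" by (simp add: height_def sum_negf)
    then show ?thesis using step by simp
  qed simp
next
  case (step d g h k)
  have "height (g (reflect k (simple_root k))) < 0"
  proof -
    have "g (\<lambda>i. - simple_root k i) = (\<lambda>i. - g (simple_root k) i)"
      using grp_linear[OF hecke_grp[OF step(1)], of "\<lambda>i. 0" "- 1" "simple_root k"]
        grp_linear[OF hecke_grp[OF step(1)], of "\<lambda>i. 0" "- 1" "\<lambda>i. 0"]
      by (simp add: fun_eq_iff)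
    then show ?thesis using step(2,3) by (simp add: reflect_simple_self height_def sum_negf)
  qed
  from hecke_descends_all[of d', unfolded hecke_descends_def, rule_format, OF step.prems step(2) this]
  obtain e h1 where h1: "hecke e (\<lambda>v. g (reflect k (reflect k v))) h1" "h' \<approx>\<^sub>J h1 * gx k"
    by (elim exE conjE)
  have "h \<approx>\<^sub>J h1" using step.IH[of e h1] h1(1) step(2) by simp
  then have "h * gx k \<approx>\<^sub>J h1 * gx k" by (rule eqv_right)
  then show ?case using eqv_sym[OF h1(2)] by (rule eqv_trans)
qed

text \<open>The algebra is spanned by the Hecke words and by the words that pass through some \<open>ge i\<close> with a Hecke word to
  the right of it; this span \<open>R\<close> contains \<open>1\<close> and is stable under right multiplication by the letters.\<close>

lemma finite_dimensional:
  assumes "\<And>i. i < n \<Longrightarrow> \<exists>S. finite S \<and> (\<forall>a\<in>alg. a * ge i \<in> spn S)"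
  shows "\<exists>S. finite S \<and> alg \<subseteq> spn S"
proof -
  define H where "H = {h. \<exists>d g. hecke d g h}"
  define R where "R = H \<union> {b * ge i * h | b i h. b \<in> alg \<and> i < n \<and> h \<in> H}"
  have one: "1 \<in> H" unfolding H_def using hecke.one by blast
  have HR: "h \<in> H \<Longrightarrow> h \<in> spn R" for h unfolding R_def by (rule spn.base) simp
  have eR: "b * ge i * h \<in> spn R" if "b \<in> alg" "i < n" "h \<in> H" for b i h
    unfolding R_def using that by (intro spn.base) blast
  have eR1: "b * ge i \<in> spn R" if "b \<in> alg" "i < n" for b i
    using eR[OF that one] by simp
  have Halg: "h \<in> H \<Longrightarrow> h \<in> alg" for h unfolding H_def using hecke_alg by blast
  \<comment> \<open>A Hecke word times a letter is a Hecke word, or ends in a square that \<open>x_square\<close> resolves.\<close>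
  have Hx: "h * gx k \<in> spn (H \<union> {h1 * ge k | h1. h1 \<in> H})" if hH: "h \<in> H" and "k < n" for h k
  proof -
    obtain d g where hg: "hecke d g h" using hH unfolding H_def by blast
    have "height (g (simple_root k)) \<noteq> 0" by (rule height_root_nonzero[OF hecke_grp[OF hg] that(2)])
    then consider "height (g (simple_root k)) > 0" | "height (g (simple_root k)) < 0" by linarith
    then show ?thesis
    proof cases
      case 1
      then have "h * gx k \<in> H" unfolding H_def using hecke.step[OF hg that(2)] by blast
      then show ?thesis by (intro spn.base) simp
    next
      case 2
      from hecke_descends_all[of d, unfolded hecke_descends_def, rule_format, OF hg \<open>k < n\<close> 2]
      obtain e h1 where h1: "hecke e (\<lambda>v. g (reflect k v)) h1" "h \<approx>\<^sub>J h1 * gx k"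
        by (elim exE conjE)
      have h1H: "h1 \<in> H" using h1(1) unfolding H_def by blast
      have "h * gx k \<approx>\<^sub>J h1 * (gx k * gx k)"
        using eqv_right[OF h1(2), of "gx k"] by (simp add: mult.assoc)
      also have "\<dots> \<approx>\<^sub>J h1 * (1 - sc (eta k) * gx k + sc (eta k / l k) * ge k)"
        by (rule eqv_left[OF x_square[OF that(2)]])
      also have "\<dots> = h1 - sc (eta k) * (h1 * gx k) + sc (eta k / l k) * (h1 * ge k)"
        by (simp only: distrib_left right_diff_distrib sc_left_commute[of h1] mult_1_right)
      finally show ?thesis
      proof (rule spn_eqv)
        let ?S = "H \<union> {h1 * ge k | h1. h1 \<in> H}"
        have "h1 \<in> spn ?S" "h1 * ge k \<in> spn ?S" using h1H by (auto intro: spn.base)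
        moreover have "h1 * gx k \<in> spn ?S"
          using spn_eqv[OF eqv_sym[OF h1(2)], of ?S] that(1) by (auto intro: spn.base)
        ultimately show "h1 - sc (eta k) * (h1 * gx k) + sc (eta k / l k) * (h1 * ge k) \<in> spn ?S"
          by (intro spn.add spn_diff spn.scale)
      qed
    qed
  qed
  have Rx: "r * gx k \<in> spn R" if "r \<in> R" "k < n" for r k
    using that(1) unfolding R_def
  proof (elim UnE CollectE exE conjE)
    assume r: "r \<in> H"
    show "r * gx k \<in> spn (H \<union> {b * ge i * h | b i h. b \<in> alg \<and> i < n \<and> h \<in> H})"
      unfolding R_def[symmetric]
      by (rule spn_subset[OF _ Hx[OF r that(2)]]) (use HR eR1 Halg that(2) in auto)
  next
    fix b i h assume b: "r = b * ge i * h" "b \<in> alg" "i < n" "h \<in> H"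
    have "b * ge i * (h * gx k) \<in> spn R"
    proof (rule spn_left[OF Hx[OF b(4) that(2)]])
      fix s assume "s \<in> H \<union> {h1 * ge k | h1. h1 \<in> H}"
      then consider "s \<in> H" | h1 where "h1 \<in> H" "s = h1 * ge k" by auto
      then show "b * ge i * s \<in> spn R"
      proof cases
        case 1
        then show ?thesis by (rule eR[OF b(2,3)])
      next
        case 2
        have "b * ge i * h1 * ge k \<in> spn R"
          by (rule eR1) (use 2 b that(2) Halg in \<open>auto intro: alg.intros\<close>)
        then show ?thesis by (simp add: 2 mult.assoc)
      qed
    qed
    then show "r * gx k \<in> spn (H \<union> {b * ge i * h | b i h. b \<in> alg \<and> i < n \<and> h \<in> H})"
      unfolding R_def[symmetric] b(1) by (simp add: mult.assoc)
  qed
  have Re: "r * ge k \<in> spn R" if "r \<in> R" "k < n" for r k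
    using that unfolding R_def by (intro eR1[unfolded R_def]) (auto intro: Halg alg.intros)
  have right: "r * a \<in> spn R" if "a \<in> alg" "r \<in> spn R" for r a
    using that
  proof (induction a arbitrary: r)
    case (x k)
    then show ?case using Rx by (auto intro: spn_right)
  next
    case (e k)
    then show ?case using Re by (auto intro: spn_right)
  next
    case (y k)
    have "r * gy k \<approx>\<^sub>J r * (gx k + sc (eta k) - sc (eta k) * ge k)"
      by (rule eqv_left[OF y_expand[OF y(1)]])
    also have "\<dots> = r * gx k + sc (eta k) * r - sc (eta k) * (r * ge k)"
      by (simp only: distrib_left right_diff_distrib sc_left_commute[of r] sc_central[of _ r])
    finally show ?case
    proof (rule spn_eqv)
      have "r * gx k \<in> spn R" "r * ge k \<in> spn R" using y Rx Re by (auto intro: spn_right)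
      then show "r * gx k + sc (eta k) * r - sc (eta k) * (r * ge k) \<in> spn R"
        using y(2) by (intro spn.add spn_diff spn.scale)
    qed
  next
    case (scale u c)
    have "r * (sc c * u) = sc c * (r * u)" by (rule sc_left_commute)
    then show ?case using scale by (simp add: spn.scale)
  next
    case (mult u w)
    then show ?case by (simp flip: mult.assoc)
  qed (auto intro: spn.intros left_J simp: distrib_left)
  have algR: "a \<in> spn R" if "a \<in> alg" for a
    using right[OF that HR[OF one]] by simp
  \<comment> \<open>By \<open>hecke_unique\<close> one representative for each group element is enough.\<close>
  define rep where "rep g = (SOME h. \<exists>d. hecke d g h)" for g
  define H0 where "H0 = rep ` grp"
  have H0: "\<exists>h0\<in>H0. h \<approx>\<^sub>J h0" if hH: "h \<in> H" for h
  proof -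
    obtain d g where hg: "hecke d g h" using hH unfolding H_def by blast
    then have "\<exists>d. hecke d g (rep g)" unfolding rep_def by (intro someI[of "\<lambda>h. \<exists>d. hecke d g h"]) blast
    then show ?thesis using hecke_unique[OF hg] hecke_grp[OF hg] by (auto simp: H0_def)
  qed
  obtain S where S: "\<And>i. i < n \<Longrightarrow> finite (S i)" "\<And>i a. i < n \<Longrightarrow> a \<in> alg \<Longrightarrow> a * ge i \<in> spn (S i)"
    using assms by metis
  define Z where "Z = H0 \<union> (\<Union>i<n. (\<lambda>(s, h). s * h) ` (S i \<times> H0))"
  have "finite Z" unfolding Z_def H0_def using S(1) finite_grp by auto
  moreover have "r \<in> spn Z" if "r \<in> R" for r
    using that unfolding R_def
  proof (elim UnE CollectE exE conjE)
    assume "r \<in> H"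
    then obtain h0 where "h0 \<in> H0" "r \<approx>\<^sub>J h0" using H0 by blast
    then show ?thesis by (intro spn_eqv[of r h0] spn.base) (auto simp: Z_def)
  next
    fix b i h assume b: "r = b * ge i * h" "b \<in> alg" "i < n" "h \<in> H"
    then obtain h0 where h0: "h0 \<in> H0" "h \<approx>\<^sub>J h0" using H0 by blast
    have "b * ge i * h0 \<in> spn Z"
    proof (rule spn_right[OF S(2)[OF b(3,2)]])
      fix s assume "s \<in> S i"
      then show "s * h0 \<in> spn Z" using h0(1) b(3) by (intro spn.base) (force simp: Z_def)
    qed
    then show ?thesis unfolding b(1) by (rule spn_eqv[OF eqv_left[OF h0(2)]])
  qed
  then have "alg \<subseteq> spn Z" using algR by (auto intro: spn_subset)
  ultimately show ?thesis by blast
qed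

end


section \<open>Sandwich relations in rank two\<close>

text \<open>The rank-two relations, in the form in which they are used: for the sandwich relation only that the result is
  proportional to \<open>ge i\<close>, and for commuting generators the value \<open>0\<close> and a nonzero \<open>delta\<close>.\<close>

locale bmw_algebra = bmw_relations n M J sc gx gy ge q l
  for n :: nat and M :: "nat \<Rightarrow> nat \<Rightarrow> nat" and J :: "'r::ring_1 set" and sc
    and gx gy ge :: "nat \<Rightarrow> 'r" and q l :: "nat \<Rightarrow> complex" +
  assumes sandwich: "i < n \<Longrightarrow> j < n \<Longrightarrow> i \<noteq> j \<Longrightarrow> set ws \<subseteq> {gx i, gx j, ge i, ge j} \<Longrightarrow>
      ge i * prod_list ws * ge i \<in> spn {ge i}"
    and even_zero: "i < n \<Longrightarrow> j < n \<Longrightarrow> i \<noteq> j \<Longrightarrow> even (M i j) \<Longrightarrow> M i j > 2 \<Longrightarrow>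
      set ws \<subseteq> {gx i, gx j, ge i, ge j} \<Longrightarrow> ge i * prod_list ws * ge j \<in> J"
    and commuting_zero: "i < n \<Longrightarrow> j < n \<Longrightarrow> M i j = 2 \<Longrightarrow> ge i * ge j * ge i \<in> J"
    and commuting_delta: "i < n \<Longrightarrow> j < n \<Longrightarrow> M i j = 2 \<Longrightarrow> delta i \<noteq> 0"
begin

text \<open>The subalgebra generated by the letters of two indices, modulo \<open>J\<close>.\<close>

definition dihedral :: "nat \<Rightarrow> nat \<Rightarrow> 'r set" where
  "dihedral i j = spn (prod_list ` lists {gx i, gx j, ge i, ge j})"

lemma dihedral_sym: "dihedral i j = dihedral j i"
proof -
  have "{gx i, gx j, ge i, ge j} = {gx j, gx i, ge j, ge i}" by blast
  then show ?thesis unfolding dihedral_def by simp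
qed

lemma dihedral_gen: "z \<in> {gx i, gx j, ge i, ge j} \<Longrightarrow> z \<in> dihedral i j"
  unfolding dihedral_def by (rule spn.base, rule image_eqI[of _ _ "[z]"]) auto

lemma dihedral_one: "1 \<in> dihedral i j"
  unfolding dihedral_def by (rule spn.base, rule image_eqI[of _ _ "[]"]) auto

lemma dihedral_mult:
  assumes "u \<in> dihedral i j" "w \<in> dihedral i j"
  shows "u * w \<in> dihedral i j"
  unfolding dihedral_def
proof (rule spn_right[OF assms(1)[unfolded dihedral_def]])
  fix s assume "s \<in> prod_list ` lists {gx i, gx j, ge i, ge j}"
  then obtain a where a: "a \<in> lists {gx i, gx j, ge i, ge j}" "s = prod_list a" by auto
  show "s * w \<in> spn (prod_list ` lists {gx i, gx j, ge i, ge j})"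
  proof (rule spn_left[OF assms(2)[unfolded dihedral_def]])
    fix t assume "t \<in> prod_list ` lists {gx i, gx j, ge i, ge j}"
    then obtain b where b: "b \<in> lists {gx i, gx j, ge i, ge j}" "t = prod_list b" by auto
    then show "s * t \<in> spn (prod_list ` lists {gx i, gx j, ge i, ge j})"
      using a by (intro spn.base image_eqI[of _ _ "a @ b"]) auto
  qed
qed

lemma dihedral_y:
  assumes "i < n" "j < n"
  shows "gy i \<in> dihedral i j" "gy j \<in> dihedral i j"
proof -
  have *: "gy t \<in> dihedral i j" if "t < n" "gx t \<in> dihedral i j" "ge t \<in> dihedral i j" for t
  proof -
    have "sc (eta t) * 1 \<in> dihedral i j" using dihedral_one unfolding dihedral_def by (rule spn.scale)
    then have "gx t + sc (eta t) - sc (eta t) * ge t \<in> dihedral i j"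
      using that(2,3) unfolding dihedral_def by (intro spn_diff spn.add spn.scale) auto
    then show ?thesis using spn_eqv[OF y_expand[OF that(1)]] unfolding dihedral_def by blast
  qed
  show "gy i \<in> dihedral i j" by (rule *[OF assms(1)]) (simp_all add: dihedral_gen)
  show "gy j \<in> dihedral i j" by (rule *[OF assms(2)]) (simp_all add: dihedral_gen)
qed

lemma dihedral_altw: "x \<in> dihedral i j \<Longrightarrow> y \<in> dihedral i j \<Longrightarrow> altw x y r \<in> dihedral i j"
  by (induction r arbitrary: x y) (auto intro: dihedral_one dihedral_mult)

lemma sandwich_dihedral:
  assumes "i < n" "j < n" "i \<noteq> j" "w \<in> dihedral i j"
  shows "ge i * w * ge i \<in> spn {ge i}"
proof -
  have "ge i * w \<in> spn ((*) (ge i) ` prod_list ` lists {gx i, gx j, ge i, ge j})"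
    using assms(4) unfolding dihedral_def by (rule spn_left) (auto intro: spn.base)
  then show ?thesis
    by (rule spn_right) (use sandwich[OF assms(1-3)] in \<open>auto simp: lists_eq_set\<close>)
qed

text \<open>Relation \<open>even_zero\<close> is about words; it extends to the span, and a span of \<open>0\<close> is \<open>J\<close>.\<close>

lemma even_dihedral:
  assumes "i < n" "j < n" "i \<noteq> j" "even (M i j)" "M i j > 2" "w \<in> dihedral i j"
  shows "ge i * w * ge j \<in> J"
proof -
  have "ge i * w \<in> spn ((*) (ge i) ` prod_list ` lists {gx i, gx j, ge i, ge j})"
    using assms(6) unfolding dihedral_def by (rule spn_left) (auto intro: spn.base)
  then have "ge i * w * ge j \<in> spn {}"
    by (rule spn_right) (use even_zero[OF assms(1-5)] in \<open>auto simp: lists_eq_set intro: spn.ideal\<close>)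
  then have *: "ge i * w * ge j \<in> spn {0}" by (rule spn_mono[rotated]) simp
  then obtain c where "ge i * w * ge j \<approx>\<^sub>J sc c * 0" unfolding spn_singleton by blast
  then show ?thesis by (simp add: eqv_def)
qed

definition ribbon :: "nat \<Rightarrow> nat \<Rightarrow> 'r" where
  "ribbon j k = altw (gx k) (gx j) (M j k - 1)"

text \<open>The inverse word.  Its first letter is the last letter of the ribbon, whence the dependence on parity.\<close>

definition ribbon_inv :: "nat \<Rightarrow> nat \<Rightarrow> 'r" where
  "ribbon_inv j k = altw (gy (if odd (M j k - 1) then k else j)) (gy (if odd (M j k - 1) then j else k)) (M j k - 1)"

lemma ribbon_inverse:
  assumes "j < n" "k < n"
  shows "ribbon j k * ribbon_inv j k \<approx>\<^sub>J 1" "ribbon_inv j k * ribbon j k \<approx>\<^sub>J 1"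
proof -
  have "1 \<approx>\<^sub>J ribbon j k * ribbon_inv j k"
    using altw_cancel_right[OF assms(2,1), of 0 "M j k - 1"]
    unfolding ribbon_def ribbon_inv_def by simp
  then show "ribbon j k * ribbon_inv j k \<approx>\<^sub>J 1" by (rule eqv_sym)
  have "1 \<approx>\<^sub>J ribbon_inv j k * ribbon j k"
  proof (cases "even (M j k - 1)")
    case True
    then show ?thesis
      using altw_cancel_left[OF assms(2,1), of 0 "M j k - 1"]
      unfolding ribbon_def ribbon_inv_def by simp
  next
    case False
    then show ?thesis
      using altw_cancel_left[OF assms, of 0 "M j k - 1"]
      unfolding ribbon_def ribbon_inv_def by simp
  qed
  then show "ribbon_inv j k * ribbon j k \<approx>\<^sub>J 1" by (rule eqv_sym)
qed

lemma ribbon_dihedral: "ribbon j k \<in> dihedral j k"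
  unfolding ribbon_def by (intro dihedral_altw dihedral_gen) auto

lemma ribbon_inv_dihedral: "j < n \<Longrightarrow> k < n \<Longrightarrow> ribbon_inv j k \<in> dihedral j k"
  unfolding ribbon_inv_def using dihedral_y[of j k] by (intro dihedral_altw) auto

lemma ribbon_odd:
  assumes "j < n" "k < n" "j \<noteq> k" "odd (M j k)"
  shows "ge j * ribbon j k \<approx>\<^sub>J ribbon j k * ge k"
  using ribbon_e[OF assms(1-3)] assms(4) by (simp add: ribbon_def)

lemma ribbon_even:
  assumes "j < n" "k < n" "j \<noteq> k" "even (M j k)"
  shows "ge j * ribbon j k \<approx>\<^sub>J ribbon j k * ge j"
  using ribbon_e[OF assms(1-3)] assms(4) by (simp add: ribbon_def)

text \<open>A ribbon turns \<open>E\<^sub>j w E\<^sub>k\<close> into a sandwich with \<open>E\<^sub>k\<close> on both sides.\<close>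

lemma odd_dihedral:
  assumes "j < n" "k < n" "j \<noteq> k" "odd (M j k)" "w \<in> dihedral j k"
  shows "ge j * w * ge k \<in> spn {ribbon j k * ge k}"
proof -
  let ?g = "ribbon j k" and ?h = "ribbon_inv j k"
  have "ge j * w * ge k = ge j * 1 * (w * ge k)" by (simp add: mult.assoc)
  also have "\<dots> \<approx>\<^sub>J ge j * (?g * ?h) * (w * ge k)"
    by (intro eqv_right eqv_left eqv_sym[OF ribbon_inverse(1)] assms)
  also have "\<dots> = ge j * ?g * (?h * w * ge k)" by (simp only: mult.assoc)
  also have "\<dots> \<approx>\<^sub>J ?g * ge k * (?h * w * ge k)"
    by (rule eqv_right[OF ribbon_odd[OF assms(1-4)]])
  also have "\<dots> = ?g * (ge k * (?h * w) * ge k)" by (simp only: mult.assoc)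
  finally have e: "ge j * w * ge k \<approx>\<^sub>J ?g * (ge k * (?h * w) * ge k)" .
  have "ge k * (?h * w) * ge k \<in> spn {ge k}"
    using assms by (intro sandwich_dihedral[of k j])
      (auto simp: dihedral_sym[of k j] intro: dihedral_mult ribbon_inv_dihedral)
  then have "?g * (ge k * (?h * w) * ge k) \<in> spn {?g * ge k}"
    by (rule spn_left) (auto intro: spn.base)
  then show ?thesis by (rule spn_eqv[OF e])
qed

lemma delta_odd: "j < n \<Longrightarrow> k < n \<Longrightarrow> odd (M j k) \<Longrightarrow> delta j = delta k"
  using odd_par[of j k] by (simp add: delta_def eta_def)

text \<open>For \<open>m = 2\<close> the two elements commute, so \<open>\<delta>\<^sub>i E\<^sub>j E\<^sub>i = E\<^sub>j E\<^sub>i E\<^sub>i = E\<^sub>i E\<^sub>j E\<^sub>i = 0\<close>.\<close>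

lemma commuting_ee:
  assumes "i < n" "j < n" "M i j = 2"
  shows "ge j * ge i \<in> J"
proof -
  have ij: "i \<noteq> j" using assms M_diag[of i] by auto
  have gx: "ge i * gx j \<approx>\<^sub>J gx j * ge i"
    using ribbon_e[OF assms(1,2) ij] by (simp add: assms(3))
  have gxx: "ge i * (gx j * gx j) \<approx>\<^sub>J gx j * gx j * ge i"
  proof -
    have "ge i * (gx j * gx j) \<approx>\<^sub>J gx j * ge i * gx j"
      unfolding mult.assoc[symmetric] by (rule eqv_right[OF gx])
    also have "\<dots> = gx j * (ge i * gx j)" by (rule mult.assoc)
    also have "\<dots> \<approx>\<^sub>J gx j * (gx j * ge i)" by (rule eqv_left[OF gx])
    finally show ?thesis by (simp only: mult.assoc)
  qed
  let ?a = "l j / eta j"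
  have "ge i * ge j \<approx>\<^sub>J ge i * (sc ?a * (gx j * gx j) + sc (l j) * gx j - sc ?a)"
    by (rule eqv_left[OF e_expand[OF assms(2)]])
  also have "\<dots> = sc ?a * (ge i * (gx j * gx j)) + sc (l j) * (ge i * gx j) - sc ?a * ge i"
    by (simp only: distrib_left right_diff_distrib sc_left_commute[of "ge i"] sc_central[of _ "ge i"])
  also have "\<dots> \<approx>\<^sub>J sc ?a * (gx j * gx j * ge i) + sc (l j) * (gx j * ge i) - sc ?a * ge i"
    by (intro eqv_add eqv_diff eqv_left gx gxx eqv_refl)
  also have "\<dots> = (sc ?a * (gx j * gx j) + sc (l j) * gx j - sc ?a) * ge i"
    by (simp only: distrib_right left_diff_distrib mult.assoc)
  also have "\<dots> \<approx>\<^sub>J ge j * ge i" by (rule eqv_right[OF eqv_sym[OF e_expand[OF assms(2)]]])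
  finally have comm: "ge i * ge j \<approx>\<^sub>J ge j * ge i" .
  have "sc (delta i) * (ge j * ge i) = ge j * (sc (delta i) * ge i)"
    by (rule sc_left_commute[symmetric])
  also have "\<dots> \<approx>\<^sub>J ge j * (ge i * ge i)" by (rule eqv_left[OF eqv_sym[OF ee[OF assms(1)]]])
  also have "\<dots> = ge j * ge i * ge i" by (rule mult.assoc[symmetric])
  also have "\<dots> \<approx>\<^sub>J ge i * ge j * ge i" by (rule eqv_right[OF eqv_sym[OF comm]])
  finally have "sc (delta i) * (ge j * ge i) \<in> J"
    using commuting_zero[OF assms] add_J unfolding eqv_def by fastforce
  then have "sc (1 / delta i) * (sc (delta i) * (ge j * ge i)) \<in> J" by (rule left_J)
  then show ?thesis
    using commuting_delta[OF assms] by (simp add: sc_collapse sc_one)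
qed


section \<open>Transport along the odd edges\<close>

text \<open>Invertible elements \<open>P t\<close>, with inverses \<open>Q t\<close>, that identify all \<open>E\<^sub>t\<close> in a component of the odd graph with one
  element \<open>Q t E\<^sub>t P t\<close>, compatibly with the ribbons up to scalars.  They are built by adding one leaf at a time: a new
  leaf is reached by a single edge, so the only loop to check goes along this edge and back, where the sandwich relation
  applies.\<close>

lemma tree_transport:
  assumes "S \<subseteq> {..<n}" and delta: "\<And>i. i < n \<Longrightarrow> delta i \<noteq> 0"
  shows "\<exists>P Q. (\<forall>t\<in>S. P t * Q t \<approx>\<^sub>J 1 \<and> Q t * P t \<approx>\<^sub>J 1) \<and>
    (\<forall>j\<in>S. \<forall>k\<in>S. j \<noteq> k \<longrightarrow> odd (M j k) \<longrightarrow>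
      Q j * ge j * P j \<approx>\<^sub>J Q k * ge k * P k \<and>
      Q j * ribbon j k * P k * (Q k * ge k * P k) \<in> spn {Q k * ge k * P k})"
  using assms(1)
proof (induction "card S" arbitrary: S)
  case 0
  then have "S = {}" using finite_subset[OF 0(2)] by simp
  then show ?case by simp
next
  case (Suc c)
  then have "S \<noteq> {}" by auto
  from exists_leaf[OF Suc.prems this]
  \<comment> \<open>The leaf \<open>a\<close> is added last.\<close>
  obtain a where a: "a \<in> S" and leaf0: "\<forall>s\<in>S. \<forall>t\<in>S. s \<noteq> a \<and> t \<noteq> a \<and> M a s \<ge> 3 \<and> M a t \<ge> 3 \<longrightarrow> s = t"
    by (elim bexE)
  have leaf: "s = t" if "s \<in> S" "t \<in> S" "s \<noteq> a" "t \<noteq> a" "M a s \<ge> 3" "M a t \<ge> 3" for s t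
    using leaf0 that by blast
  have fin: "finite S" using Suc.prems finite_subset by blast
  define S' where "S' = S - {a}"
  have S: "S = insert a S'" "a \<notin> S'" "S' \<subseteq> {..<n}" "card S' = c" "a < n"
    using a Suc fin by (auto simp: S'_def)
  obtain P Q where inv: "\<And>t. t \<in> S' \<Longrightarrow> P t * Q t \<approx>\<^sub>J 1" "\<And>t. t \<in> S' \<Longrightarrow> Q t * P t \<approx>\<^sub>J 1"
    and tr: "\<And>j k. j \<in> S' \<Longrightarrow> k \<in> S' \<Longrightarrow> j \<noteq> k \<Longrightarrow> odd (M j k) \<Longrightarrow>
      Q j * ge j * P j \<approx>\<^sub>J Q k * ge k * P k \<and>
      Q j * ribbon j k * P k * (Q k * ge k * P k) \<in> spn {Q k * ge k * P k}"
    using Suc.hyps(1)[of S'] S by metis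
  have sym: "M t a = M a t" if "t \<in> S'" for t
    using M_sym[OF S(5), of t] S(3) that by auto
  have three: "M a t \<ge> 3" if "t \<in> S'" "odd (M a t)" for t
  proof -
    have "M a t \<ge> 2" using that S by (intro M_ge2) auto
    then show ?thesis using that(2) by (cases "M a t = 2") auto
  qed
  show ?case
  proof (cases "\<exists>t\<in>S'. odd (M a t)")
    case False
    then have no: "even (M a t) \<and> even (M t a)" if "t \<in> S'" for t
      using that sym by auto
    show ?thesis
      using inv tr no S(1,2) by (intro exI[of _ "P(a := 1)"] exI[of _ "Q(a := 1)"]) auto
  next
    case True
    then obtain t where t: "t \<in> S'" "odd (M a t)" by blast
    have ta: "t < n" "t \<noteq> a" "M t a = M a t" using t S sym by auto
    \<comment> \<open>An odd bond has label at least \<open>3\<close>, so \<open>a\<close> has at most one odd neighbour.\<close>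
    have only: "s = t" if "s \<in> S'" "odd (M a s) \<or> odd (M s a)" for s
    proof -
      have "odd (M a s)" using that sym by auto
      then show ?thesis using leaf[of s t] three that t S by auto
    qed
    define pa where "pa = ribbon a t * P t"
    define qa where "qa = Q t * ribbon_inv a t"
    define et where "et = Q t * ge t * P t"
    note rinv = ribbon_inverse[OF S(5) ta(1)]
    have inva: "pa * qa \<approx>\<^sub>J 1" "qa * pa \<approx>\<^sub>J 1"
    proof -
      have "pa * qa = ribbon a t * (P t * Q t) * ribbon_inv a t" by (simp add: pa_def qa_def mult.assoc)
      also have "\<dots> \<approx>\<^sub>J ribbon a t * 1 * ribbon_inv a t" by (intro eqv_right eqv_left inv t)
      also have "\<dots> \<approx>\<^sub>J 1" using rinv by simp
      finally show "pa * qa \<approx>\<^sub>J 1" .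
      have "qa * pa = Q t * (ribbon_inv a t * ribbon a t) * P t" by (simp add: pa_def qa_def mult.assoc)
      also have "\<dots> \<approx>\<^sub>J Q t * 1 * P t" by (intro eqv_right eqv_left rinv)
      also have "\<dots> \<approx>\<^sub>J 1" using inv t by simp
      finally show "qa * pa \<approx>\<^sub>J 1" .
    qed
    have ea: "qa * ge a * pa \<approx>\<^sub>J et"
    proof -
      have "qa * ge a * pa = Q t * ribbon_inv a t * (ge a * ribbon a t) * P t"
        by (simp add: pa_def qa_def mult.assoc)
      also have "\<dots> \<approx>\<^sub>J Q t * ribbon_inv a t * (ribbon a t * ge t) * P t"
        by (intro eqv_right eqv_left ribbon_odd S(5) ta(1) not_sym[OF ta(2)] t(2))
      also have "\<dots> = Q t * (ribbon_inv a t * ribbon a t) * (ge t * P t)" by (simp only: mult.assoc)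
      also have "\<dots> \<approx>\<^sub>J Q t * 1 * (ge t * P t)" by (intro eqv_right eqv_left rinv)
      finally show ?thesis by (simp add: et_def mult.assoc)
    qed
    have r1: "qa * ribbon a t * P t * et \<in> spn {et}"
    proof -
      have "qa * ribbon a t * P t * et = qa * pa * et" by (simp add: pa_def mult.assoc)
      also have "\<dots> \<approx>\<^sub>J 1 * et" by (rule eqv_right[OF inva(2)])
      finally show ?thesis by (rule spn_eqv) (simp add: spn.base)
    qed
    \<comment> \<open>The loop along the edge and back commutes with \<open>E\<^sub>t\<close>; the sandwich relation bounds it after division by \<open>delta t\<close>.\<close>
    have loop: "ribbon t a * ribbon a t * ge t \<in> spn {ge t}"
    proof -
      let ?g = "ribbon t a * ribbon a t"
      have g: "?g \<in> dihedral t a"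
        by (intro dihedral_mult ribbon_dihedral) (simp add: dihedral_sym[of t a] ribbon_dihedral)
      have "ge t * ?g * ge t = ge t * ribbon t a * (ribbon a t * ge t)" by (simp only: mult.assoc)
      also have "\<dots> \<approx>\<^sub>J ribbon t a * ge a * (ribbon a t * ge t)"
        using ta t S(5) by (intro eqv_right ribbon_odd) auto
      also have "\<dots> = ribbon t a * (ge a * ribbon a t) * ge t" by (simp only: mult.assoc)
      also have "\<dots> \<approx>\<^sub>J ribbon t a * (ribbon a t * ge t) * ge t"
        using ta t S(5) by (intro eqv_right eqv_left ribbon_odd) auto
      also have "\<dots> = ?g * (ge t * ge t)" by (simp only: mult.assoc)
      also have "\<dots> \<approx>\<^sub>J ?g * (sc (delta t) * ge t)" by (rule eqv_left[OF ee[OF ta(1)]])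
      also have "\<dots> = sc (delta t) * (?g * ge t)" by (rule sc_left_commute)
      finally have "sc (delta t) * (?g * ge t) \<in> spn {ge t}"
        by (rule spn_eqv[OF eqv_sym]) (rule sandwich_dihedral[OF ta(1) S(5) ta(2) g])
      then have "sc (1 / delta t) * (sc (delta t) * (?g * ge t)) \<in> spn {ge t}" by (rule spn.scale)
      then show ?thesis using delta[OF ta(1)] by (simp add: sc_collapse sc_one)
    qed
    have r2: "Q t * ribbon t a * pa * et \<in> spn {et}"
    proof -
      have "Q t * ribbon t a * pa * et = Q t * ribbon t a * ribbon a t * (P t * Q t) * (ge t * P t)"
        by (simp add: pa_def et_def mult.assoc)
      also have "\<dots> \<approx>\<^sub>J Q t * ribbon t a * ribbon a t * 1 * (ge t * P t)"
        by (intro eqv_right eqv_left inv t)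
      also have "\<dots> = Q t * (ribbon t a * ribbon a t * ge t) * P t" by (simp add: mult.assoc)
      finally show ?thesis
      proof (rule spn_eqv)
        have "Q t * (ribbon t a * ribbon a t * ge t) \<in> spn {Q t * ge t}"
          using loop by (rule spn_left) (auto intro: spn.base)
        then show "Q t * (ribbon t a * ribbon a t * ge t) * P t \<in> spn {et}"
          by (rule spn_right) (auto intro: spn.base simp: et_def)
      qed
    qed
    define ea' where "ea' = qa * ge a * pa"
    have sub: "u \<in> spn {ea'}" if "u \<in> spn {et}" for u
      using that by (rule spn_subset[rotated]) (auto intro: spn_eqv[OF eqv_sym[OF ea]] spn.base simp: ea'_def)
    have sub': "Q t * ribbon t a * pa * ea' \<in> spn {ea'}"
      using eqv_left[OF ea, of "Q t * ribbon t a * pa"] sub[OF r2] unfolding ea'_def by (rule spn_eqv)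
    let ?P = "P(a := pa)" and ?Q = "Q(a := qa)"
    have "\<forall>t\<in>S. ?P t * ?Q t \<approx>\<^sub>J 1 \<and> ?Q t * ?P t \<approx>\<^sub>J 1"
      using inv inva S(1,2) by auto
    moreover have "?Q j * ge j * ?P j \<approx>\<^sub>J ?Q k * ge k * ?P k \<and>
      ?Q j * ribbon j k * ?P k * (?Q k * ge k * ?P k) \<in> spn {?Q k * ge k * ?P k}"
      if jk: "j \<in> S" "k \<in> S" "j \<noteq> k" "odd (M j k)" for j k
    proof -
      consider "j \<in> S'" "k \<in> S'" "j \<noteq> a" "k \<noteq> a" | "j = a" "k = t" | "j = t" "k = a"
        using jk only[of j] only[of k] S(1,2) by auto
      then show ?thesis
      proof cases
        case 1
        then show ?thesis using tr[of j k] jk by simp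
      next
        case 2
        then show ?thesis using ea r1 ta by (simp add: et_def)
      next
        case 3
        then show ?thesis using eqv_sym[OF ea] sub' ta by (simp add: et_def ea'_def)
      qed
    qed
    ultimately show ?thesis by blast
  qed
qed

end


section \<open>Finiteness of the left ideals\<close>

context bmw_algebra
begin

text \<open>As \<open>v j\<close> is a nonzero multiple of \<open>E\<^sub>j v j\<close>, a factor \<open>E\<^sub>j\<close> can be inserted in front of \<open>v j\<close>.  The conditions on
  the module then become sandwich relations.\<close>

lemma lk_module_from_transport:
  assumes e: "\<And>j. j < n \<Longrightarrow> \<exists>c. c \<noteq> 0 \<and> ge j * v j \<approx>\<^sub>J sc c * v j"
    and ribbon: "\<And>j k. j < n \<Longrightarrow> k < n \<Longrightarrow> j \<noteq> k \<Longrightarrow> odd (M j k) \<Longrightarrow> ribbon j k * v k \<in> spn {v j}"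
  shows "lk_module n M J sc gx gy ge q l v"
proof (rule lk_module.intro[OF bmw_relations_axioms], rule lk_module_axioms.intro)
  have ev: "ge j * v j \<in> spn {v j}" if "j < n" for j
    using e[OF that] unfolding spn_singleton by blast
  \<comment> \<open>To act on \<open>v j\<close> it suffices to act on \<open>E\<^sub>j v j\<close>.\<close>
  have via_e: "a * v j \<in> spn S" if j: "j < n" and aS: "a * (ge j * v j) \<in> spn S" for a j S
  proof -
    obtain c where c: "c \<noteq> 0" "ge j * v j \<approx>\<^sub>J sc c * v j" using e[OF j] by blast
    have "a * (ge j * v j) \<approx>\<^sub>J sc c * (a * v j)"
      using eqv_left[OF c(2), of a] by (simp add: sc_left_commute[of a])
    then have "sc c * (a * v j) \<in> spn S" using aS by (rule spn_eqv[OF eqv_sym])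
    then have "sc (1 / c) * (sc c * (a * v j)) \<in> spn S" by (rule spn.scale)
    then show ?thesis using c(1) by (simp add: sc_collapse sc_one)
  qed
  show "ge j * v j \<in> spn {v j}" if "j < n" for j by (rule ev[OF that])
  show "gx j * v j \<in> spn {v j}" if j: "j < n" for j
  proof (rule via_e[OF j])
    have "gx j * (ge j * v j) \<approx>\<^sub>J sc (inverse (l j)) * (ge j * v j)"
      using eqv_right[OF xe[OF j], of "v j"] by (simp add: mult.assoc)
    then show "gx j * (ge j * v j) \<in> spn {v j}"
      using spn.scale[OF ev[OF j]] by (rule spn_eqv)
  qed
  show "altw (gx k) (gx j) (M j k - 1) * v (if odd (M j k) then k else j) \<in> spn {v j}"
    if jk: "j < n" "k < n" "j \<noteq> k" for j k
  proof (cases "odd (M j k)")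
    case True
    then show ?thesis using ribbon[OF jk] by (simp add: ribbon_def)
  next
    case False
    have "ribbon j k * v j \<in> spn {v j}"
    proof (rule via_e[OF jk(1)])
      have "ribbon j k * (ge j * v j) = ribbon j k * ge j * v j" by (simp only: mult.assoc)
      moreover have "ribbon j k * ge j * v j \<in> spn {v j}"
      proof (rule via_e[OF jk(1)])
        have "ribbon j k * ge j * (ge j * v j) \<approx>\<^sub>J ge j * ribbon j k * (ge j * v j)"
          using eqv_right[OF eqv_sym[OF ribbon_even[OF jk]]] False by blast
        also have "\<dots> = ge j * ribbon j k * ge j * v j" by (simp only: mult.assoc)
        finally have 1: "ribbon j k * ge j * (ge j * v j) \<approx>\<^sub>J ge j * ribbon j k * ge j * v j" .
        have "ge j * ribbon j k * ge j * v j \<in> spn {ge j * v j}"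
          using sandwich_dihedral[OF jk ribbon_dihedral] by (rule spn_right) (auto intro: spn.base)
        then have "ge j * ribbon j k * ge j * v j \<in> spn {v j}"
          by (rule spn_subset[rotated]) (use ev[OF jk(1)] in auto)
        then show "ribbon j k * ge j * (ge j * v j) \<in> spn {v j}" by (rule spn_eqv[OF 1])
      qed
      ultimately show "ribbon j k * (ge j * v j) \<in> spn {v j}" by simp
    qed
    then show ?thesis using False by (simp add: ribbon_def)
  qed
  show "ge j * (altw (gx k) (gx j) d * v (if even d then k else j)) \<in> spn {v j}"
    if jk: "j < n" "k < n" "j \<noteq> k" and d: "d < M j k" for j k d
  proof -
    let ?w = "altw (gx k) (gx j) d" and ?t = "if even d then k else j"
    have w: "?w \<in> dihedral j k" by (intro dihedral_altw dihedral_gen) auto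
    have t: "?t < n" using jk by simp
    have "ge j * ?w * v ?t \<in> spn {v j}"
    proof (rule via_e[OF t])
      have eq: "ge j * ?w * (ge ?t * v ?t) = ge j * ?w * ge ?t * v ?t" by (simp only: mult.assoc)
      show "ge j * ?w * (ge ?t * v ?t) \<in> spn {v j}"
      proof (cases "even d")
        case False
        have "ge j * ?w * ge j * v j \<in> spn {ge j * v j}"
          using sandwich_dihedral[OF jk w] by (rule spn_right) (auto intro: spn.base)
        then have "ge j * ?w * ge j * v j \<in> spn {v j}"
          by (rule spn_subset[rotated]) (use ev[OF jk(1)] in auto)
        then show ?thesis using False unfolding eq by simp
      next
        case ed: True
        consider "odd (M j k)" | "even (M j k)" "M j k > 2" | "M j k = 2"
          using M_ge2[OF jk] by linarith
        then have "ge j * ?w * ge k * v k \<in> spn {v j}"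
        proof cases
          case 1
          have 2: "ge j * ?w * ge k * v k \<in> spn {ribbon j k * ge k * v k}"
            using odd_dihedral[OF jk 1 w] by (rule spn_right) (auto intro: spn.base)
          have "ribbon j k * (ge k * v k) \<in> spn {ribbon j k * v k}"
            using ev[OF jk(2)] by (rule spn_left) (auto intro: spn.base)
          then have "ribbon j k * (ge k * v k) \<in> spn {v j}"
            by (rule spn_subset[rotated]) (use ribbon[OF jk 1] in auto)
          then show ?thesis
            by (intro spn_subset[OF _ 2]) (simp add: mult.assoc)
        next
          case 2
          then have "ge j * ?w * ge k * v k \<in> J" using even_dihedral[OF jk 2 w] right_J by blast
          then show ?thesis by (rule spn.ideal)
        next
          case 3
          then have "d = 0" using ed d by (cases d) auto
          moreover have "ge j * ge k * v k \<in> J"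
            using commuting_ee[OF jk(2,1)] 3 M_sym[OF jk(1,2)] right_J by auto
          ultimately show ?thesis by (auto intro: spn.ideal)
        qed
        then show ?thesis using ed unfolding eq by simp
      qed
    qed
    then show ?thesis by (simp add: mult.assoc)
  qed
qed

text \<open>The vectors \<open>v t = P t Q i E\<^sub>i\<close> in the component of \<open>i\<close>, and \<open>0\<close> elsewhere, form a module in the sense
  of \<open>lk_module\<close>, and \<open>v i\<close> is \<open>E\<^sub>i\<close> itself.\<close>

lemma ideal_finite_generic:
  assumes delta: "\<And>i. i < n \<Longrightarrow> delta i \<noteq> 0" and i: "i < n"
  shows "\<exists>S. finite S \<and> (\<forall>a\<in>alg. a * ge i \<in> spn S)"
proof -
  have "\<exists>P Q. (\<forall>t\<in>{..<n}. P t * Q t \<approx>\<^sub>J 1 \<and> Q t * P t \<approx>\<^sub>J 1) \<and>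
    (\<forall>j\<in>{..<n}. \<forall>k\<in>{..<n}. j \<noteq> k \<longrightarrow> odd (M j k) \<longrightarrow>
      Q j * ge j * P j \<approx>\<^sub>J Q k * ge k * P k \<and>
      Q j * ribbon j k * P k * (Q k * ge k * P k) \<in> spn {Q k * ge k * P k})"
    by (rule tree_transport[OF order_refl]) (rule delta)
  then obtain P Q where inv0: "\<forall>t\<in>{..<n}. P t * Q t \<approx>\<^sub>J 1 \<and> Q t * P t \<approx>\<^sub>J 1"
    and tr0: "\<forall>j\<in>{..<n}. \<forall>k\<in>{..<n}. j \<noteq> k \<longrightarrow> odd (M j k) \<longrightarrow>
      Q j * ge j * P j \<approx>\<^sub>J Q k * ge k * P k \<and>
      Q j * ribbon j k * P k * (Q k * ge k * P k) \<in> spn {Q k * ge k * P k}"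
    by (elim exE conjE)
  have inv: "P t * Q t \<approx>\<^sub>J 1" if "t < n" for t
    using inv0 that by blast
  define et where "et t = Q t * ge t * P t" for t
  have tr: "et j \<approx>\<^sub>J et k" "Q j * ribbon j k * P k * et k \<in> spn {et k}"
    if "j < n" "k < n" "j \<noteq> k" "odd (M j k)" for j k
    using tr0 that unfolding et_def by blast+
  define odd_edge where "odd_edge = {(j, k). j < n \<and> k < n \<and> j \<noteq> k \<and> odd (M j k)}"
  define v where "v t = (if (i, t) \<in> odd_edge\<^sup>* then P t * Q i * ge i else 0)" for t
  have conn: "t < n \<and> et t \<approx>\<^sub>J et i" if "(i, t) \<in> odd_edge\<^sup>*" for t
    using that
  proof (induction rule: rtrancl_induct)
    case base
    then show ?case using i by simp
  next
    case (step t s)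
    then have ts: "t < n" "s < n" "t \<noteq> s" "odd (M t s)" by (auto simp: odd_edge_def)
    then show ?case using eqv_trans[OF eqv_sym[OF tr(1)[OF ts]]] step.IH by blast
  qed
  have etQ: "et i * Q i \<approx>\<^sub>J Q i * ge i"
  proof -
    have "et i * Q i = Q i * ge i * (P i * Q i)" by (simp add: et_def mult.assoc)
    also have "\<dots> \<approx>\<^sub>J Q i * ge i * 1" by (rule eqv_left[OF inv[OF i]])
    finally show ?thesis by simp
  qed
  have lk: "lk_module n M J sc gx gy ge q l v"
  proof (rule lk_module_from_transport)
    fix t assume t: "t < n"
    show "\<exists>c. c \<noteq> 0 \<and> ge t * v t \<approx>\<^sub>J sc c * v t"
    proof (cases "(i, t) \<in> odd_edge\<^sup>*")
      case False
      then show ?thesis by (intro exI[of _ 1]) (simp add: v_def)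
    next
      case True
      have "ge t * (P t * Q i * ge i) = 1 * ge t * P t * (Q i * ge i)" by (simp add: mult.assoc)
      also have "\<dots> \<approx>\<^sub>J (P t * Q t) * ge t * P t * (Q i * ge i)"
        by (intro eqv_right eqv_sym[OF inv[OF t]])
      also have "\<dots> = P t * et t * (Q i * ge i)" by (simp add: et_def mult.assoc)
      also have "\<dots> \<approx>\<^sub>J P t * et i * (Q i * ge i)"
        by (intro eqv_right eqv_left conn[OF True, THEN conjunct2])
      also have "\<dots> = P t * (et i * Q i) * ge i" by (simp add: mult.assoc)
      also have "\<dots> \<approx>\<^sub>J P t * (Q i * ge i) * ge i" by (intro eqv_right eqv_left etQ)
      also have "\<dots> = P t * Q i * (ge i * ge i)" by (simp add: mult.assoc)
      also have "\<dots> \<approx>\<^sub>J P t * Q i * (sc (delta i) * ge i)" by (rule eqv_left[OF ee[OF i]])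
      also have "\<dots> = sc (delta i) * (P t * Q i * ge i)" by (rule sc_left_commute)
      finally show ?thesis using True delta[OF i] by (intro exI[of _ "delta i"]) (simp add: v_def)
    qed
  next
    fix j k assume jk: "j < n" "k < n" "j \<noteq> k" "odd (M j k)"
    show "ribbon j k * v k \<in> spn {v j}"
    proof (cases "(i, k) \<in> odd_edge\<^sup>*")
      case False
      then show ?thesis by (simp add: v_def)
    next
      case True
      have "(k, j) \<in> odd_edge" using jk M_sym[of j k] by (auto simp: odd_edge_def)
      with True have ij: "(i, j) \<in> odd_edge\<^sup>*" by (rule rtrancl_into_rtrancl)
      obtain c where c: "Q j * ribbon j k * P k * et k \<approx>\<^sub>J sc c * et k"
        using tr(2)[OF jk] unfolding spn_singleton by blast
      have etki: "et k \<approx>\<^sub>J et i" using conn[OF True] by simp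
      have "ribbon j k * (P k * Q i * ge i) = 1 * ribbon j k * P k * (Q i * ge i)" by (simp add: mult.assoc)
      also have "\<dots> \<approx>\<^sub>J 1 * ribbon j k * P k * (et i * Q i)" by (rule eqv_left[OF eqv_sym[OF etQ]])
      also have "\<dots> \<approx>\<^sub>J (P j * Q j) * ribbon j k * P k * (et k * Q i)"
        by (intro eqv_mult eqv_sym[OF inv[OF jk(1)]] eqv_sym[OF etki] eqv_refl)
      also have "\<dots> = P j * (Q j * ribbon j k * P k * et k) * Q i" by (simp only: mult.assoc)
      also have "\<dots> \<approx>\<^sub>J P j * (sc c * et k) * Q i" by (intro eqv_right eqv_left c)
      also have "\<dots> \<approx>\<^sub>J P j * (sc c * et i) * Q i" by (intro eqv_right eqv_left etki)
      also have "\<dots> = P j * (sc c * (et i * Q i))" by (simp only: mult.assoc)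
      also have "\<dots> \<approx>\<^sub>J P j * (sc c * (Q i * ge i))" by (intro eqv_left etQ)
      also have "\<dots> = sc c * (P j * Q i * ge i)" by (simp only: sc_left_commute[of "P j"] mult.assoc)
      finally have "ribbon j k * v k \<approx>\<^sub>J sc c * v j" using True ij by (simp add: v_def)
      then show ?thesis unfolding spn_singleton by blast
    qed
  qed
  from lk_module.module_finite[OF lk]
  obtain S where S: "finite S" "\<forall>a\<in>alg. \<forall>t<n. a * v t \<in> spn S"
    by (elim exE conjE)
  have "a * ge i \<in> spn S" if a: "a \<in> alg" for a
  proof -
    have "v i = P i * Q i * ge i" by (simp add: v_def)
    also have "\<dots> \<approx>\<^sub>J 1 * ge i" by (rule eqv_right[OF inv[OF i]])
    finally have "v i \<approx>\<^sub>J ge i" by simp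
    then have "a * ge i \<approx>\<^sub>J a * v i" by (rule eqv_left[OF eqv_sym])
    moreover have "a * v i \<in> spn S" using S(2) a i by blast
    ultimately show ?thesis by (rule spn_eqv)
  qed
  then show ?thesis using S(1) by blast
qed

text \<open>If \<open>\<delta>\<^sub>i = 0\<close>, then \<open>i\<close> commutes with no other generator.  Two further generators \<open>j, k\<close> would commute with each
  other, have nonzero \<open>\<delta>\<close>, and hence be joined to \<open>i\<close> by even bonds of label at least \<open>4\<close>, which finite type
  excludes.\<close>

lemma rank_le_two:
  assumes "i < n" "delta i = 0"
  shows "n \<le> 2"
proof (rule ccontr)
  assume n: "\<not> n \<le> 2"
  have three: "M i j \<ge> 3" if "j < n" "j \<noteq> i" for j
    using M_ge2[OF assms(1), of j] commuting_delta[OF assms(1), of j] assms(2) that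
    by (cases "M i j = 2") auto
  have "\<exists>j k. j < n \<and> k < n \<and> i \<noteq> j \<and> i \<noteq> k \<and> j \<noteq> k"
  proof -
    have "i = 0 \<or> i = 1 \<or> i > 1" by linarith
    then show ?thesis
    proof (elim disjE)
      assume "i = 0"
      then show ?thesis using n by (intro exI[of _ 1] exI[of _ 2]) auto
    next
      assume "i = 1"
      then show ?thesis using n by (intro exI[of _ 0] exI[of _ 2]) auto
    next
      assume "i > 1"
      then show ?thesis using n by (intro exI[of _ 0] exI[of _ 1]) auto
    qed
  qed
  then obtain j k where jk: "j < n" "k < n" "i \<noteq> j" "i \<noteq> k" "j \<noteq> k" by (elim exE conjE)
  have 3: "M i j \<ge> 3" "M i k \<ge> 3" using three jk by auto
  have 2: "M j k = 2" "M k j = 2"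
    using no_triangle[OF assms(1) jk 3] M_sym[OF jk(1,2)] by simp_all
  have nz: "delta j \<noteq> 0" "delta k \<noteq> 0"
    using commuting_delta[OF jk(1,2) 2(1)] commuting_delta[OF jk(2,1) 2(2)] by auto
  have ev: "even (M i j)" "even (M i k)"
    using delta_odd[OF assms(1) jk(1)] delta_odd[OF assms(1) jk(2)] nz assms(2) by auto
  then have "M i j \<ge> 4" "M i k \<ge> 4" using 3 by presburger+
  then show False by (rule no_double_even[OF assms(1) jk])
qed

lemma ideal_finite_rank_one:
  assumes "n = 1" "i < n"
  shows "\<exists>S. finite S \<and> (\<forall>a\<in>alg. a * ge i \<in> spn S)"
proof (intro exI[of _ "{ge i}"] conjI ballI)
  fix a assume a: "a \<in> alg"
  show "a * ge i \<in> spn {ge i}"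
  proof (rule alg_stable[OF _ _ a])
    fix k s assume "k < n" "s \<in> {ge i}"
    then have "k = i" "s = ge i" using assms by auto
    then show "gx k * s \<in> spn {ge i}" "ge k * s \<in> spn {ge i}"
      using xe[OF assms(2)] ee[OF assms(2)] unfolding spn_singleton by blast+
  qed (rule spn.base, simp)
qed simp

text \<open>The alternating words of length at most \<open>m\<close>, times \<open>E\<^sub>i\<close>, span a stable subspace: a letter \<open>X\<close> extends a word,
  or meets its own square, and a letter \<open>E\<close> makes a sandwich.  Nothing is divided by \<open>\<delta>\<close>.\<close>

lemma ideal_finite_rank_two:
  assumes n: "n = 2" and M: "M 0 1 \<noteq> 2" and i: "i < n"
  shows "\<exists>S. finite S \<and> (\<forall>a\<in>alg. a * ge i \<in> spn S)"
proof -
  define m where "m = M 0 1"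
  have mm: "M a b = m" if "a < n" "b < n" "a \<noteq> b" for a b
  proof -
    have "a = 0 \<and> b = 1 \<or> a = 1 \<and> b = 0" using that n by auto
    then show ?thesis using M_sym[of 0 1] n by (auto simp: m_def)
  qed
  have m2: "m > 2" using M_ge2[of 0 1] M n by (simp add: m_def)
  define S where "S = (\<lambda>(a, b, r). altw (gx a) (gx b) r * ge i) ` {(a, b, r). a < n \<and> b < n \<and> a \<noteq> b \<and> r \<le> m}"
  have "{(a, b, r). a < n \<and> b < n \<and> a \<noteq> b \<and> r \<le> m} \<subseteq> {..<n} \<times> {..<n} \<times> {..m}" by auto
  then have fin: "finite S" unfolding S_def by (intro finite_imageI) (rule finite_subset, auto)
  have inS: "altw (gx a) (gx b) r * ge i \<in> spn S" if "a < n" "b < n" "a \<noteq> b" "r \<le> m" for a b r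
    unfolding S_def by (rule spn.base, rule image_eqI[of _ _ "(a, b, r)"]) (use that in auto)
  have eS: "ge a * (altw (gx b) (gx c) r * ge i) \<in> spn S" if abc: "a < n" "b < n" "c < n" for a b c r
  proof -
    define t where "t = (if a = i then 1 - i else a)"
    have t: "t < n" "t \<noteq> i" using n i abc unfolding t_def by presburger+
    have all: "u = i \<or> u = t" if "u < n" for u using that t i n by presburger
    have w: "altw (gx b) (gx c) r \<in> dihedral t i"
      using all[OF abc(2)] all[OF abc(3)] by (intro dihedral_altw dihedral_gen) auto
    show ?thesis
    proof (cases "a = i")
      case True
      have "ge i * altw (gx b) (gx c) r * ge i \<in> spn {ge i}"
        using w by (intro sandwich_dihedral[OF i t(1) not_sym[OF t(2)]]) (simp add: dihedral_sym[of i t])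
      then have "ge i * altw (gx b) (gx c) r * ge i \<in> spn S"
        by (rule spn_subset[rotated]) (use inS[OF i t(1) not_sym[OF t(2)], of 0] in auto)
      then show ?thesis by (simp add: True mult.assoc)
    next
      case False
      then have at: "a = t" by (simp add: t_def)
      have "ge t * altw (gx b) (gx c) r * ge i \<in> spn S"
      proof (cases "odd (M t i)")
        case True
        show ?thesis
          by (rule spn_subset[OF _ odd_dihedral[OF t(1) i t(2) True w]])
            (use inS[OF i t(1) not_sym[OF t(2)], of "m - 1"] mm[OF t(1) i t(2)] in \<open>auto simp: ribbon_def\<close>)
      next
        case False
        then have "ge t * altw (gx b) (gx c) r * ge i \<in> J"
          using even_dihedral[OF t(1) i t(2) _ _ w] mm[OF t(1) i t(2)] m2 by auto
        then show ?thesis by (rule spn.ideal)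
      qed
      then show ?thesis by (simp add: at mult.assoc)
    qed
  qed
  \<comment> \<open>A repeated letter is resolved by \<open>x_square\<close>.\<close>
  have square: "gx a * (gx a * (altw (gx b) (gx a) r * ge i)) \<in> spn S"
    if ab: "a < n" "b < n" "a \<noteq> b" "Suc r \<le> m" for a b r
  proof -
    let ?u = "altw (gx b) (gx a) r * ge i"
    have "gx a * (gx a * ?u) \<approx>\<^sub>J (1 - sc (eta a) * gx a + sc (eta a / l a) * ge a) * ?u"
      using eqv_right[OF x_square[OF ab(1)], of ?u] by (simp only: mult.assoc)
    also have "\<dots> = ?u - sc (eta a) * (gx a * ?u) + sc (eta a / l a) * (ge a * ?u)"
      by (simp add: distrib_right left_diff_distrib mult.assoc)
    finally show ?thesis
    proof (rule spn_eqv)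
      have "gx a * ?u \<in> spn S" using inS[OF ab] by (simp add: mult.assoc)
      then show "?u - sc (eta a) * (gx a * ?u) + sc (eta a / l a) * (ge a * ?u) \<in> spn S"
        using inS[OF ab(2,1) not_sym[OF ab(3)], of r] ab(4) eS[OF ab(1,2,1), of r]
        by (intro spn.add spn_diff spn.scale) auto
    qed
  qed
  have xS: "gx a * (altw (gx b) (gx c) r * ge i) \<in> spn S"
    if abc: "a < n" "b < n" "c < n" "b \<noteq> c" "r \<le> m" for a b c r
  proof (cases r)
    case 0
    have "1 - a < n" "a \<noteq> 1 - a" using n abc(1) by presburger+
    then show ?thesis using 0 inS[OF abc(1), of "1 - a" "Suc 0"] m2 by simp
  next
    case (Suc r')
    have ac: "a = b \<or> a = c" using abc n by presburger
    show ?thesis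
    proof (cases "a = b")
      case True
      then show ?thesis using square[OF abc(2,3,4), of r'] abc Suc by (simp add: mult.assoc)
    next
      case False
      then have a: "a = c" using ac by simp
      show ?thesis
      proof (cases "r = m")
        case False
        then show ?thesis using inS[OF abc(3,2) not_sym[OF abc(4)], of "Suc r"] abc(5) by (simp add: a mult.assoc)
      next
        case True
        have "altw (gx b) (gx c) m \<approx>\<^sub>J altw (gx c) (gx b) m"
          using braid[OF abc(2,3,4)] mm[OF abc(2,3,4)] by simp
        then have "gx c * (altw (gx b) (gx c) m * ge i) \<approx>\<^sub>J gx c * (altw (gx c) (gx b) m * ge i)"
          by (intro eqv_left eqv_right)
        moreover have "gx c * (altw (gx c) (gx b) m * ge i) \<in> spn S"
          using square[OF abc(3,2) not_sym[OF abc(4)], of r'] Suc True by (simp add: mult.assoc)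
        ultimately show ?thesis using a True by (auto intro: spn_eqv)
      qed
    qed
  qed
  show ?thesis
  proof (intro exI[of _ S] conjI fin ballI)
    fix a assume a: "a \<in> alg"
    show "a * ge i \<in> spn S"
    proof (rule alg_stable[OF _ _ a])
      fix k s assume k: "k < n" and "s \<in> S"
      then obtain a b r where s: "a < n" "b < n" "a \<noteq> b" "r \<le> m" "s = altw (gx a) (gx b) r * ge i"
        by (auto simp: S_def)
      show "gx k * s \<in> spn S" using xS[OF k s(1-4)] s(5) by simp
      show "ge k * s \<in> spn S" using eS[OF k s(1,2)] s(5) by simp
    next
      have "1 - i < n" "i \<noteq> 1 - i" using n i by presburger+
      then show "ge i \<in> spn S" using inS[OF i, of "1 - i" 0] by simp
    qed
  qed
qed

theorem algebra_finite: "\<exists>S. finite S \<and> alg \<subseteq> spn S"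
proof (rule finite_dimensional)
  fix i assume i: "i < n"
  show "\<exists>S. finite S \<and> (\<forall>a\<in>alg. a * ge i \<in> spn S)"
  proof (cases "\<exists>j<n. delta j = 0")
    case False
    then show ?thesis using i by (intro ideal_finite_generic) auto
  next
    case True
    then obtain j where j: "j < n" "delta j = 0" by blast
    have "n = 1 \<or> n = 2" using rank_le_two[OF j] i by linarith
    then show ?thesis
    proof
      assume "n = 1"
      then show ?thesis using i by (rule ideal_finite_rank_one)
    next
      assume n: "n = 2"
      have "M 0 1 \<noteq> 2"
      proof
        assume "M 0 1 = 2"
        then have "delta 0 \<noteq> 0" "delta 1 \<noteq> 0"
          using commuting_delta[of 0 1] commuting_delta[of 1 0] M_sym[of 0 1] n by auto
        moreover have "j = 0 \<or> j = 1" using j n by auto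
        ultimately show False using j by auto
      qed
      then show ?thesis by (rule ideal_finite_rank_two[OF n _ i])
    qed
  qed
qed

end


section \<open>The monodromy for two orthogonal lines\<close>

text \<open>Along the path of \<open>\<sigma>\<^sub>i\<close> for two orthogonal lines only one coordinate moves, from \<open>1\<close> to \<open>- 1\<close> after scaling.  This
  is a continuous logarithm of that coordinate, with value \<open>\<i> \<pi>\<close> at the end; flat sections have components
  \<open>exp (c * log_path \<epsilon> t)\<close>.\<close>

definition log_path :: "real \<Rightarrow> real \<Rightarrow> complex" where
  "log_path \<epsilon> t =
     (if t \<le> 1/2 then of_real (ln (1 - (1 - \<epsilon>) * (2 * t)))
      else if t \<le> 3/4 then of_real (ln \<epsilon>) + \<i> * of_real (pi * (4 * t - 2))
      else of_real (ln (\<epsilon> + (1 - \<epsilon>) * (4 * t - 3))) + \<i> * of_real pi)"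

text \<open>A point \<open>(x, y)\<close> whose distance from \<open>H\<^sub>i\<close> is multiplied by \<open>z\<close>: as \<open>H\<^sub>0\<close> is the first axis, the second coordinate
  moves for \<open>i = 0\<close>.\<close>

definition moved :: "nat \<Rightarrow> real \<Rightarrow> real \<Rightarrow> complex \<Rightarrow> complex \<times> complex" where
  "moved i x y z = (if i = 0 then (of_real x, of_real y * z) else (of_real x * z, of_real y))"

lemma log_path_0: "log_path \<epsilon> 0 = 0" and log_path_1: "log_path \<epsilon> 1 = \<i> * of_real pi"
  by (simp_all add: log_path_def)

lemma affine_pos:
  fixes \<epsilon> s :: real
  assumes "0 < \<epsilon>" "\<epsilon> < 1" "0 \<le> s" "s \<le> 1"
  shows "1 - (1 - \<epsilon>) * s > 0" "\<epsilon> + (1 - \<epsilon>) * s > 0"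
proof -
  have "(1 - \<epsilon>) * s \<le> (1 - \<epsilon>) * 1" using assms by (intro mult_left_mono) auto
  also have "\<dots> < 1" using assms by simp
  finally show "1 - (1 - \<epsilon>) * s > 0" by (rule iffD2[OF diff_gt_0_iff_gt])
  show "\<epsilon> + (1 - \<epsilon>) * s > 0" using assms by (intro add_pos_nonneg) auto
qed

lemma exp_log_path:
  assumes "0 < \<epsilon>" "\<epsilon> < 1" "0 \<le> t" "t \<le> 1"
  shows "exp (log_path \<epsilon> t) =
     (if t \<le> 1/2 then of_real (1 - (1 - \<epsilon>) * (2 * t))
      else if t \<le> 3/4 then of_real \<epsilon> * exp (of_real (pi * (4 * t - 2)) * \<i>)
      else - of_real (\<epsilon> + (1 - \<epsilon>) * (4 * t - 3)))"
proof -
  have *: "exp (of_real (ln r)) = (of_real r :: complex)" if "r > 0" for r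
    using that by (simp add: exp_of_real)
  show ?thesis
    using assms affine_pos[OF assms(1,2), of "2 * t"] affine_pos[OF assms(1,2), of "4 * t - 3"]
    by (auto simp: log_path_def exp_add * mult.commute[of \<i>] simp del: of_real_add of_real_diff of_real_mult)
qed

lemma continuous_log_path:
  assumes "0 < \<epsilon>" "\<epsilon> < 1"
  shows "continuous_on {0..1} (log_path \<epsilon>)"
  unfolding log_path_def
proof (rule continuous_on_cases_1)
  show "continuous_on {t \<in> {0..1}. t \<le> 1 / 2} (\<lambda>t. complex_of_real (ln (1 - (1 - \<epsilon>) * (2 * t))))"
  proof (intro continuous_intros)
    show "\<forall>t\<in>{t \<in> {0..1}. t \<le> 1 / 2}. 1 - (1 - \<epsilon>) * (2 * t) \<noteq> 0"
    proof
      fix t :: real assume "t \<in> {t \<in> {0..1}. t \<le> 1 / 2}"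
      then show "1 - (1 - \<epsilon>) * (2 * t) \<noteq> 0" using affine_pos(1)[OF assms, of "2 * t"] by auto
    qed
  qed
  show "continuous_on {t \<in> {0..1}. 1 / 2 \<le> t}
     (\<lambda>t. if t \<le> 3 / 4 then of_real (ln \<epsilon>) + \<i> * of_real (pi * (4 * t - 2))
       else of_real (ln (\<epsilon> + (1 - \<epsilon>) * (4 * t - 3))) + \<i> * of_real pi)"
  proof (rule continuous_on_cases_1)
    show "continuous_on {t \<in> {t \<in> {0..1}. 1 / 2 \<le> t}. t \<le> 3 / 4}
      (\<lambda>t. of_real (ln \<epsilon>) + \<i> * of_real (pi * (4 * t - 2)))"
      by (intro continuous_intros)
    show "continuous_on {t \<in> {t \<in> {0..1}. 1 / 2 \<le> t}. 3 / 4 \<le> t}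
      (\<lambda>t. of_real (ln (\<epsilon> + (1 - \<epsilon>) * (4 * t - 3))) + \<i> * of_real pi)"
    proof (intro continuous_intros)
      show "\<forall>t\<in>{t \<in> {t \<in> {0..1}. 1 / 2 \<le> t}. 3 / 4 \<le> t}. \<epsilon> + (1 - \<epsilon>) * (4 * t - 3) \<noteq> 0"
      proof
        fix t :: real assume "t \<in> {t \<in> {t \<in> {0..1}. 1 / 2 \<le> t}. 3 / 4 \<le> t}"
        then show "\<epsilon> + (1 - \<epsilon>) * (4 * t - 3) \<noteq> 0" using affine_pos(2)[OF assms, of "4 * t - 3"] by auto
      qed
    qed
    show "of_real (ln \<epsilon>) + \<i> * of_real (pi * (4 * (3 / 4) - 2)) =
      of_real (ln (\<epsilon> + (1 - \<epsilon>) * (4 * (3 / 4) - 3))) + \<i> * of_real pi" by simp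
  qed
  show "complex_of_real (ln (1 - (1 - \<epsilon>) * (2 * (1 / 2)))) =
    (if 1 / 2 \<le> (3 / 4 :: real) then of_real (ln \<epsilon>) + \<i> * of_real (pi * (4 * (1 / 2) - 2))
     else of_real (ln (\<epsilon> + (1 - \<epsilon>) * (4 * (1 / 2) - 3))) + \<i> * of_real pi)" by simp
qed

lemma log_path_derivative:
  assumes "0 < \<epsilon>" "\<epsilon> < 1" "t \<in> {0<..<1} - {1/2, 3/4}"
  shows "\<exists>D. (log_path \<epsilon> has_vector_derivative D) (at t)"
proof -
  consider "t \<in> {0<..<1/2}" | "t \<in> {1/2<..<3/4}" | "t \<in> {3/4<..<1}" using assms(3) by fastforce
  then show ?thesis
  proof cases
    case 1
    have pos: "1 - (1 - \<epsilon>) * (2 * t) > 0" using affine_pos(1)[OF assms(1,2), of "2 * t"] 1 by simp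
    have "((\<lambda>t. ln (1 - (1 - \<epsilon>) * (2 * t))) has_field_derivative
        (1 / (1 - (1 - \<epsilon>) * (2 * t))) * (- ((1 - \<epsilon>) * 2))) (at t)"
      using pos by (auto intro!: derivative_eq_intros)
    then have "((\<lambda>t. complex_of_real (ln (1 - (1 - \<epsilon>) * (2 * t)))) has_vector_derivative
        of_real ((1 / (1 - (1 - \<epsilon>) * (2 * t))) * (- ((1 - \<epsilon>) * 2)))) (at t)"
      by (rule has_vector_derivative_of_real)
    then have "(log_path \<epsilon> has_vector_derivative
        of_real ((1 / (1 - (1 - \<epsilon>) * (2 * t))) * (- ((1 - \<epsilon>) * 2)))) (at t)"
      by (rule has_vector_derivative_transform_within_open[of _ _ _ "{0<..<1/2}"])
        (use 1 in \<open>auto simp: log_path_def\<close>)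
    then show ?thesis by blast
  next
    case 2
    have "((\<lambda>t. pi * (4 * t - 2)) has_field_derivative (pi * 4)) (at t)"
      by (auto intro!: derivative_eq_intros)
    then have "((\<lambda>t. complex_of_real (pi * (4 * t - 2))) has_vector_derivative of_real (pi * 4)) (at t)"
      by (rule has_vector_derivative_of_real)
    then have "((\<lambda>t. of_real (ln \<epsilon>) + \<i> * complex_of_real (pi * (4 * t - 2))) has_vector_derivative
        (0 + \<i> * of_real (pi * 4))) (at t)"
      by (intro has_vector_derivative_add has_vector_derivative_const has_vector_derivative_mult_right)
    then have "(log_path \<epsilon> has_vector_derivative (0 + \<i> * of_real (pi * 4))) (at t)"
      by (rule has_vector_derivative_transform_within_open[of _ _ _ "{1/2<..<3/4}"])
        (use 2 in \<open>auto simp: log_path_def\<close>)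
    then show ?thesis by blast
  next
    case 3
    have pos: "\<epsilon> + (1 - \<epsilon>) * (4 * t - 3) > 0" using affine_pos(2)[OF assms(1,2), of "4 * t - 3"] 3 by simp
    have "((\<lambda>t. ln (\<epsilon> + (1 - \<epsilon>) * (4 * t - 3))) has_field_derivative
        (1 / (\<epsilon> + (1 - \<epsilon>) * (4 * t - 3))) * ((1 - \<epsilon>) * 4)) (at t)"
      using pos by (auto intro!: derivative_eq_intros)
    then have "((\<lambda>t. complex_of_real (ln (\<epsilon> + (1 - \<epsilon>) * (4 * t - 3)))) has_vector_derivative
        of_real ((1 / (\<epsilon> + (1 - \<epsilon>) * (4 * t - 3))) * ((1 - \<epsilon>) * 4))) (at t)"
      by (rule has_vector_derivative_of_real)
    then have "((\<lambda>t. complex_of_real (ln (\<epsilon> + (1 - \<epsilon>) * (4 * t - 3))) + \<i> * of_real pi) has_vector_derivative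
        (of_real ((1 / (\<epsilon> + (1 - \<epsilon>) * (4 * t - 3))) * ((1 - \<epsilon>) * 4)) + 0)) (at t)"
      by (intro has_vector_derivative_add has_vector_derivative_const)
    then have "(log_path \<epsilon> has_vector_derivative
        (of_real ((1 / (\<epsilon> + (1 - \<epsilon>) * (4 * t - 3))) * ((1 - \<epsilon>) * 4)) + 0)) (at t)"
      by (rule has_vector_derivative_transform_within_open[of _ _ _ "{3/4<..<1}"])
        (use 3 in \<open>auto simp: log_path_def\<close>)
    then show ?thesis by blast
  qed
qed

lemma line_form_two:
  "line_form 2 0 z = snd z" "line_form 2 (Suc 0) z = - fst z"
  by (simp_all add: line_form_def)

lemma reflection_two:
  "reflection 2 0 z = (fst z, - snd z)" "reflection 2 (Suc 0) z = (- fst z, snd z)"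
  by (simp_all add: reflection_def)

lemma sigma_path_two:
  assumes i: "i < 2" and e: "0 < \<epsilon>" "\<epsilon> < 1" and xy: "0 < x" "0 < y" and t: "0 \<le> t" "t \<le> 1"
  shows "sigma_path 2 (of_real x, of_real y) \<epsilon> i t = moved i x y (exp (log_path \<epsilon> t))"
proof -
  let ?p = "(complex_of_real x, complex_of_real y)"
  have i: "i = 0 \<or> i = Suc 0" using i by auto
  have r: "reflection 2 0 ?p - ?p = (0, - 2 * of_real y)" "reflection 2 (Suc 0) ?p - ?p = (- 2 * of_real x, 0)"
    by (simp_all add: reflection_two)
  have b: "before_pt 2 ?p \<epsilon> i = moved i x y (of_real \<epsilon>)"
    using i unfolding before_pt_def
    by (elim disjE) (simp_all only: r, simp_all add: moved_def scaleR_conv_of_real field_simps)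
  have inn: "inner (moved i x y (of_real \<epsilon>)) (reflection 2 i ?p - ?p)
      / inner (reflection 2 i ?p - ?p) (reflection 2 i ?p - ?p) = - \<epsilon> / 2"
    using i xy by (auto simp: r moved_def inner_complex_def field_simps)
  have h: "half_circle (reflection 2 i ?p - ?p) (before_pt 2 ?p \<epsilon> i) s
      = moved i x y (of_real \<epsilon> * exp (of_real (pi * s) * \<i>))" for s
    unfolding half_circle_def b inn using i
    by (elim disjE) (simp_all only: r, simp_all add: moved_def cscale_def algebra_simps)
  consider "t \<le> 1/2" | "\<not> t \<le> 1/2" "t \<le> 3/4" | "\<not> t \<le> 1/2" "\<not> t \<le> 3/4" by blast
  then show ?thesis
  proof cases
    case 1
    then show ?thesis
      using i unfolding sigma_path_def joinpaths_def exp_log_path[OF e t]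
      by (auto simp: b linepath_def moved_def scaleR_conv_of_real algebra_simps)
  next
    case 2
    have "2 * (2 * t - 1) = 4 * t - 2" by simp
    moreover have "2 * t - 1 \<le> 1 / 2" using 2 by simp
    ultimately show ?thesis
      using 2 unfolding sigma_path_def joinpaths_def exp_log_path[OF e t] h by simp
  next
    case 3
    have "2 * (2 * t - 1) - 1 = 4 * t - 3" by simp
    moreover have "\<not> 2 * t - 1 \<le> 1 / 2" using 3 by simp
    moreover have "linepath (reflection 2 i (before_pt 2 ?p \<epsilon> i)) (reflection 2 i ?p) s
       = moved i x y (- of_real (\<epsilon> + (1 - \<epsilon>) * s))" for s
      using i by (auto simp: b linepath_def moved_def reflection_two scaleR_conv_of_real algebra_simps)
    ultimately show ?thesis
      using 3 unfolding sigma_path_def joinpaths_def exp_log_path[OF e t] by simp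
  qed
qed

text \<open>Orthogonal reflections fix both lines, so for \<open>m = 2\<close> the permutation representation is trivial and the
  connection is diagonal.\<close>

lemma hline_two_image:
  assumes "t < 2" "b < 2"
  shows "reflection 2 t ` hline 2 b = hline 2 b"
proof -
  have tb: "t = 0 \<or> t = Suc 0" "b = 0 \<or> b = Suc 0" using assms by auto
  have inv: "reflection 2 t (reflection 2 t z) = z" for z using tb by (auto simp: reflection_two)
  have sub: "reflection 2 t z \<in> hline 2 b" if "z \<in> hline 2 b" for z
    using tb that by (auto simp: hline_def line_form_two reflection_two)
  show ?thesis
    using sub inv by (auto intro!: image_eqI[of _ "reflection 2 t" "reflection 2 t _"])
qed

lemma hline_two_eq:
  assumes "a < 2" "b < 2"
  shows "hline 2 a = hline 2 b \<longleftrightarrow> a = b"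
proof -
  have "(1, 0) \<in> hline 2 0" "(1, 0) \<notin> hline 2 (Suc 0)"
    by (simp_all add: hline_def line_form_two)
  moreover have "a = 0 \<or> a = Suc 0" "b = 0 \<or> b = Suc 0" using assms by auto
  ultimately show ?thesis by auto
qed

lemma perm_mat_two: "i < 2 \<Longrightarrow> perm_mat 2 i = 1\<^sub>m 2"
  by (rule eq_matI) (auto simp: perm_mat_def hline_two_image hline_two_eq)

lemma proj_mat_two:
  assumes "i < 2" "a < 2" "b < 2"
  shows "proj_mat 2 k \<alpha> i $$ (a, b) = (if a = i \<and> b = i then \<alpha> i else 0)"
proof -
  have "(\<Sum>t \<in> {t. t < 2 \<and> reflection 2 t ` hline 2 b = hline 2 i}. k (t mod 2)) = 0" if "b \<noteq> i"
  proof -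
    have "{t. t < 2 \<and> reflection 2 t ` hline 2 b = hline 2 i} = {}"
      using that assms by (auto simp: hline_two_image hline_two_eq)
    then show ?thesis by (simp only: sum.empty)
  qed
  then show ?thesis using assms by (auto simp: proj_mat_def)
qed

text \<open>The eigenvalue of the residue of the connection along \<open>H\<^sub>i\<close> on the basis vector \<open>a\<close>.\<close>

definition exponent :: "(nat \<Rightarrow> complex) \<Rightarrow> (nat \<Rightarrow> complex) \<Rightarrow> complex \<Rightarrow> nat \<Rightarrow> nat \<Rightarrow> complex" where
  "exponent k \<alpha> \<kappa> i a = \<kappa> * (k i - (if a = i then \<alpha> i else 0))"

lemma less_two_cases: "(a::nat) < 2 \<Longrightarrow> a = 0 \<or> a = Suc 0"
  by auto

lemma Omega_two:
  assumes i: "i < 2" and u: "line_form 2 (1 - i) u = 0" and ab: "a < 2" "b < 2"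
  shows "Omega 2 k \<alpha> \<kappa> z u $$ (a, b) =
    (if a = b then exponent k \<alpha> \<kappa> i a * (line_form 2 i u / line_form 2 i z) else 0)"
proof -
  have "(\<Sum>j<2. (k (j mod 2) * (perm_mat 2 j $$ (a, b)) - proj_mat 2 k \<alpha> j $$ (a, b))
      * (line_form 2 j u / line_form 2 j z))
    = (k i * (perm_mat 2 i $$ (a, b)) - proj_mat 2 k \<alpha> i $$ (a, b)) * (line_form 2 i u / line_form 2 i z)"
    using less_two_cases[OF i] u by (auto simp: numeral_2_eq_2)
  then show ?thesis
    using i ab by (simp add: Omega_def perm_mat_two proj_mat_two exponent_def)
qed

lemma Omega_two_mult:
  assumes "i < 2" "line_form 2 (1 - i) u = 0" "a < 2" "v \<in> carrier_vec 2"
  shows "vec_index (Omega 2 k \<alpha> \<kappa> z u *\<^sub>v v) a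
    = exponent k \<alpha> \<kappa> i a * (line_form 2 i u / line_form 2 i z) * vec_index v a"
proof -
  have dim: "Omega 2 k \<alpha> \<kappa> z u \<in> carrier_mat 2 2" by (simp add: Omega_def)
  have "vec_index (Omega 2 k \<alpha> \<kappa> z u *\<^sub>v v) a = (\<Sum>b<2. Omega 2 k \<alpha> \<kappa> z u $$ (a, b) * vec_index v b)"
    using dim assms(3,4) by (simp add: scalar_prod_def atLeast0LessThan)
  also have "\<dots> = (\<Sum>b<2. if b = a then exponent k \<alpha> \<kappa> i a * (line_form 2 i u / line_form 2 i z) * vec_index v a else 0)"
    using assms by (intro sum.cong) (auto simp: Omega_two)
  also have "\<dots> = exponent k \<alpha> \<kappa> i a * (line_form 2 i u / line_form 2 i z) * vec_index v a"
    using assms(3) by simp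
  finally show ?thesis .
qed

text \<open>The form of the other line does not change along the path, and the form of \<open>H\<^sub>i\<close> has the logarithmic derivative
  of \<open>log_path\<close>.\<close>

lemma sigma_path_two_derivative:
  assumes i: "i < 2" and e: "0 < \<epsilon>" "\<epsilon> < 1" and xy: "0 < x" "0 < y"
    and t: "t \<in> {0<..<1} - {1/2, 3/4}" and D: "(log_path \<epsilon> has_vector_derivative D) (at t)"
  defines "\<gamma> \<equiv> sigma_path 2 (of_real x, of_real y) \<epsilon> i"
  shows "\<gamma> differentiable (at t)" "line_form 2 (1 - i) (vector_derivative \<gamma> (at t)) = 0"
    "line_form 2 i (vector_derivative \<gamma> (at t)) / line_form 2 i (\<gamma> t) = D"
proof -
  let ?d = "if i = 0 then (0, of_real y * (D * exp (log_path \<epsilon> t))) else (of_real x * (D * exp (log_path \<epsilon> t)), 0)"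
  have "((\<lambda>t. exp (log_path \<epsilon> t)) has_vector_derivative (D * exp (log_path \<epsilon> t))) (at t)"
    using field_vector_diff_chain_at[OF D DERIV_exp] by (simp add: o_def)
  then have D0: "((\<lambda>t. c * exp (log_path \<epsilon> t)) has_vector_derivative c * (D * exp (log_path \<epsilon> t))) (at t)" for c
    by (rule has_vector_derivative_mult_right)
  have "((\<lambda>t. moved i x y (exp (log_path \<epsilon> t))) has_vector_derivative ?d) (at t)"
  proof (cases "i = 0")
    case True
    then show ?thesis unfolding moved_def
      using has_vector_derivative_Pair[OF has_vector_derivative_const[of "of_real x"] D0[of "of_real y"]] by simp
  next
    case False
    then show ?thesis unfolding moved_def
      using has_vector_derivative_Pair[OF D0[of "of_real x"] has_vector_derivative_const[of "of_real y"]] by simp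
  qed
  then have d: "(\<gamma> has_vector_derivative ?d) (at t)"
    by (rule has_vector_derivative_transform_within_open[of _ _ _ "{0<..<1}"])
      (use t sigma_path_two[OF i e xy] in \<open>auto simp: \<gamma>_def\<close>)
  then show "\<gamma> differentiable (at t)"
    unfolding has_vector_derivative_def differentiable_def by blast
  have v: "vector_derivative \<gamma> (at t) = ?d" by (rule vector_derivative_at[OF d])
  have g: "\<gamma> t = moved i x y (exp (log_path \<epsilon> t))"
    using sigma_path_two[OF i e xy, of t] t by (simp add: \<gamma>_def)
  show "line_form 2 (1 - i) (vector_derivative \<gamma> (at t)) = 0"
    "line_form 2 i (vector_derivative \<gamma> (at t)) / line_form 2 i (\<gamma> t) = D"
    unfolding v g using less_two_cases[OF i] xy by (auto simp: line_form_two moved_def)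
qed

lemma mat_eq_by_action:
  fixes A B :: "'a::comm_ring_1 mat"
  assumes "A \<in> carrier_mat r c" "B \<in> carrier_mat r c" "\<And>v. v \<in> carrier_vec c \<Longrightarrow> A *\<^sub>v v = B *\<^sub>v v"
  shows "A = B"
proof (rule eq_matI)
  fix a b assume "a < dim_row B" "b < dim_col B"
  then have ab: "a < r" "b < c" using assms(2) by auto
  have entry: "C $$ (a, b) = vec_index (C *\<^sub>v unit_vec c b) a" if "C \<in> carrier_mat r c" for C :: "'a mat"
    using that ab by simp
  show "A $$ (a, b) = B $$ (a, b)"
    unfolding entry[OF assms(1)] entry[OF assms(2)] using assms(3)[of "unit_vec c b"] by simp
qed (use assms in auto)

text \<open>The product of a flat component with \<open>exp (- c * log_path)\<close> is continuous with zero derivative off finitely many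
  points, hence constant.  The explicit solutions show that the transport matrix is determined.\<close>

lemma parallel_transport_two:
  assumes i: "i < 2" and e: "0 < \<epsilon>" "\<epsilon> < 1" and xy: "0 < x" "0 < y"
  shows "parallel_transport 2 k \<alpha> \<kappa> (sigma_path 2 (of_real x, of_real y) \<epsilon> i)
    = mat 2 2 (\<lambda>(a, b). if a = b then exp (exponent k \<alpha> \<kappa> i a * (\<i> * of_real pi)) else 0)"
proof -
  let ?\<gamma> = "sigma_path 2 (of_real x, of_real y) \<epsilon> i" and ?c = "exponent k \<alpha> \<kappa> i" and ?L = "log_path \<epsilon>"
  let ?P = "mat 2 2 (\<lambda>(a, b). if a = b then exp (?c a * (\<i> * of_real pi)) else 0)"
  have P: "vec_index (?P *\<^sub>v v) a = exp (?c a * (\<i> * of_real pi)) * vec_index v a"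
    if "a < 2" "v \<in> carrier_vec 2" for v a
  proof -
    have "vec_index (?P *\<^sub>v v) a = (\<Sum>b<2. ?P $$ (a, b) * vec_index v b)"
      using that by (simp add: scalar_prod_def atLeast0LessThan)
    also have "\<dots> = (\<Sum>b<2. if b = a then exp (?c a * (\<i> * of_real pi)) * vec_index v a else 0)"
      using that by (intro sum.cong) auto
    finally show ?thesis using that by simp
  qed
  note sp = sigma_path_two_derivative[OF i e xy]
  have ode: "vec_index (Omega 2 k \<alpha> \<kappa> (?\<gamma> t) (vector_derivative ?\<gamma> (at t)) *\<^sub>v v) a = ?c a * D * vec_index v a"
    if "t \<in> {0<..<1} - {1/2, 3/4}" "(?L has_vector_derivative D) (at t)" "a < 2" "v \<in> carrier_vec 2" for t D a v
    using Omega_two_mult[OF i sp(2)[OF that(1,2)] that(3,4), of k \<alpha> \<kappa> "?\<gamma> t"]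
    unfolding sp(3)[OF that(1,2)] .
  have expL: "((\<lambda>t. exp (b * ?L t)) has_vector_derivative (b * D * exp (b * ?L t))) (at t)"
    if "(?L has_vector_derivative D) (at t)" for b D t
    using field_vector_diff_chain_at[OF has_vector_derivative_mult_right[OF that, of b] DERIV_exp]
    by (simp add: o_def)
  have contL: "continuous_on {0..1} (\<lambda>t. exp (b * ?L t))" for b
    by (intro continuous_intros continuous_log_path e)
  have sol: "F 1 = ?P *\<^sub>v F 0" if F: "flat_along 2 k \<alpha> \<kappa> ?\<gamma> F" for F
  proof (rule eq_vecI)
    have car: "F t \<in> carrier_vec 2" if "t \<in> {0..1}" for t
      using F that unfolding flat_along_def by blast
    then have car01: "F 0 \<in> carrier_vec 2" "F 1 \<in> carrier_vec 2" by auto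
    show "dim_vec (F 1) = dim_vec (?P *\<^sub>v F 0)" using car01 by simp
    fix a assume "a < dim_vec (?P *\<^sub>v F 0)"
    then have a: "a < 2" by simp
    have cont: "continuous_on {0..1} (\<lambda>t. vec_index (F t) a)"
      using F a unfolding flat_along_def by blast
    obtain S where S: "finite S" "\<And>t. t \<in> {0<..<1} - S \<Longrightarrow> ((\<lambda>t. vec_index (F t) a) has_vector_derivative
        vec_index (Omega 2 k \<alpha> \<kappa> (?\<gamma> t) (vector_derivative ?\<gamma> (at t)) *\<^sub>v F t) a) (at t)"
      using F a unfolding flat_along_def by blast
    \<comment> \<open>Strip the expected solution; what remains is constant.\<close>
    let ?G = "\<lambda>t. vec_index (F t) a * exp (- ?c a * ?L t)"
    have "?G 1 = ?G 0"
    proof (rule has_derivative_zero_unique_strong_interval[of "S \<union> {0, 1, 1/2, 3/4}" 0 1 ?G "?G 0" 1])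
      show "continuous_on {0..1} ?G" by (intro continuous_on_mult cont contL)
      fix t :: real assume t: "t \<in> {0..1} - (S \<union> {0, 1, 1/2, 3/4})"
      then have t1: "t \<in> {0<..<1} - {1/2, 3/4}" "t \<in> {0<..<1} - S" by auto
      obtain D where D: "(?L has_vector_derivative D) (at t)" using log_path_derivative[OF e t1(1)] by blast
      have "((\<lambda>t. vec_index (F t) a) has_vector_derivative ?c a * D * vec_index (F t) a) (at t)"
        using S(2)[OF t1(2)] ode[OF t1(1) D a car] t by simp
      from has_vector_derivative_mult[OF this expL[OF D, of "- ?c a"]]
      have "(?G has_vector_derivative 0) (at t)" by (simp add: algebra_simps)
      then have "(?G has_vector_derivative 0) (at t within {0..1})"
        by (rule has_vector_derivative_at_within)
      then show "(?G has_derivative (\<lambda>h. 0)) (at t within {0..1})"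
        by (simp add: has_vector_derivative_def)
    qed (use S(1) in auto)
    then have F0: "vec_index (F 0) a = vec_index (F 1) a * exp (- ?c a * (\<i> * of_real pi))"
      by (simp add: log_path_0 log_path_1)
    have "exp (?c a * (\<i> * of_real pi)) * exp (- ?c a * (\<i> * of_real pi)) = 1"
      by (simp add: exp_add[symmetric])
    then have "vec_index (F 1) a
        = vec_index (F 1) a * (exp (?c a * (\<i> * of_real pi)) * exp (- ?c a * (\<i> * of_real pi)))"
      by (simp only: mult_1_right)
    then show "vec_index (F 1) a = vec_index (?P *\<^sub>v F 0) a"
      unfolding P[OF a car01(1)] F0 by (simp only: mult.left_commute mult.commute mult.assoc)
  qed
  have exist: "\<exists>F. flat_along 2 k \<alpha> \<kappa> ?\<gamma> F \<and> F 0 = v" if v: "v \<in> carrier_vec 2" for v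
  proof (intro exI[of _ "\<lambda>t. vec 2 (\<lambda>a. exp (?c a * ?L t) * vec_index v a)"] conjI)
    let ?F = "\<lambda>t. vec 2 (\<lambda>a. exp (?c a * ?L t) * vec_index v a)"
    have idx: "(\<lambda>t. vec_index (?F t) a) = (\<lambda>t. exp (?c a * ?L t) * vec_index v a)" if "a < 2" for a
      using that by simp
    show "?F 0 = v" using v by (intro eq_vecI) (auto simp: log_path_0)
    show "flat_along 2 k \<alpha> \<kappa> ?\<gamma> ?F"
      unfolding flat_along_def
    proof (intro conjI)
      show "\<forall>t\<in>{0..1}. ?F t \<in> carrier_vec 2" by simp
      show "\<forall>a<2. continuous_on {0..1} (\<lambda>t. vec_index (?F t) a)"
        using contL by (auto simp: idx intro!: continuous_on_mult continuous_on_const)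
      show "\<exists>S. finite S \<and> (\<forall>t\<in>{0<..<1} - S. ?\<gamma> differentiable (at t) \<and>
          (\<forall>a<2. ((\<lambda>t. vec_index (?F t) a) has_vector_derivative
            vec_index (Omega 2 k \<alpha> \<kappa> (?\<gamma> t) (vector_derivative ?\<gamma> (at t)) *\<^sub>v ?F t) a) (at t)))"
      proof (intro exI[of _ "{1/2, 3/4}"] conjI ballI allI impI)
        fix t :: real assume t: "t \<in> {0<..<1} - {1/2, 3/4}"
        then obtain D where D: "(?L has_vector_derivative D) (at t)" using log_path_derivative[OF e] by blast
        show "?\<gamma> differentiable (at t)" by (rule sp(1)[OF t D])
        fix a :: nat assume a: "a < 2"
        have "((\<lambda>t. exp (?c a * ?L t) * vec_index v a) has_vector_derivative
            ?c a * D * exp (?c a * ?L t) * vec_index v a) (at t)"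
          using has_vector_derivative_mult_left[OF expL[OF D, of "?c a"], of "vec_index v a"] by simp
        then show "((\<lambda>t. vec_index (?F t) a) has_vector_derivative
            vec_index (Omega 2 k \<alpha> \<kappa> (?\<gamma> t) (vector_derivative ?\<gamma> (at t)) *\<^sub>v ?F t) a) (at t)"
          using ode[OF t D a, of "?F t"] a by (simp add: idx mult.assoc)
      qed simp
    qed
  qed
  show ?thesis
    unfolding parallel_transport_def
  proof (rule the_equality)
    show "?P \<in> carrier_mat 2 2 \<and> (\<forall>F. flat_along 2 k \<alpha> \<kappa> ?\<gamma> F \<longrightarrow> F 1 = ?P *\<^sub>v F 0)"
      using sol by simp
    fix Q assume Q: "Q \<in> carrier_mat 2 2 \<and> (\<forall>F. flat_along 2 k \<alpha> \<kappa> ?\<gamma> F \<longrightarrow> F 1 = Q *\<^sub>v F 0)"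
    have "Q *\<^sub>v v = ?P *\<^sub>v v" if v: "v \<in> carrier_vec 2" for v
    proof -
      obtain F where F: "flat_along 2 k \<alpha> \<kappa> ?\<gamma> F" "F 0 = v" using exist[OF v] by blast
      have "F 1 = Q *\<^sub>v F 0" using Q F(1) by blast
      then show ?thesis unfolding sol[OF F(1)] F(2) by (rule sym)
    qed
    then show "Q = ?P" using Q by (intro mat_eq_by_action[of Q 2 2]) auto
  qed
qed

lemma T_LK_two:
  assumes "i < 2" "0 < \<epsilon>" "\<epsilon> < 1" "p \<in> open_sector 2"
  shows "T_LK 2 p \<epsilon> k \<alpha> \<kappa> i
    = mat 2 2 (\<lambda>(a, b). if a = b then exp (exponent k \<alpha> \<kappa> i a * (\<i> * of_real pi)) else 0)"
proof -
  obtain r t where p: "0 < r" "0 < t" "t < pi / 2" "p = (of_real (r * cos t), of_real (r * sin t))"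
    using assms(4) by (auto simp: open_sector_def)
  have "cos t > 0" "sin t > 0"
    using p by (auto intro!: cos_gt_zero_pi sin_gt_zero)
  then show ?thesis
    unfolding T_LK_def p(4) using parallel_transport_two[OF assms(1-3), of "r * cos t" "r * sin t"] p(1)
    by (simp add: perm_mat_two[OF assms(1)])
qed

text \<open>The value at \<open>X = l\<^sup>-\<^sup>1\<close> of the polynomial that expresses \<open>E\<close> through \<open>X\<close>.\<close>

definition e_scalar :: "complex \<Rightarrow> complex \<Rightarrow> complex" where
  "e_scalar q l = l / (inverse q - q) * ((inverse l - q) * (inverse l + inverse q))"

lemma e_LK_two:
  assumes "i < 2" "0 < \<epsilon>" "\<epsilon> < 1" "p \<in> open_sector 2"
  shows "e_LK 2 p \<epsilon> k \<alpha> \<kappa> i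
    = mat 2 2 (\<lambda>(a, b). if a = i \<and> b = i then e_scalar (q_par k \<kappa> i) (l_par k \<alpha> \<kappa> i) else 0)"
proof -
  let ?q = "q_par k \<kappa> i" and ?l = "l_par k \<alpha> \<kappa> i"
  let ?T = "\<lambda>a. exp (exponent k \<alpha> \<kappa> i a * (\<i> * of_real pi))"
  have Tq: "?T a = ?q" if "a \<noteq> i" for a
    using that by (simp add: exponent_def q_par_def mult.commute mult.left_commute)
  have Tl: "?T i = inverse ?l"
    by (simp add: exponent_def q_par_def l_par_def exp_diff right_diff_distrib left_diff_distrib mult_ac)
  have A: "T_LK 2 p \<epsilon> k \<alpha> \<kappa> i - ?q \<cdot>\<^sub>m 1\<^sub>m 2 = mat 2 2 (\<lambda>(a, b). if a = b then ?T a - ?q else 0)"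
    unfolding T_LK_two[OF assms] by (rule eq_matI) auto
  have B: "T_LK 2 p \<epsilon> k \<alpha> \<kappa> i + inverse ?q \<cdot>\<^sub>m 1\<^sub>m 2 = mat 2 2 (\<lambda>(a, b). if a = b then ?T a + inverse ?q else 0)"
    unfolding T_LK_two[OF assms] by (rule eq_matI) auto
  have C: "mat 2 2 (\<lambda>(a, b). if a = b then f a else 0) * mat 2 2 (\<lambda>(a, b). if a = b then g a else 0)
      = mat 2 2 (\<lambda>(a, b). if a = b then f a * g a else 0)" for f g :: "nat \<Rightarrow> complex"
  proof (rule eq_matI)
    fix a b assume "a < dim_row (mat 2 2 (\<lambda>(a, b). if a = b then f a * g a else 0))"
      "b < dim_col (mat 2 2 (\<lambda>(a, b). if a = b then f a * g a else 0))"
    then have ab: "a < 2" "b < 2" by auto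
    then have "(mat 2 2 (\<lambda>(a, b). if a = b then f a else 0) * mat 2 2 (\<lambda>(a, b). if a = b then g a else 0)) $$ (a, b)
        = (\<Sum>c<2. (if a = c then f a else 0) * (if c = b then g c else 0))"
      by (simp add: scalar_prod_def atLeast0LessThan)
    also have "\<dots> = (if a = b then f a * g a else 0)"
      using less_two_cases[OF ab(1)] less_two_cases[OF ab(2)] by (auto simp: numeral_2_eq_2)
    finally show "(mat 2 2 (\<lambda>(a, b). if a = b then f a else 0) * mat 2 2 (\<lambda>(a, b). if a = b then g a else 0)) $$ (a, b)
        = mat 2 2 (\<lambda>(a, b). if a = b then f a * g a else 0) $$ (a, b)" using ab by simp
  qed auto
  show ?thesis
    unfolding e_LK_def A B C
    by (rule eq_matI) (auto simp: Tq Tl e_scalar_def)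
qed


lemma e_scalar_nonzero:
  assumes "i < 2" "0 < \<epsilon>" "\<epsilon> < 1" "p \<in> open_sector 2"
    and "vec_space.rank 2 (e_LK 2 p \<epsilon> k \<alpha> \<kappa> i) = 1"
  shows "e_scalar (q_par k \<kappa> i) (l_par k \<alpha> \<kappa> i) \<noteq> 0"
proof
  assume z: "e_scalar (q_par k \<kappa> i) (l_par k \<alpha> \<kappa> i) = 0"
  have "e_LK 2 p \<epsilon> k \<alpha> \<kappa> i = 0\<^sub>m 2 2"
    unfolding e_LK_two[OF assms(1-4)] z by (rule eq_matI) auto
  then show False using assms(5) vec_space.rank_0I[of 2 2, where ?'a = complex] by simp
qed

text \<open>Both operators are diagonal with disjoint supports, so their product vanishes.\<close>

lemma Phi_two:
  assumes "i < 2" "j < 2" "i \<noteq> j" "0 < \<epsilon>" "\<epsilon> < 1" "p \<in> open_sector 2"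
    and "vec_space.rank 2 (e_LK 2 p \<epsilon> k \<alpha> \<kappa> i) = 1"
  shows "Phi 2 p \<epsilon> k \<alpha> \<kappa> i [E j] = 0"
proof -
  let ?e = "\<lambda>j. e_LK 2 p \<epsilon> k \<alpha> \<kappa> j" and ?c = "e_scalar (q_par k \<kappa> i) (l_par k \<alpha> \<kappa> i)"
  note ei = e_LK_two[OF assms(1,4-6)] and ej = e_LK_two[OF assms(2,4-6)]
  have nz: "?c \<noteq> 0" by (rule e_scalar_nonzero[OF assms(1,4-7)])
  have d: "?e i \<in> carrier_mat 2 2" "?e j \<in> carrier_mat 2 2"
    by (simp_all add: ei ej)
  have "word_val 2 p \<epsilon> k \<alpha> \<kappa> [E j] = ?e j"
    using d by (simp add: word_val_def)
  moreover have "?e i * ?e j = 0\<^sub>m 2 2"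
    unfolding ei ej
    using assms(3)
    by (intro eq_matI) (auto simp: scalar_prod_def numeral_2_eq_2)
  ultimately have "?e i * word_val 2 p \<epsilon> k \<alpha> \<kappa> [E j] * ?e i = 0\<^sub>m 2 2"
    using d by simp
  moreover have "0\<^sub>m 2 2 = c \<cdot>\<^sub>m ?e i \<longleftrightarrow> c = 0" for c
  proof
    assume eq: "0\<^sub>m 2 2 = c \<cdot>\<^sub>m ?e i"
    have "0 = (c \<cdot>\<^sub>m ?e i) $$ (i, i)" unfolding eq[symmetric] using assms(1) by simp
    also have "\<dots> = c * ?c" using assms(1) by (simp add: ei)
    finally show "c = 0" using nz by simp
  next
    assume "c = 0"
    then show "0\<^sub>m 2 2 = c \<cdot>\<^sub>m ?e i" using d by (intro eq_matI) auto
  qed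
  ultimately show ?thesis
    unfolding Phi_def by simp
qed


section \<open>Words with foreign letters\<close>

abbreviation letters :: "nat \<Rightarrow> nat gen set" where
  "letters n \<equiv> X ` {..<n} \<union> Xm ` {..<n} \<union> E ` {..<n}"

text \<open>The type \<^typ>\<open>falg\<close> contains letters of every index, while the free algebra on \<open>n\<close> generators is only a subset of
  it.  Combinations of words that contain a letter of another index form a two-sided ideal of the whole type, complementary
  to this subset.\<close>

definition foreign :: "nat \<Rightarrow> falg set" where
  "foreign n = {f. Poly_Mapping.keys f \<inter> lists (letters n) = {}}"

lemma foreign_add: "f \<in> foreign n \<Longrightarrow> g \<in> foreign n \<Longrightarrow> f + g \<in> foreign n"
  using keys_add[of f g] unfolding foreign_def by blast

lemma foreign_mult:
  assumes "f \<in> foreign n \<or> g \<in> foreign n"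
  shows "f * g \<in> foreign n"
proof -
  have "w \<notin> lists (letters n)" if "w \<in> Poly_Mapping.keys (f * g)" for w
  proof
    assume w: "w \<in> lists (letters n)"
    obtain u v where uv: "w = u @ v" "u \<in> Poly_Mapping.keys f" "v \<in> Poly_Mapping.keys g"
      using keys_mult[of f g] \<open>w \<in> Poly_Mapping.keys (f * g)\<close> unfolding plus_list_def by blast
    have "u \<in> lists (letters n)" "v \<in> lists (letters n)" using w unfolding uv(1) append_in_lists_conv by auto
    then show False using assms uv(2,3) unfolding foreign_def by blast
  qed
  then show ?thesis unfolding foreign_def by blast
qed

lemma carrier_free_algebra:
  "f \<in> carrier (free_algebra n) \<longleftrightarrow> Poly_Mapping.keys f \<subseteq> lists (letters n)"
  by (simp add: free_algebra_def)

lemma foreign_carrier: "f \<in> carrier (free_algebra n) \<Longrightarrow> f \<in> foreign n \<Longrightarrow> f = 0"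
  unfolding carrier_free_algebra foreign_def using keys_eq_empty[of f] by blast

lemma foreign_decompose:
  fixes f :: falg
  shows "\<exists>g \<in> carrier (free_algebra n). f - g \<in> foreign n"
proof
  let ?L = "lists (letters n)"
  let ?g = "\<Sum>w\<in>Poly_Mapping.keys f \<inter> ?L. Poly_Mapping.single w (Poly_Mapping.lookup f w)"
  show "?g \<in> carrier (free_algebra n)"
    unfolding carrier_free_algebra
    by (rule order_trans[OF keys_sum]) (auto simp del: in_lists_conv_set split: if_splits)
  have "Poly_Mapping.lookup ?g w = Poly_Mapping.lookup f w" if "w \<in> ?L" for w
  proof -
    have "Poly_Mapping.lookup ?g w = (\<Sum>v\<in>Poly_Mapping.keys f \<inter> ?L. if v = w then Poly_Mapping.lookup f w else 0)"
      unfolding lookup_sum by (intro sum.cong) (auto simp: lookup_single when_def)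
    also have "\<dots> = Poly_Mapping.lookup f w"
      using \<open>w \<in> ?L\<close> by (auto simp: in_keys_iff simp del: in_lists_conv_set)
    finally show ?thesis .
  qed
  then have "w \<notin> Poly_Mapping.keys (f - ?g)" if "w \<in> ?L" for w
    using \<open>w \<in> ?L\<close> by (simp add: in_keys_iff lookup_minus del: in_lists_conv_set)
  then show "f - ?g \<in> foreign n"
    unfolding foreign_def by blast
qed

lemma mon_mult: "mon u * mon v = mon (u @ v)"
  by (simp add: mult_single plus_list_def)

lemma altw_mon: "altw (mon [x]) (mon [y]) r = mon (alt x y r)"
  by (induction r arbitrary: x y) (auto simp: mon_mult one_falg)

lemma prod_list_mon:
  assumes "set ws \<subseteq> {mon [X i], mon [X j], mon [E i], mon [E j]}"
  shows "\<exists>w\<in>Lambda. prod_list ws = mon (rename i j w)"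
  using assms
proof (induction ws)
  case Nil
  show ?case by (intro bexI[of _ "[]"]) (auto simp: Lambda_def rename_def one_falg)
next
  case (Cons a ws)
  then obtain w where w: "w \<in> Lambda" "prod_list ws = mon (rename i j w)" by auto
  have "\<exists>g \<in> {X (0 :: nat), X 1, E 0, E 1}. a = mon [map_gen (\<lambda>t. if t = 0 then i else j) g]"
    using Cons.prems by auto
  then obtain g where g: "g \<in> {X (0 :: nat), X 1, E 0, E 1}" "a = mon [map_gen (\<lambda>t. if t = 0 then i else j) g]"
    by blast
  have "prod_list (a # ws) = mon (rename i j (g # w))"
    by (simp add: g(2) w(2) mon_mult rename_def)
  moreover have "g # w \<in> Lambda" using g(1) w(1) by (simp add: Lambda_def)
  ultimately show ?case by blast
qed

lemma cst_central:
  fixes f :: falg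
  shows "cst c * f = f * cst c"
proof -
  have f: "f = (\<Sum>v\<in>Poly_Mapping.keys f. Poly_Mapping.single v (Poly_Mapping.lookup f v))"
    by (rule poly_mapping_eqI) (auto simp: lookup_sum lookup_single when_def in_keys_iff)
  show ?thesis
    by (subst (1 2) f) (simp add: sum_distrib_left sum_distrib_right mult_single plus_list_def mult.commute)
qed


section \<open>Generators joined by an odd edge are conjugate\<close>

text \<open>With \<open>M i j = 2 r + 1\<close> and \<open>g = (s\<^sub>i s\<^sub>j)\<^sup>r\<close>, the words \<open>g s\<^sub>i\<close> and \<open>s\<^sub>j g\<close> are palindromes whose product is
  the relator.\<close>

lemma cox_conjugate_odd:
  assumes "coxeter_matrix n M" "i < n" "j < n" "odd (M i j)"
  shows "cox_conjugate n M i j"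
proof -
  let ?G = "coxeter_group n M" and ?c = "\<lambda>w. cox_rel n M `` {w}"
  interpret G: group ?G by (rule group_coxeter_group[OF assms(1)])
  obtain r where r: "M i j = 2 * r + 1" using assms(4) by (elim oddE)
  define g where "g = concat (replicate r [i, j])"
  have one: "\<one>\<^bsub>?G\<^esub> = ?c []" by (simp add: coxeter_group_def)
  have car: "?c w \<in> carrier ?G" if "w \<in> lists {..<n}" for w
    using that by (simp add: coxeter_group_def quotientI del: in_lists_conv_set)
  have L: "g \<in> lists {..<n}" "[i] \<in> lists {..<n}" "[j] \<in> lists {..<n}"
    using assms(2,3) by (auto simp: g_def split: if_splits)
  have L2: "g @ [i] \<in> lists {..<n}" "[j] @ g \<in> lists {..<n}" using L by auto
  have shift: "concat (replicate r [j, i]) @ [j] = [j] @ concat (replicate r [i, j])" for r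
    by (induction r) auto
  have snoc: "concat (replicate r [j, i]) @ [j, i] = j # i # concat (replicate r [j, i])" for r
    by (induction r) auto
  have "rev (concat (replicate r [i, j])) = concat (replicate r [j, i])" for r
    by (induction r) (auto simp: snoc)
  then have rev: "rev ([j] @ g) = [j] @ g" using shift[of r] by (simp add: g_def)
  have "concat (replicate (2 * r + 1) [i, j]) = concat (replicate r [i, j] @ [[i, j]] @ replicate r [i, j])"
    by (simp add: mult_2 replicate_add replicate_app_Cons_same)
  then have word: "(g @ [i]) @ ([j] @ g) = concat (replicate (M i j) [i, j])"
    unfolding r by (simp add: g_def)
  have "cox_step n M ((g @ [i]) @ ([j] @ g)) []"
    using cox_step.intros[OF assms(2,3), of M "[]" "[]"] unfolding word by simp
  then have "((g @ [i]) @ ([j] @ g), []) \<in> cox_rel n M"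
    using L by (auto simp: cox_rel_def)
  then have ab: "?c (g @ [i]) \<otimes>\<^bsub>?G\<^esub> ?c ([j] @ g) = \<one>\<^bsub>?G\<^esub>"
    unfolding coxeter_mult_class[OF L2] one by (rule equiv_class_eq[OF equiv_cox_rel])
  have "(([j] @ g) @ ([j] @ g), []) \<in> cox_rel n M"
    using cox_rel_rev[OF assms(1) L2(2)] unfolding rev .
  then have bb: "?c ([j] @ g) \<otimes>\<^bsub>?G\<^esub> ?c ([j] @ g) = \<one>\<^bsub>?G\<^esub>"
    unfolding coxeter_mult_class[OF L2(2,2)] one by (rule equiv_class_eq[OF equiv_cox_rel])
  have "?c (g @ [i]) = ?c ([j] @ g)"
    using ab bb by (metis G.inv_equality car[OF L2(1)] car[OF L2(2)])
  then have "?c g \<otimes>\<^bsub>?G\<^esub> ?c [i] = ?c [j] \<otimes>\<^bsub>?G\<^esub> ?c g"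
    using L by (simp add: coxeter_mult_class del: in_lists_conv_set)
  then have "?c g \<otimes>\<^bsub>?G\<^esub> ?c [i] \<otimes>\<^bsub>?G\<^esub> inv\<^bsub>?G\<^esub> (?c g) = ?c [j]"
    using car[OF L(1)] car[OF L(3)] by (simp add: G.m_assoc)
  then show ?thesis
    unfolding cox_conjugate_def cox_gen_def using car[OF L(1)] by blast
qed


section \<open>The presented algebra\<close>

locale bmw_presentation =
  fixes n :: nat and M :: "nat \<Rightarrow> nat \<Rightarrow> nat" and k \<alpha> :: "nat \<Rightarrow> complex" and \<kappa> :: complex
    and p :: "nat \<Rightarrow> complex \<times> complex" and \<epsilon> :: real
  assumes coxeter_M: "coxeter_matrix n M"
    and finite_W: "finite (carrier (coxeter_group n M))"
    and parameters: "BMW_parameters n M k \<alpha>"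
    and base_point: "m \<ge> 2 \<Longrightarrow> p m \<in> open_sector m"
    and eps: "0 < \<epsilon>" "\<epsilon> < 1"
    and generic: "BMW_generic n M p \<epsilon> k \<alpha> \<kappa>"
begin

abbreviation "R \<equiv> free_algebra n"
abbreviation "I \<equiv> BMW_ideal n M p \<epsilon> k \<alpha> \<kappa>"

text \<open>The ideal of relations, enlarged by the foreign words so that it becomes an ideal of the whole type.  On the
  carrier of the free algebra nothing is added, by \<open>foreign_carrier\<close>.\<close>

definition J :: "falg set" where
  "J = {z. \<exists>a\<in>I. z - a \<in> foreign n}"

sublocale finite_coxeter_system n M
  by unfold_locales (rule coxeter_M finite_W)+

sublocale R: ring R by (rule ring_free_algebra)

sublocale I: ideal I R by (rule ideal_BMW_ideal)

lemma R_simps [simp]: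
  "f \<oplus>\<^bsub>R\<^esub> g = f + g" "f \<otimes>\<^bsub>R\<^esub> g = f * g" "\<one>\<^bsub>R\<^esub> = 1" "\<zero>\<^bsub>R\<^esub> = 0"
  by (simp_all add: free_algebra_def)

lemma zero_foreign: "0 \<in> foreign n"
  by (simp add: foreign_def)

lemma ideal_J: "a \<in> I \<Longrightarrow> a \<in> J"
  unfolding J_def using zero_foreign by (intro CollectI bexI[of _ a]) auto

lemma relator_J: "a \<in> BMW_relators n M p \<epsilon> k \<alpha> \<kappa> \<Longrightarrow> a \<in> J"
  by (rule ideal_J, unfold BMW_ideal_def) (rule subsetD[OF R.genideal_self[OF BMW_relators_carrier]])

lemma J_mult:
  assumes "z \<in> J"
  shows "r * z \<in> J" "z * r \<in> J"
proof -
  obtain a where a: "a \<in> I" "z - a \<in> foreign n" using assms by (auto simp: J_def)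
  obtain s where s: "s \<in> carrier R" "r - s \<in> foreign n" using foreign_decompose by blast
  have "s * a \<in> I" "a * s \<in> I" using I.I_l_closed[OF a(1) s(1)] I.I_r_closed[OF a(1) s(1)] by simp_all
  moreover have "r * z - s * a = r * (z - a) + (r - s) * a" "z * r - a * s = (z - a) * r + a * (r - s)"
    by (simp_all add: algebra_simps)
  ultimately show "r * z \<in> J" "z * r \<in> J"
    unfolding J_def using a(2) s(2) foreign_add foreign_mult by (metis (mono_tags, lifting) mem_Collect_eq)+
qed

sublocale quotient_span J cst
proof
  show "0 \<in> J" by (rule ideal_J) (use I.zero_closed in simp)
  show "x + y \<in> J" if "x \<in> J" "y \<in> J" for x y
  proof -
    obtain a b where ab: "a \<in> I" "x - a \<in> foreign n" "b \<in> I" "y - b \<in> foreign n"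
      using \<open>x \<in> J\<close> \<open>y \<in> J\<close> by (auto simp: J_def)
    have "x + y - (a + b) \<in> foreign n"
      using foreign_add[OF ab(2,4)] by (simp add: algebra_simps)
    moreover have "a + b \<in> I" using I.a_closed[OF ab(1,3)] by simp
    ultimately show ?thesis unfolding J_def by blast
  qed
  show "cst (a + b) = cst a + cst b" for a b by (rule single_add)
  show "cst (a * b) = cst a * cst b" for a b by (simp add: mult_single plus_list_def)
qed (rule J_mult cst_central one_falg[symmetric] | assumption)+

lemma rank_e_LK:
  assumes "i < j" "j < n" "t \<in> {0, 1}"
  shows "vec_space.rank (M i j)
    (e_LK (M i j) (p (M i j)) \<epsilon> (pair_par k i j) (pair_par \<alpha> i j) \<kappa> t) = 1"
proof -
  have "M i j \<noteq> 0" using assms M_ge2[of i j] by auto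
  then show ?thesis using generic assms unfolding BMW_generic_def by blast
qed

lemma q_par_pair: "q_par (pair_par k i j) \<kappa> t = q_par k \<kappa> (if t = 0 then i else j)"
  and l_par_pair: "l_par (pair_par k i j) (pair_par \<alpha> i j) \<kappa> t = l_par k \<alpha> \<kappa> (if t = 0 then i else j)"
  by (auto simp: q_par_def l_par_def pair_par_def)

sublocale bmw_relations n M J cst "\<lambda>i. mon [X i]" "\<lambda>i. mon [Xm i]" "\<lambda>i. mon [E i]"
  "q_par k \<kappa>" "l_par k \<alpha> \<kappa>"
proof
  fix i assume i: "i < n"
  show "eqv (mon [X i] * mon [Xm i]) 1" "eqv (mon [Xm i] * mon [X i]) 1"
    unfolding eqv_def using relator_J[OF BMW_relators.inv_right[OF i]]
      relator_J[OF BMW_relators.inv_left[OF i]] by (simp_all add: mon_mult)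
  show "q_par k \<kappa> i \<noteq> 0" "l_par k \<alpha> \<kappa> i \<noteq> 0" by (simp_all add: q_par_def l_par_def)
  show "(q_par k \<kappa> i)\<^sup>2 \<noteq> 1" using generic i by (simp add: BMW_generic_def)
  show "eqv (cst (inverse (q_par k \<kappa> i) - q_par k \<kappa> i) * mon [E i])
      (cst (l_par k \<alpha> \<kappa> i) * (mon [X i] - cst (q_par k \<kappa> i)) * (mon [X i] + cst (inverse (q_par k \<kappa> i))))"
    unfolding eqv_def by (rule relator_J[OF BMW_relators.quadratic[OF i]])
  show "eqv (mon [X i] * mon [E i]) (cst (inverse (l_par k \<alpha> \<kappa> i)) * mon [E i])"
    "eqv (mon [E i] * mon [X i]) (cst (inverse (l_par k \<alpha> \<kappa> i)) * mon [E i])"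
    unfolding eqv_def mon_mult append.simps
    by (rule relator_J[OF BMW_relators.XE[OF i]], rule relator_J[OF BMW_relators.EX[OF i]])
  fix j assume j: "j < n"
  show "eqv (altw (mon [X i]) (mon [X j]) (M i j)) (altw (mon [X j]) (mon [X i]) (M i j))" if "i \<noteq> j"
    unfolding eqv_def altw_mon by (rule relator_J[OF BMW_relators.braid[OF i j that]])
  show "q_par k \<kappa> i = q_par k \<kappa> j \<and> l_par k \<alpha> \<kappa> i = l_par k \<alpha> \<kappa> j" if "odd (M i j)"
    using parameters cox_conjugate_odd[OF coxeter_M i j that] i j
    by (simp add: BMW_parameters_def q_par_def l_par_def)
qed

lemma delta_e_scalar:
  assumes "i < n"
  shows "delta i = e_scalar (q_par k \<kappa> i) (l_par k \<alpha> \<kappa> i)"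
proof -
  let ?q = "q_par k \<kappa> i" and ?l = "l_par k \<alpha> \<kappa> i"
  have "(inverse ?l - ?q) * (inverse ?l + inverse ?q) = (inverse ?l)\<^sup>2 + inverse ?l * eta i - 1"
    using q_nz[OF assms] by (simp add: eta_def algebra_simps power2_eq_square)
  moreover have "?l / eta i * (inverse ?l * eta i) = 1"
    using eta_nz[OF assms] l_nz[OF assms] by simp
  ultimately show ?thesis
    unfolding delta_def e_scalar_def eta_def[symmetric] by (simp only: distrib_left right_diff_distrib mult_1_right)
qed

lemma sandwich_pair:
  assumes "i < j" "j < n" "set ws \<subseteq> {mon [X i], mon [X j], mon [E i], mon [E j]}"
  shows "mon [E i] * prod_list ws * mon [E i] \<in> spn {mon [E i]}"
    and "mon [E j] * prod_list ws * mon [E j] \<in> spn {mon [E j]}"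
proof -
  have M: "M i j \<noteq> 0" using M_ge2[of i j] assms by auto
  obtain w where w: "w \<in> Lambda" "prod_list ws = mon (rename i j w)"
    using prod_list_mon[OF assms(3)] by blast
  show "mon [E i] * prod_list ws * mon [E i] \<in> spn {mon [E i]}"
    "mon [E j] * prod_list ws * mon [E j] \<in> spn {mon [E j]}"
    unfolding spn_singleton eqv_def w(2) mon_mult
    using relator_J[OF BMW_relators.EwE_left[where M = M, OF assms(1,2) M w(1)]]
      relator_J[OF BMW_relators.EwE_right[where M = M, OF assms(1,2) M w(1)]] by auto
qed

lemma even_zero_pair:
  assumes "i < j" "j < n" "even (M i j)" "M i j > 2" "set ws \<subseteq> {mon [X i], mon [X j], mon [E i], mon [E j]}"
  shows "mon [E i] * prod_list ws * mon [E j] \<in> J" and "mon [E j] * prod_list ws * mon [E i] \<in> J"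
proof -
  obtain w where w: "w \<in> Lambda" "prod_list ws = mon (rename i j w)"
    using prod_list_mon[OF assms(5)] by blast
  show "mon [E i] * prod_list ws * mon [E j] \<in> J" "mon [E j] * prod_list ws * mon [E i] \<in> J"
    unfolding w(2) mon_mult
    using relator_J[OF BMW_relators.even_left[where M = M, OF assms(1-4) w(1)]]
      relator_J[OF BMW_relators.even_right[where M = M, OF assms(1-4) w(1)]] by auto
qed

text \<open>The rank-one condition for \<open>m = 2\<close> says that \<open>e_scalar\<close> is nonzero for both generators, and this scalar is
  \<open>delta\<close>.\<close>

lemma commuting_pair:
  assumes "i < j" "j < n" "M i j = 2"
  shows "mon [E i] * mon [E j] * mon [E i] \<in> J" and "mon [E j] * mon [E i] * mon [E j] \<in> J"
    and "delta i \<noteq> 0" and "delta j \<noteq> 0"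
proof -
  have M: "M i j \<noteq> 0" using assms(3) by simp
  have sec: "p 2 \<in> open_sector 2" by (rule base_point) simp
  have rank: "vec_space.rank 2 (e_LK 2 (p 2) \<epsilon> (pair_par k i j) (pair_par \<alpha> i j) \<kappa> t) = 1" if "t \<in> {0, 1}" for t
    using rank_e_LK[OF assms(1,2) that] unfolding assms(3) .
  have rank0: "vec_space.rank 2 (e_LK 2 (p 2) \<epsilon> (pair_par k i j) (pair_par \<alpha> i j) \<kappa> 0) = 1"
    and rank1: "vec_space.rank 2 (e_LK 2 (p 2) \<epsilon> (pair_par k i j) (pair_par \<alpha> i j) \<kappa> 1) = 1"
    by (rule rank; simp)+
  have w: "[E 1] \<in> Lambda" "[E 0] \<in> Lambda" by (simp_all add: Lambda_def)
  have P0: "Phi (M i j) (p (M i j)) \<epsilon> (pair_par k i j) (pair_par \<alpha> i j) \<kappa> 0 [E 1] = 0"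
    unfolding assms(3) by (rule Phi_two[OF _ _ _ eps sec rank0]) auto
  have P1: "Phi (M i j) (p (M i j)) \<epsilon> (pair_par k i j) (pair_par \<alpha> i j) \<kappa> 1 [E 0] = 0"
    unfolding assms(3) by (rule Phi_two[OF _ _ _ eps sec rank1]) auto
  show "mon [E i] * mon [E j] * mon [E i] \<in> J"
    using relator_J[OF BMW_relators.EwE_left[where M = M, OF assms(1,2) M w(1)]] unfolding P0
    by (simp add: mon_mult rename_def)
  show "mon [E j] * mon [E i] * mon [E j] \<in> J"
    using relator_J[OF BMW_relators.EwE_right[where M = M, OF assms(1,2) M w(2)]] unfolding P1
    by (simp add: mon_mult rename_def)
  show "delta i \<noteq> 0"
    using e_scalar_nonzero[OF _ eps sec rank0] delta_e_scalar[of i] assms(1,2)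
    by (simp add: q_par_pair l_par_pair)
  show "delta j \<noteq> 0"
    using e_scalar_nonzero[OF _ eps sec rank1] delta_e_scalar[of j] assms(1,2)
    by (simp add: q_par_pair l_par_pair)
qed

sublocale bmw_algebra n M J cst "\<lambda>i. mon [X i]" "\<lambda>i. mon [Xm i]" "\<lambda>i. mon [E i]"
  "q_par k \<kappa>" "l_par k \<alpha> \<kappa>"
proof
  fix i j assume ij: "i < n" "j < n"
  have swap: "{mon [X i], mon [X j], mon [E i], mon [E j]} = {mon [X j], mon [X i], mon [E j], mon [E i]}"
    by blast
  show "mon [E i] * prod_list ws * mon [E i] \<in> spn {mon [E i]}"
    if "i \<noteq> j" "set ws \<subseteq> {mon [X i], mon [X j], mon [E i], mon [E j]}" for ws
    using that sandwich_pair(1)[of i j ws] sandwich_pair(2)[of j i ws] ij unfolding swap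
    by (cases "i < j") auto
  show "mon [E i] * prod_list ws * mon [E j] \<in> J"
    if "i \<noteq> j" "even (M i j)" "M i j > 2" "set ws \<subseteq> {mon [X i], mon [X j], mon [E i], mon [E j]}" for ws
    using that even_zero_pair(1)[of i j ws] even_zero_pair(2)[of j i ws] ij M_sym[OF ij] unfolding swap
    by (cases "i < j") auto
  assume 2: "M i j = 2"
  then have "i \<noteq> j" using coxeter_M ij by (auto simp: coxeter_matrix_def)
  then show "mon [E i] * mon [E j] * mon [E i] \<in> J" "delta i \<noteq> 0"
    using commuting_pair(1,3)[of i j] commuting_pair(2,4)[of j i] ij 2 M_sym[OF ij]
    by (cases "i < j"; simp)+
qed

lemma mon_alg: "w \<in> lists (letters n) \<Longrightarrow> mon w \<in> alg"
proof (induction w)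
  case Nil
  then show ?case using alg.one by (simp add: one_falg)
next
  case (Cons a w)
  then have a: "a \<in> letters n" and "mon w \<in> alg" by auto
  moreover have "mon [a] \<in> alg" using a alg.x alg.y alg.e by auto
  ultimately have "mon [a] * mon w \<in> alg" by (intro alg.mult)
  then show ?case by (simp add: mon_mult)
qed

lemma carrier_alg:
  assumes "f \<in> carrier R"
  shows "f \<in> alg"
proof -
  have sum: "(\<Sum>w\<in>W. Poly_Mapping.single w (Poly_Mapping.lookup f w)) \<in> alg"
    if "finite W" "W \<subseteq> lists (letters n)" for W
    using that
  proof (induction W)
    case empty
    then show ?case using alg.ideal[OF zero_J] by simp
  next
    case (insert w W)
    have "Poly_Mapping.single w (Poly_Mapping.lookup f w) = cst (Poly_Mapping.lookup f w) * mon w"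
      by (simp add: mult_single plus_list_def)
    moreover have "mon w \<in> alg" by (rule mon_alg) (use insert.prems in blast)
    ultimately show ?case using insert by (auto intro: alg.add alg.scale)
  qed
  have f: "f = (\<Sum>w\<in>Poly_Mapping.keys f. Poly_Mapping.single w (Poly_Mapping.lookup f w))"
    by (rule poly_mapping_eqI) (auto simp: lookup_sum lookup_single when_def in_keys_iff)
  show ?thesis
    by (subst f, rule sum[OF finite_keys]) (use assms in \<open>simp only: carrier_free_algebra\<close>)
qed

text \<open>A finite spanning set modulo \<open>J\<close> may involve foreign words.  Dropping these gives representatives in the free
  algebra, whose classes span the quotient.\<close>

theorem fin_dim_BMW_algebra: "vectorspace.fin_dim class_ring (BMW_algebra n M p \<epsilon> k \<alpha> \<kappa>)"
proof -
  let ?B = "BMW_algebra n M p \<epsilon> k \<alpha> \<kappa>" and ?Q = "R Quot I" and ?cls = "\<lambda>f. I +>\<^bsub>R\<^esub> f"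
  interpret V: vectorspace class_ring ?B by (rule vectorspace_BMW_algebra)
  interpret h: ring_hom_ring R ?Q ?cls by (rule I.rcos_ring_hom_ring)
  have B: "carrier ?B = carrier ?Q" "zero ?B = zero ?Q" "add ?B = add ?Q"
    "\<And>c x. c \<odot>\<^bsub>?B\<^esub> x = ?cls (cst c) \<otimes>\<^bsub>?Q\<^esub> x"
    by (simp_all add: BMW_algebra_def Let_def ring.defs module.defs)
  have cst_R: "cst c \<in> carrier R" for c by (rule mon_carrier) simp
  obtain S where S: "finite S" "alg \<subseteq> spn S" using algebra_finite by blast
  obtain \<pi> where \<pi>: "\<pi> f \<in> carrier R" "f - \<pi> f \<in> foreign n" for f
    using foreign_decompose[of n] by metis
  define A where "A = (\<lambda>f. ?cls (\<pi> f)) ` S"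
  have A: "finite A" "A \<subseteq> carrier ?B"
    using S(1) \<pi>(1) h.hom_closed unfolding A_def B(1) by auto
  interpret sub: submodule class_ring "V.span A" ?B by (rule V.span_is_submodule[OF A(2)])
  have span: "\<exists>f\<in>carrier R. u - f \<in> foreign n \<and> ?cls f \<in> V.span A" if "u \<in> spn S" for u
    using that
  proof induction
    case (ideal z)
    then obtain a where a: "a \<in> I" "z - a \<in> foreign n" unfolding J_def by blast
    have "?cls a = \<zero>\<^bsub>?B\<^esub>" unfolding B(2) using a(1) I.a_rcos_const by (simp add: FactRing_def)
    then show ?case using a I.a_Hcarr sub.zero_closed by metis
  next
    case (base s)
    then have "?cls (\<pi> s) \<in> V.span A" using V.in_own_span[OF A(2)] unfolding A_def by blast
    then show ?case using \<pi> by blast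
  next
    case (add u v)
    then obtain f g where fg: "f \<in> carrier R" "u - f \<in> foreign n" "?cls f \<in> V.span A"
      "g \<in> carrier R" "v - g \<in> foreign n" "?cls g \<in> V.span A" by blast
    have "u + v - (f + g) \<in> foreign n" using foreign_add[OF fg(2,5)] by (simp add: algebra_simps)
    moreover have "?cls (f + g) \<in> V.span A"
      using sub.m_closed[OF fg(3,6)] h.hom_add[OF fg(1,4)] unfolding B(3) by simp
    moreover have "f + g \<in> carrier R" using R.add.m_closed[OF fg(1,4)] by simp
    ultimately show ?case by blast
  next
    case (scale u c)
    then obtain f where f: "f \<in> carrier R" "u - f \<in> foreign n" "?cls f \<in> V.span A" by blast
    have "cst c * u - cst c * f \<in> foreign n"
      using foreign_mult[of "cst c" n "u - f"] f(2) by (simp add: right_diff_distrib)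
    moreover have "?cls (cst c * f) \<in> V.span A"
      using sub.smult_closed[of c, OF _ f(3)] h.hom_mult[OF cst_R f(1), of c] unfolding B(4) by simp
    moreover have "cst c * f \<in> carrier R" using R.m_closed[OF cst_R f(1)] by simp
    ultimately show ?case by blast
  qed
  \<comment> \<open>On the carrier the decomposition is unique, so an element coincides with its representative.\<close>
  have "carrier ?B \<subseteq> V.span A"
  proof
    fix x assume "x \<in> carrier ?B"
    then obtain f where f: "f \<in> carrier R" "x = ?cls f"
      unfolding B(1) FactRing_def by (auto simp: A_RCOSETS_def')
    then obtain g where g: "g \<in> carrier R" "f - g \<in> foreign n" "?cls g \<in> V.span A"
      using span S(2) carrier_alg by blast
    have "f - g \<in> carrier R"
      using f(1) g(1) keys_diff[of f g] unfolding carrier_free_algebra by blast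
    then have "f = g" using foreign_carrier g(2) by fastforce
    then show "x \<in> V.span A" using f(2) g(3) by simp
  qed
  then have "V.gen_set A" using sub.subset by blast
  then show ?thesis unfolding V.fin_dim_def using A by blast
qed

end


theorem theorem5p1:
  fixes n :: nat
    and M :: "nat \<Rightarrow> nat \<Rightarrow> nat"
    and k \<alpha> :: "nat \<Rightarrow> complex"
    and \<kappa> :: complex
    and p :: "nat \<Rightarrow> complex \<times> complex"
    and \<epsilon> :: real
  assumes "coxeter_matrix n M"
    and "finite (carrier (coxeter_group n M))"
    and "BMW_parameters n M k \<alpha>"
    and "\<And>m. m \<ge> 2 \<Longrightarrow> p m \<in> open_sector m"
    and "0 < \<epsilon>" and "\<epsilon> < 1"
    and "BMW_generic n M p \<epsilon> k \<alpha> \<kappa>"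
  shows "vectorspace.fin_dim class_ring (BMW_algebra n M p \<epsilon> k \<alpha> \<kappa>)"
proof -
  interpret bmw_presentation n M k \<alpha> \<kappa> p \<epsilon>
    by unfold_locales (fact assms)+
  show ?thesis by (rule fin_dim_BMW_algebra)
qed

end
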